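(* Let $\wp=(\zeta_1,\dots,\zeta_n,\xi_1,\dots,\xi_n)\in P^{2n}$ and let $M_q^\wp(n)$ be the corresponding modified algebra. Then $M_q^\wp(n)$ is an iterated Ore extension (starting from $\mathbb C$), and hence a domain. Its Hilbert series (with all generators $\tilde Z_{i,j}$ in degree $1$) is the same as that of the commutative polynomial ring in $n^2$ variables. Hence the following relations are defining relations of $M_q^\wp(n)$ on the generators $\tilde Z_{i,j}$, $1\le i,j\le n$: $$\tilde Z_{i,j}\tilde Z_{i,k}=q^{(\alpha_{i,k}|\zeta_i+\xi_j)-(\alpha_{i,j}|\zeta_i+\xi_k)+1}\tilde Z_{i,k}\tilde Z_{i,j}\quad\text{if } j<k,$$ $$\tilde Z_{i,j}\tilde Z_{k,j}=q^{(\alpha_{k,j}|\zeta_i+\xi_j)-(\alpha_{i,j}|\zeta_k+\xi_j)+1}\tilde Z_{k,j}\tilde Z_{i,j}\quad\text{if } i<k,$$ $$\tilde Z_{i,j}\tilde Z_{s,t}=q^{(\alpha_{s,t}|\zeta_i+\xi_j)-(\alpha_{i,j}|\zeta_s+\xi_t)}\tilde Z_{s,t}\tilde Z_{i,j}\quad\text{if } i<s \text{ and } t<j,$$ $$\tilde Z_{i,j}\tilde Z_{s,t}=q^{(\alpha_{s,t}|\zeta_i+\xi_j)-(\alpha_{i,j}|\zeta_s+\xi_t)}\tilde Z_{s,t}\tilde Z_{i,j}+(q-q^{-1})q^{(\alpha_{s,t}|\zeta_i+\xi_j)-(\alpha_{s,j}|\zeta_i+\xi_t)}\tilde Z_{i,t}\tilde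 Z_{s,j}\quad\text{if } i<s \text{ and } j<t.$$
   Context: Let $n\ge1$ and $q\in\mathbb C^*$, $q^2\neq1$. $M_q(n)$ is the $\mathbb C$-algebra generated by $Z_{i,j}$ ($1\le i,j\le n$) with defining relations $Z_{i,j}Z_{i,k}=qZ_{i,k}Z_{i,j}$ if $j<k$; $Z_{i,j}Z_{k,j}=qZ_{k,j}Z_{i,j}$ if $i<k$; $Z_{i,j}Z_{s,t}=Z_{s,t}Z_{i,j}$ if $i<s$, $t<j$; $Z_{i,j}Z_{s,t}=Z_{s,t}Z_{i,j}+(q-q^{-1})Z_{i,t}Z_{s,j}$ if $i<s$, $j<t$. $P$ is the free abelian group (weight lattice of type $A_{2n-1}$) with basis the fundamental weights $\lambda_\beta,\lambda_{\mu_1},\dots,\lambda_{\mu_{n-1}},\lambda_{\nu_1},\dots,\lambda_{\nu_{n-1}}$. The simple roots are $\beta,\mu_1,\dots,\mu_{n-1},\nu_1,\dots,\nu_{n-1}$, and $\alpha_{i,j}=(\mu_1+\dots+\mu_{i-1})+\beta+(\nu_1+\dots+\nu_{j-1})$. The pairing is the bilinear one with $(\lambda_\beta|\alpha_{i,j})=1$, $(\lambda_{\mu_k}|\alpha_{i,j})=1$ if $k<i$ and $0$ otherwise, $(\lambda_{\nu_k}|\alpha_{i,j})=1$ if $k<j$ and $0$ otherwise; write $(\alpha|\lambda)=(\lambda|\alpha)$. Let $\mathcal S$ be the semidirect (smash) product of the Laurent polynomial ring $\mathbb C[L_\lambda:\lambda\in P]$ ($L_\lambda L_{\lambda'}=L_{\lambda+\lambda'}$)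 with $M_q(n)$: as a vector space it is $M_q(n)\otimes\mathbb C[L_\lambda]$, both factors are subalgebras, and $L_\lambda Z_{i,j}=q^{(\lambda|\alpha_{i,j})}Z_{i,j}L_\lambda$. (It is the subalgebra of the quantized enveloping algebra $\mathcal U_q(A_{2n-1})$ generated by the quadratic algebra $M_q(n)$ of quantum root vectors and the $L_\lambda$.) For $\wp=(\zeta_1,\dots,\zeta_n,\xi_1,\dots,\xi_n)\in P^{2n}$ put $\tilde Z_{i,j}=Z_{i,j}L_{\zeta_i}L_{\xi_j}$; the modified algebra $M_q^\wp(n)$ is the subalgebra of $\mathcal S$ generated by all $\tilde Z_{i,j}$. *)

theory Defs
  imports
    "HOL-Algebra.Algebra"
    "HOL-Computational_Algebra.Formal_Power_Series"
begin

section \<open>Free algebras, polynomial rings and presentations over the complex numbers\<close>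

text \<open>Words in an alphabet, written additively, so that \<open>'x free_word \<Rightarrow>\<^sub>0 complex\<close> is the
  monoid algebra of the free monoid, i.e. the free algebra, and its type class multiplication
  is concatenation of words.\<close>

datatype 'x free_word = Word (letters: "'x list")

instantiation free_word :: (type) monoid_add
begin
definition zero_free_word :: "'a free_word"
  where "zero_free_word = Word []"
definition plus_free_word :: "'a free_word \<Rightarrow> 'a free_word \<Rightarrow> 'a free_word"
  where "plus_free_word v w = Word (letters v @ letters w)"
instance
  by standard (simp_all add: zero_free_word_def plus_free_word_def)
end

definition free_algebra :: "'x set \<Rightarrow> ('x free_word \<Rightarrow>\<^sub>0 complex) ring"
  where "free_algebra I =
    \<lparr>carrier = {f. \<forall>w \<in> Poly_Mapping.keys f. set (letters w) \<subseteq> I},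
     monoid.mult = (*), one = 1, ring.zero = 0, add = (+)\<rparr>"

definition free_gen :: "'x \<Rightarrow> ('x free_word \<Rightarrow>\<^sub>0 complex)"
  where "free_gen x = Poly_Mapping.single (Word [x]) 1"

definition free_scalar :: "complex \<Rightarrow> ('x free_word \<Rightarrow>\<^sub>0 complex)"
  where "free_scalar c = Poly_Mapping.single 0 c"

lemma ring_free_algebra: "ring (free_algebra I)"
proof -
  have mult: "f * g \<in> carrier (free_algebra I)"
    if f: "f \<in> carrier (free_algebra I)" and g: "g \<in> carrier (free_algebra I)" for f g
  proof -
    have "set (letters w) \<subseteq> I" if w: "w \<in> Poly_Mapping.keys (f * g)" for w
    proof -
      obtain u v where "w = u + v" "u \<in> Poly_Mapping.keys f" "v \<in> Poly_Mapping.keys g"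
        using keys_mult[of f g] w by blast
      then show ?thesis
        using f g by (auto simp: free_algebra_def plus_free_word_def)
    qed
    then show ?thesis by (simp add: free_algebra_def)
  qed
  have add: "f + g \<in> carrier (free_algebra I)"
    if "f \<in> carrier (free_algebra I)" "g \<in> carrier (free_algebra I)" for f g
    using that Poly_Mapping.keys_add[of f g] by (force simp: free_algebra_def)
  have neg: "- f \<in> carrier (free_algebra I)" if "f \<in> carrier (free_algebra I)" for f
    using that by (simp add: free_algebra_def)
  have one: "1 \<in> carrier (free_algebra I)"
    by (simp add: free_algebra_def zero_free_word_def)
  have zero: "0 \<in> carrier (free_algebra I)"
    by (simp add: free_algebra_def)
  have ops: "f \<otimes>\<^bsub>free_algebra I\<^esub> g = f * g" "f \<oplus>\<^bsub>free_algebra I\<^esub> g = f + g"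
    "\<one>\<^bsub>free_algebra I\<^esub> = 1" "\<zero>\<^bsub>free_algebra I\<^esub> = 0" for f g
    by (simp_all add: free_algebra_def)
  show ?thesis
  proof (rule ringI)
    show "abelian_group (free_algebra I)"
    proof (rule abelian_groupI)
      fix f assume f: "f \<in> carrier (free_algebra I)"
      show "\<exists>g\<in>carrier (free_algebra I).
              g \<oplus>\<^bsub>free_algebra I\<^esub> f = \<zero>\<^bsub>free_algebra I\<^esub>"
        by (rule bexI[OF _ neg[OF f]]) (simp add: ops)
    qed (simp_all add: ops add zero add.assoc add.commute)
    show "Group.monoid (free_algebra I)"
      by (rule monoidI) (simp_all add: ops mult one mult.assoc)
  qed (simp_all add: ops distrib_left distrib_right)
qed

definition comm_polynomial_ring :: "'x set \<Rightarrow> (('x \<Rightarrow>\<^sub>0 nat) \<Rightarrow>\<^sub>0 complex) ring"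
  where "comm_polynomial_ring I =
    \<lparr>carrier = {f. \<forall>m \<in> Poly_Mapping.keys f. Poly_Mapping.keys m \<subseteq> I},
     monoid.mult = (*), one = 1, ring.zero = 0, add = (+)\<rparr>"

definition poly_var :: "'x \<Rightarrow> (('x \<Rightarrow>\<^sub>0 nat) \<Rightarrow>\<^sub>0 complex)"
  where "poly_var x = Poly_Mapping.single (Poly_Mapping.single x 1) 1"

definition poly_scalars :: "(('x \<Rightarrow>\<^sub>0 nat) \<Rightarrow>\<^sub>0 complex) set"
  where "poly_scalars = range (\<lambda>c. Poly_Mapping.single 0 c)"

definition word_product :: "('a, 'm) ring_scheme \<Rightarrow> 'a list \<Rightarrow> 'a"
  where "word_product A xs = foldr (\<otimes>\<^bsub>A\<^esub>) xs \<one>\<^bsub>A\<^esub>"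

text \<open>A complex algebra is a ring \<open>A\<close> together with its structure map \<open>\<iota>\<close> from the
  complex numbers.  The function below substitutes \<open>z x\<close> for the generator \<open>x\<close>.\<close>

definition free_eval ::
    "('a, 'm) ring_scheme \<Rightarrow> (complex \<Rightarrow> 'a) \<Rightarrow> ('x \<Rightarrow> 'a) \<Rightarrow> ('x free_word \<Rightarrow>\<^sub>0 complex) \<Rightarrow> 'a"
  where "free_eval A \<iota> z f =
    (\<Oplus>\<^bsub>A\<^esub>w\<in>Poly_Mapping.keys f.
       \<iota> (Poly_Mapping.lookup f w) \<otimes>\<^bsub>A\<^esub> word_product A (map z (letters w)))"

definition defining_relations ::
    "('a, 'm) ring_scheme \<Rightarrow> (complex \<Rightarrow> 'a) \<Rightarrow> 'x set \<Rightarrow> ('x \<Rightarrow> 'a)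
      \<Rightarrow> ('x free_word \<Rightarrow>\<^sub>0 complex) set \<Rightarrow> bool"
  where "defining_relations A \<iota> I z Rel \<longleftrightarrow>
    free_eval A \<iota> z \<in> ring_hom (free_algebra I) A \<and>
    free_eval A \<iota> z ` carrier (free_algebra I) = carrier A \<and>
    a_kernel (free_algebra I) A (free_eval A \<iota> z) = Idl\<^bsub>free_algebra I\<^esub> Rel"


section \<open>Domains, Ore extensions and Hilbert series\<close>

text \<open>The library's \<^locale>\<open>domain\<close> includes commutativity.\<close>

definition noncomm_domain :: "('a, 'm) ring_scheme \<Rightarrow> bool"
  where "noncomm_domain A \<longleftrightarrow>
    ring A \<and> \<one>\<^bsub>A\<^esub> \<noteq> \<zero>\<^bsub>A\<^esub> \<and>
    (\<forall>a\<in>carrier A. \<forall>b\<in>carrier A.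
       a \<otimes>\<^bsub>A\<^esub> b = \<zero>\<^bsub>A\<^esub> \<longrightarrow> a = \<zero>\<^bsub>A\<^esub> \<or> b = \<zero>\<^bsub>A\<^esub>)"

definition skew_derivation :: "('a, 'm) ring_scheme \<Rightarrow> 'a set \<Rightarrow> ('a \<Rightarrow> 'a) \<Rightarrow> ('a \<Rightarrow> 'a) \<Rightarrow> bool"
  where "skew_derivation A R \<sigma> \<delta> \<longleftrightarrow>
    \<delta> \<in> R \<rightarrow> R \<and>
    (\<forall>a\<in>R. \<forall>b\<in>R. \<delta> (a \<oplus>\<^bsub>A\<^esub> b) = \<delta> a \<oplus>\<^bsub>A\<^esub> \<delta> b) \<and>
    (\<forall>a\<in>R. \<forall>b\<in>R.
       \<delta> (a \<otimes>\<^bsub>A\<^esub> b) = \<sigma> a \<otimes>\<^bsub>A\<^esub> \<delta> b \<oplus>\<^bsub>A\<^esub> \<delta> a \<otimes>\<^bsub>A\<^esub> b)"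

text \<open>For subrings \<open>R\<close>, \<open>T\<close> of \<open>A\<close>: \<open>T = R[x; \<sigma>, \<delta>]\<close> for some \<open>x \<in> T\<close>, some automorphism
  \<open>\<sigma>\<close> of \<open>R\<close> and some \<open>\<sigma>\<close>-derivation \<open>\<delta>\<close> of \<open>R\<close>.  That is, \<open>T\<close> is a free left \<open>R\<close>-module
  on the powers of \<open>x\<close>, and \<open>x r = \<sigma>(r) x + \<delta>(r)\<close>.\<close>

definition Ore_extension :: "('a, 'm) ring_scheme \<Rightarrow> 'a set \<Rightarrow> 'a set \<Rightarrow> bool"
  where "Ore_extension A R T \<longleftrightarrow>
    subring R A \<and> subring T A \<and> R \<subseteq> T \<and>
    (\<exists>x\<in>T. \<exists>\<sigma> \<delta>.
       \<sigma> \<in> ring_iso (A\<lparr>carrier := R\<rparr>) (A\<lparr>carrier := R\<rparr>) \<and>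
       skew_derivation A R \<sigma> \<delta> \<and>
       (\<forall>r\<in>R. x \<otimes>\<^bsub>A\<^esub> r = \<sigma> r \<otimes>\<^bsub>A\<^esub> x \<oplus>\<^bsub>A\<^esub> \<delta> r) \<and>
       (\<forall>t\<in>T. \<exists>!c :: nat \<Rightarrow> 'a.
          (\<forall>i. c i \<in> R) \<and> finite {i. c i \<noteq> \<zero>\<^bsub>A\<^esub>} \<and>
          t = (\<Oplus>\<^bsub>A\<^esub>i\<in>{i. c i \<noteq> \<zero>\<^bsub>A\<^esub>}. c i \<otimes>\<^bsub>A\<^esub> (x [^]\<^bsub>A\<^esub> i))))"

inductive iterated_Ore_extension :: "('a, 'm) ring_scheme \<Rightarrow> 'a set \<Rightarrow> 'a set \<Rightarrow> bool"
  for A :: "('a, 'm) ring_scheme" and K :: "'a set"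
  where
    base: "subring K A \<Longrightarrow> iterated_Ore_extension A K K"
  | step: "iterated_Ore_extension A K R \<Longrightarrow> Ore_extension A R T \<Longrightarrow> iterated_Ore_extension A K T"

text \<open>In the following definitions \<open>K\<close> is the subfield of scalars of \<open>A\<close>, as for
  \<^const>\<open>ring.Span\<close> and \<^const>\<open>ring.dimension\<close>.  The first one is the \<open>K\<close>-span of all
  products of \<open>d\<close> elements of \<open>G\<close>.\<close>

definition degree_part :: "('a, 'm) ring_scheme \<Rightarrow> 'a set \<Rightarrow> 'a set \<Rightarrow> nat \<Rightarrow> 'a set"
  where "degree_part A K G d =
    \<Union> {ring.Span A K us | us. set us \<subseteq> {word_product A xs | xs. set xs \<subseteq> G \<and> length xs = d}}"

definition is_grading :: "('a, 'm) ring_scheme \<Rightarrow> (nat \<Rightarrow> 'a set) \<Rightarrow> bool"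
  where "is_grading A V \<longleftrightarrow>
    (\<forall>d. subgroup (V d) (add_monoid A)) \<and>
    \<one>\<^bsub>A\<^esub> \<in> V 0 \<and>
    (\<forall>d e. \<forall>a\<in>V d. \<forall>b\<in>V e. a \<otimes>\<^bsub>A\<^esub> b \<in> V (d + e)) \<and>
    (\<forall>a\<in>carrier A. \<exists>!c :: nat \<Rightarrow> 'a.
       (\<forall>d. c d \<in> V d) \<and> finite {d. c d \<noteq> \<zero>\<^bsub>A\<^esub>} \<and>
       a = (\<Oplus>\<^bsub>A\<^esub>d\<in>{d. c d \<noteq> \<zero>\<^bsub>A\<^esub>}. c d))"

text \<open>Placing the elements of \<open>G\<close> in degree 1 makes \<open>A\<close> a graded algebra with
  finite-dimensional components and Hilbert series \<open>h\<close>.\<close>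

definition has_Hilbert_series :: "('a, 'm) ring_scheme \<Rightarrow> 'a set \<Rightarrow> 'a set \<Rightarrow> nat fps \<Rightarrow> bool"
  where "has_Hilbert_series A K G h \<longleftrightarrow>
    is_grading A (degree_part A K G) \<and>
    (\<forall>d. ring.dimension A (fps_nth h d) K (degree_part A K G d))"


section \<open>Weights and roots\<close>

datatype node = Beta | Mu nat | Nu nat

definition nodes :: "nat \<Rightarrow> node set"
  where "nodes n = {Beta} \<union> Mu ` {1..<n} \<union> Nu ` {1..<n}"

text \<open>A weight is given by its coordinates in the basis of fundamental weights, an element of
  the root lattice by its coordinates in the basis of simple roots.\<close>

type_synonym weight = "node \<Rightarrow>\<^sub>0 int"
type_synonym root = "node \<Rightarrow>\<^sub>0 int"

definition weight_lattice :: "nat \<Rightarrow> weight set"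
  where "weight_lattice n = carrier (free_Abelian_group (nodes n))"

definition alpha :: "nat \<Rightarrow> nat \<Rightarrow> root"
  where "alpha i j = (\<Sum>k\<in>{1..<i}. frag_of (Mu k)) + frag_of Beta + (\<Sum>k\<in>{1..<j}. frag_of (Nu k))"

definition pairing :: "weight \<Rightarrow> root \<Rightarrow> int"
  where "pairing l a =
    (\<Sum>k\<in>Poly_Mapping.keys l. Poly_Mapping.lookup l k * Poly_Mapping.lookup a k)"

lemma pairing_superset:
  assumes "finite S" "Poly_Mapping.keys l \<subseteq> S"
  shows "pairing l a = (\<Sum>k\<in>S. Poly_Mapping.lookup l k * Poly_Mapping.lookup a k)"
  unfolding pairing_def
  by (rule sum.mono_neutral_left) (use assms in \<open>auto simp: in_keys_iff\<close>)

lemma pairing_add_left: "pairing (l + l') a = pairing l a + pairing l' a"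
proof -
  let ?S = "Poly_Mapping.keys l \<union> Poly_Mapping.keys l'"
  have "Poly_Mapping.keys (l + l') \<subseteq> ?S"
    by (rule Poly_Mapping.keys_add)
  then show ?thesis
    by (subst (1 2 3) pairing_superset[of ?S])
      (auto simp: lookup_add sum.distrib distrib_right)
qed

lemma pairing_add_right: "pairing l (a + a') = pairing l a + pairing l a'"
  by (simp add: pairing_def lookup_add sum.distrib distrib_left)

lemma pairing_alpha:
  "pairing (frag_of Beta) (alpha i j) = 1"
  "k \<ge> 1 \<Longrightarrow> pairing (frag_of (Mu k)) (alpha i j) = (if k < i then 1 else 0)"
  "k \<ge> 1 \<Longrightarrow> pairing (frag_of (Nu k)) (alpha i j) = (if k < j then 1 else 0)"
  by (auto simp: pairing_def alpha_def lookup_add lookup_sum lookup_single when_def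
        simp del: lookup_frag_of)


section \<open>The quadratic algebra\<close>

type_synonym free_mat = "(nat \<times> nat) free_word \<Rightarrow>\<^sub>0 complex"

definition mat_indices :: "nat \<Rightarrow> (nat \<times> nat) set"
  where "mat_indices n = {1..n} \<times> {1..n}"

abbreviation gen :: "nat \<Rightarrow> nat \<Rightarrow> free_mat"
  where "gen i j \<equiv> free_gen (i, j)"

text \<open>A relation \<open>u = v\<close> is represented by the element \<open>u - v\<close> of the free algebra.\<close>

definition Mq_relations :: "nat \<Rightarrow> complex \<Rightarrow> free_mat set"
  where "Mq_relations n q =
    {gen i j * gen i k - free_scalar q * gen i k * gen i j | i j k.
       i \<in> {1..n} \<and> j \<in> {1..n} \<and> k \<in> {1..n} \<and> j < k} \<union>
    {gen i j * gen k j - free_scalar q * gen k j * gen i j | i j k.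
       i \<in> {1..n} \<and> j \<in> {1..n} \<and> k \<in> {1..n} \<and> i < k} \<union>
    {gen i j * gen s t - gen s t * gen i j | i j s t.
       i \<in> {1..n} \<and> j \<in> {1..n} \<and> s \<in> {1..n} \<and> t \<in> {1..n} \<and> i < s \<and> t < j} \<union>
    {gen i j * gen s t - (gen s t * gen i j + free_scalar (q - inverse q) * gen i t * gen s j) | i j s t.
       i \<in> {1..n} \<and> j \<in> {1..n} \<and> s \<in> {1..n} \<and> t \<in> {1..n} \<and> i < s \<and> j < t}"

definition Mq_ideal :: "nat \<Rightarrow> complex \<Rightarrow> free_mat set"
  where "Mq_ideal n q = Idl\<^bsub>free_algebra (mat_indices n)\<^esub> (Mq_relations n q)"

definition Mq :: "nat \<Rightarrow> complex \<Rightarrow> free_mat set ring"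
  where "Mq n q = free_algebra (mat_indices n) Quot Mq_ideal n q"

definition Mq_class :: "nat \<Rightarrow> complex \<Rightarrow> free_mat \<Rightarrow> free_mat set"
  where "Mq_class n q f = Mq_ideal n q +>\<^bsub>free_algebra (mat_indices n)\<^esub> f"


section \<open>The smash product and the modified algebra\<close>

text \<open>For an action of the abelian group \<open>P\<close> on a ring \<open>M\<close>, a finitely supported function
  \<open>f\<close> stands for the sum of the \<open>f l \<otimes> L\<^sub>l\<close> over \<open>l \<in> P\<close>; the product is determined by
  \<open>(a L\<^sub>l) (b L\<^sub>m) = a (l . b) L\<^sub>l\<^sub>+\<^sub>m\<close>.\<close>

definition smash_product ::
    "('m, 'b) ring_scheme \<Rightarrow> ('p::ab_group_add) set \<Rightarrow> ('p \<Rightarrow> 'm \<Rightarrow> 'm) \<Rightarrow> ('p \<Rightarrow> 'm) ring"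
  where "smash_product M P act =
    \<lparr>carrier = {f. (\<forall>l. f l \<in> carrier M) \<and> finite {l. f l \<noteq> \<zero>\<^bsub>M\<^esub>} \<and>
                   {l. f l \<noteq> \<zero>\<^bsub>M\<^esub>} \<subseteq> P},
     monoid.mult = (\<lambda>f g l.
        \<Oplus>\<^bsub>M\<^esub>p\<in>{(m, m'). f m \<noteq> \<zero>\<^bsub>M\<^esub> \<and> g m' \<noteq> \<zero>\<^bsub>M\<^esub> \<and> m + m' = l}.
          f (fst p) \<otimes>\<^bsub>M\<^esub> act (fst p) (g (snd p))),
     one = (\<lambda>l. if l = 0 then \<one>\<^bsub>M\<^esub> else \<zero>\<^bsub>M\<^esub>),
     ring.zero = (\<lambda>l. \<zero>\<^bsub>M\<^esub>),
     add = (\<lambda>f g l. f l \<oplus>\<^bsub>M\<^esub> g l)\<rparr>"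

definition smash_tensor :: "('m, 'b) ring_scheme \<Rightarrow> 'm \<Rightarrow> 'p \<Rightarrow> ('p \<Rightarrow> 'm)"
  where "smash_tensor M a l = (\<lambda>m. if m = l then a else \<zero>\<^bsub>M\<^esub>)"

definition word_root :: "(nat \<times> nat) free_word \<Rightarrow> root"
  where "word_root w = (\<Sum>(i, j)\<leftarrow>letters w. alpha i j)"

definition free_weight_action :: "complex \<Rightarrow> weight \<Rightarrow> free_mat \<Rightarrow> free_mat"
  where "free_weight_action q l f =
    Poly_Mapping.mapp (\<lambda>w c. q powi (pairing l (word_root w)) * c) f"

text \<open>The defining relations are homogeneous with respect to \<^const>\<open>word_root\<close>, so
  the action preserves their ideal and maps cosets onto cosets.\<close>

definition Mq_weight_action :: "complex \<Rightarrow> weight \<Rightarrow> free_mat set \<Rightarrow> free_mat set"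
  where "Mq_weight_action q l C = free_weight_action q l ` C"

type_synonym smash_elt = "weight \<Rightarrow> free_mat set"

definition Sq :: "nat \<Rightarrow> complex \<Rightarrow> smash_elt ring"
  where "Sq n q = smash_product (Mq n q) (weight_lattice n) (Mq_weight_action q)"

definition Sq_scalar :: "nat \<Rightarrow> complex \<Rightarrow> complex \<Rightarrow> smash_elt"
  where "Sq_scalar n q c = smash_tensor (Mq n q) (Mq_class n q (free_scalar c)) 0"

definition Sq_Z :: "nat \<Rightarrow> complex \<Rightarrow> nat \<Rightarrow> nat \<Rightarrow> smash_elt"
  where "Sq_Z n q i j = smash_tensor (Mq n q) (Mq_class n q (gen i j)) 0"

definition Sq_L :: "nat \<Rightarrow> complex \<Rightarrow> weight \<Rightarrow> smash_elt"
  where "Sq_L n q l = smash_tensor (Mq n q) \<one>\<^bsub>Mq n q\<^esub> l"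

text \<open>In the following, \<open>\<zeta>\<close> and \<open>\<xi>\<close> are the two halves of the parameter in \<open>P\<^sup>2\<^sup>n\<close>;
  only their values on \<open>{1..n}\<close> matter.\<close>

definition mod_Z :: "nat \<Rightarrow> complex \<Rightarrow> (nat \<Rightarrow> weight) \<Rightarrow> (nat \<Rightarrow> weight) \<Rightarrow> nat \<times> nat \<Rightarrow> smash_elt"
  where "mod_Z n q \<zeta> \<xi> = (\<lambda>(i, j).
    Sq_Z n q i j \<otimes>\<^bsub>Sq n q\<^esub> Sq_L n q (\<zeta> i) \<otimes>\<^bsub>Sq n q\<^esub> Sq_L n q (\<xi> j))"

definition mod_Mq :: "nat \<Rightarrow> complex \<Rightarrow> (nat \<Rightarrow> weight) \<Rightarrow> (nat \<Rightarrow> weight) \<Rightarrow> smash_elt ring"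
  where "mod_Mq n q \<zeta> \<xi> = (Sq n q)\<lparr>carrier :=
    generate_ring (Sq n q) (range (Sq_scalar n q) \<union> mod_Z n q \<zeta> \<xi> ` mat_indices n)\<rparr>"

definition mod_Mq_relations ::
    "nat \<Rightarrow> complex \<Rightarrow> (nat \<Rightarrow> weight) \<Rightarrow> (nat \<Rightarrow> weight) \<Rightarrow> free_mat set"
  where "mod_Mq_relations n q \<zeta> \<xi> =
    {gen i j * gen i k
       - free_scalar (q powi (pairing (\<zeta> i + \<xi> j) (alpha i k)
                              - pairing (\<zeta> i + \<xi> k) (alpha i j) + 1)) * gen i k * gen i j | i j k.
       i \<in> {1..n} \<and> j \<in> {1..n} \<and> k \<in> {1..n} \<and> j < k} \<union>
    {gen i j * gen k j
       - free_scalar (q powi (pairing (\<zeta> i + \<xi> j) (alpha k j)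
                              - pairing (\<zeta> k + \<xi> j) (alpha i j) + 1)) * gen k j * gen i j | i j k.
       i \<in> {1..n} \<and> j \<in> {1..n} \<and> k \<in> {1..n} \<and> i < k} \<union>
    {gen i j * gen s t
       - free_scalar (q powi (pairing (\<zeta> i + \<xi> j) (alpha s t)
                              - pairing (\<zeta> s + \<xi> t) (alpha i j))) * gen s t * gen i j | i j s t.
       i \<in> {1..n} \<and> j \<in> {1..n} \<and> s \<in> {1..n} \<and> t \<in> {1..n} \<and> i < s \<and> t < j} \<union>
    {gen i j * gen s t
       - (free_scalar (q powi (pairing (\<zeta> i + \<xi> j) (alpha s t)
                               - pairing (\<zeta> s + \<xi> t) (alpha i j))) * gen s t * gen i j
          + free_scalar ((q - inverse q)
              * q powi (pairing (\<zeta> i + \<xi> j) (alpha s t)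
                        - pairing (\<zeta> i + \<xi> t) (alpha s j))) * gen i t * gen s j) | i j s t.
       i \<in> {1..n} \<and> j \<in> {1..n} \<and> s \<in> {1..n} \<and> t \<in> {1..n} \<and> i < s \<and> j < t}"

end

theory Submission
  imports Defs "HOL-Library.Product_Lexorder"
begin

text \<open>
  The theorem is about a basis.  Order the generators \<open>z\<^sub>i\<^sub>j\<close> of the modified algebra
  lexicographically.  The relations say that, for \<open>a < b\<close>, the product \<open>z\<^sub>b z\<^sub>a\<close> is a nonzero multiple of
  \<open>z\<^sub>a z\<^sub>b\<close> plus a quadratic polynomial in generators below \<open>b\<close>.  Two consequences
  are purely formal.

  First, let \<open>R\<close> be generated by the letters below \<open>b\<close>.  Then \<open>z\<^sub>b r\<close> always has the form
  \<open>\<sigma>(r) z\<^sub>b + \<delta>(r)\<close> with \<open>\<sigma>(r), \<delta>(r) \<in> R\<close>, so powers of \<open>z\<^sub>b\<close> can be collected on the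
  right, and by induction the ordered monomials span (\<open>homogeneous_normal_form\<close>).  This uses the relations
  only, so it holds in the abstractly presented algebra too.

  Secondly, suppose that the ordered monomials are also linearly independent in the concrete
  algebra (\<open>pbw_algebra\<close>).  Then coefficients of powers of \<open>z\<^sub>b\<close> are unique, \<open>\<sigma>\<close> and \<open>\<delta>\<close> are well defined, and \<open>\<sigma>\<close>,
  which rescales every word by a nonzero number, is an automorphism; adding one letter after
  the other gives an iterated Ore extension (\<open>Ore_extension_layer\<close>).  Comparing leading coefficients
  shows that an Ore extension of a domain is a domain.  The ordered words of length \<open>d\<close> are a basis of the
  component of degree \<open>d\<close>, and their number depends on the alphabet alone; the commutative polynomial
  ring satisfies the same hypotheses, whence the same Hilbert series.  Finally, an element
  of the kernel of the evaluation map is congruent, modulo the ideal of the relations, to a combination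
  of ordered words that evaluates to zero, hence to zero: the relations are defining.

  It remains to prove independence.  A monomial in the \<open>z\<^sub>i\<^sub>j\<close> is a nonzero
  multiple of the same monomial in the \<open>Z\<^sub>i\<^sub>j\<close>, times some \<open>L\<^sub>\<lambda>\<close>.  Looking at the coefficient of each
  \<open>L\<^sub>\<lambda>\<close> reduces the claim to the quadratic algebra (\<open>mod_monomials_independent\<close>).  There it is proved with a
  representation on functions on a lattice.  The relations of a quantum matrix can be written
  as one equation, which is inherited by the product of two matrices if the entries of one
  commute with those of the other (\<open>quantum_matrix_mult\<close>).  Starting from lower triangular matrices of weighted shifts,
  which satisfy it by an identity between powers of \<open>q\<close>, one builds a square quantum matrix
  whose entries are sums over lattice paths.  For a suitable height on the lattice the straight path
  dominates all others (\<open>path_matrix_leading_term\<close>), so a monomial sends a point mass to a function whose unique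
  highest point records the exponents of the monomial.
\<close>

section \<open>Free algebras\<close>

lemma poly_mapping_sum_single: "(\<Sum>w\<in>Poly_Mapping.keys f. Poly_Mapping.single w (Poly_Mapping.lookup f w)) = f"
proof (rule poly_mapping_eqI)
  fix v
  have "(\<Sum>w\<in>Poly_Mapping.keys f. Poly_Mapping.lookup (Poly_Mapping.single w (Poly_Mapping.lookup f w)) v) =
        (\<Sum>w\<in>Poly_Mapping.keys f. if w = v then Poly_Mapping.lookup f v else 0)"
    by (intro sum.cong refl) (simp add: lookup_single when_def)
  then show "Poly_Mapping.lookup (\<Sum>w\<in>Poly_Mapping.keys f. Poly_Mapping.single w (Poly_Mapping.lookup f w)) v
             = Poly_Mapping.lookup f v"
    by (simp add: lookup_sum in_keys_iff)
qed

definition supported_on :: "'a set \<Rightarrow> ('a \<Rightarrow>\<^sub>0 'b::zero) set"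
  where "supported_on W = {f. Poly_Mapping.keys f \<subseteq> W}"

lemma supported_on_induct [consumes 1, case_names zero single add]:
  fixes f :: "'a \<Rightarrow>\<^sub>0 'b::comm_monoid_add"
  assumes f: "f \<in> supported_on W"
    and zero: "P 0"
    and single: "\<And>w a. w \<in> W \<Longrightarrow> P (Poly_Mapping.single w a)"
    and add: "\<And>f g. f \<in> supported_on W \<Longrightarrow> g \<in> supported_on W \<Longrightarrow> P f \<Longrightarrow> P g \<Longrightarrow> P (f + g)"
  shows "P f"
proof -
  have closed: "f + g \<in> supported_on W" if "f \<in> supported_on W" "g \<in> supported_on W" for f g :: "'a \<Rightarrow>\<^sub>0 'b"
    using that Poly_Mapping.keys_add[of f g] by (auto simp: supported_on_def)
  have "(\<Sum>w\<in>S. Poly_Mapping.single w (Poly_Mapping.lookup f w)) \<in> supported_on W \<and>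
        P (\<Sum>w\<in>S. Poly_Mapping.single w (Poly_Mapping.lookup f w))" if "finite S" "S \<subseteq> W" for S
    using that
  proof (induction S)
    case empty
    then show ?case by (simp add: zero supported_on_def)
  next
    case (insert w S)
    moreover have "Poly_Mapping.single w (Poly_Mapping.lookup f w) \<in> supported_on W"
      using insert.prems by (simp add: supported_on_def)
    ultimately show ?case by (simp add: closed single add)
  qed
  from this[of "Poly_Mapping.keys f"] show ?thesis
    using f by (simp add: poly_mapping_sum_single supported_on_def)
qed

lemma supported_on_mono: "V \<subseteq> W \<Longrightarrow> supported_on V \<subseteq> supported_on W"
  by (auto simp: supported_on_def)

lemma supported_on_closed [simp]:
  "0 \<in> supported_on W"
  "Poly_Mapping.single w a \<in> supported_on W \<longleftrightarrow> a = 0 \<or> w \<in> W"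
  "f \<in> supported_on W \<Longrightarrow> g \<in> supported_on W \<Longrightarrow> f + g \<in> supported_on W"
  by (use Poly_Mapping.keys_add[of f g] in \<open>auto simp: supported_on_def\<close>)

lemma supported_on_diff [simp]:
  fixes f g :: "'a \<Rightarrow>\<^sub>0 'b::ab_group_add"
  shows "f \<in> supported_on W \<Longrightarrow> - f \<in> supported_on W"
    "f \<in> supported_on W \<Longrightarrow> g \<in> supported_on W \<Longrightarrow> f - g \<in> supported_on W"
  by (auto simp: supported_on_def in_keys_iff lookup_minus subset_iff) metis

lemma supported_on_sum:
  "(\<And>x. x \<in> S \<Longrightarrow> f x \<in> supported_on W) \<Longrightarrow> (\<Sum>x\<in>S. f x) \<in> supported_on W"
  by (induction S rule: infinite_finite_induct) auto

definition words :: "'x set \<Rightarrow> 'x free_word set"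
  where "words I = {w. set (letters w) \<subseteq> I}"

definition words_of_length :: "'x set \<Rightarrow> nat \<Rightarrow> 'x free_word set"
  where "words_of_length I d = {w \<in> words I. length (letters w) = d}"

definition sorted_words :: "'x::linorder set \<Rightarrow> 'x free_word set"
  where "sorted_words I = {w \<in> words I. sorted (letters w)}"

lemma sorted_words_eqI:
  assumes "v \<in> sorted_words I" "w \<in> sorted_words I"
    and "\<And>x. count_list (letters v) x = count_list (letters w) x"
  shows "v = w"
proof -
  have "mset (letters v) = mset (letters w)"
    using assms(3) by (intro multiset_eqI) (simp add: count_mset)
  moreover have "sorted (letters v)" "sorted (letters w)"
    using assms by (simp_all add: sorted_words_def)
  ultimately have "letters v = letters w"
    by (metis properties_for_sort)
  then show ?thesis by (rule free_word.expand)
qed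

lemma carrier_free_algebra: "carrier (free_algebra I) = supported_on (words I)"
  by (auto simp: free_algebra_def supported_on_def words_def)

lemma free_algebra_simps [simp]:
  "f \<otimes>\<^bsub>free_algebra I\<^esub> g = f * g" "f \<oplus>\<^bsub>free_algebra I\<^esub> g = f + g"
  "\<one>\<^bsub>free_algebra I\<^esub> = 1" "\<zero>\<^bsub>free_algebra I\<^esub> = 0"
  by (simp_all add: free_algebra_def)

lemma supported_on_mult:
  fixes f g :: "'a::monoid_add \<Rightarrow>\<^sub>0 'b::semiring_0"
  assumes "f \<in> supported_on V" "g \<in> supported_on W" "\<And>v w. v \<in> V \<Longrightarrow> w \<in> W \<Longrightarrow> v + w \<in> U"
  shows "f * g \<in> supported_on U"
  using assms keys_mult[of f g] unfolding supported_on_def by fast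

lemma letters_add [simp]: "letters (v + w) = letters v @ letters w" "letters 0 = []"
  by (simp_all add: plus_free_word_def zero_free_word_def)

lemma words_add [simp]: "v + w \<in> words I \<longleftrightarrow> v \<in> words I \<and> w \<in> words I" "0 \<in> words I"
  by (auto simp: words_def)

lemma free_closed [simp]:
  "f \<in> supported_on (words I) \<Longrightarrow> g \<in> supported_on (words I) \<Longrightarrow> f * g \<in> supported_on (words I)"
  "1 \<in> supported_on (words I)"
  "free_gen x \<in> supported_on (words I) \<longleftrightarrow> x \<in> I"
  "free_scalar a \<in> supported_on (words I)"
  using supported_on_mult[of f "words I" g "words I" "words I"]
  by (simp_all add: free_gen_def free_scalar_def words_def flip: single_one)

lemma free_power_closed [simp]: "f \<in> supported_on (words I) \<Longrightarrow> f ^ m \<in> supported_on (words I)"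
  by (induction m) auto

lemma free_a_inv:
  assumes "f \<in> supported_on (words I)"
  shows "\<ominus>\<^bsub>free_algebra I\<^esub> f = - f"
proof -
  interpret ring "free_algebra I" by (rule ring_free_algebra)
  show ?thesis
    using assms minus_equality[of "- f" f] by (simp add: carrier_free_algebra)
qed

lemma free_scalar_simps:
  "free_scalar (a + b) = free_scalar a + free_scalar b"
  "free_scalar (a * b) = free_scalar a * free_scalar b"
  "free_scalar 1 = 1" "free_scalar 0 = 0" "free_scalar (- a) = - free_scalar a"
  by (simp_all add: free_scalar_def single_add mult_single single_uminus)

lemma free_scalar_central: "free_scalar a * f = f * free_scalar a"
proof -
  have "f \<in> supported_on UNIV" by (simp add: supported_on_def)
  then show ?thesis
    by (induction f rule: supported_on_induct) (simp_all add: free_scalar_def mult_single mult.commute algebra_simps)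
qed

lemma single_Cons: "Poly_Mapping.single (Word (x # xs)) a = free_gen x * Poly_Mapping.single (Word xs) a"
  by (simp add: free_gen_def mult_single plus_free_word_def)

section \<open>Evaluation in a complex algebra\<close>

locale complex_algebra = ring A for A :: "('a, 'm) ring_scheme" (structure) +
  fixes \<iota> :: "complex \<Rightarrow> 'a"
  assumes scalar_closed [simp]: "\<iota> a \<in> carrier A"
    and scalar_add: "\<iota> (a + b) = \<iota> a \<oplus> \<iota> b"
    and scalar_mult: "\<iota> (a * b) = \<iota> a \<otimes> \<iota> b"
    and scalar_one: "\<iota> 1 = \<one>"
    and scalar_central: "x \<in> carrier A \<Longrightarrow> \<iota> a \<otimes> x = x \<otimes> \<iota> a"
begin

lemma scalar_zero [simp]: "\<iota> 0 = \<zero>"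
  using scalar_add[of 0 0] by (simp add: add.l_cancel_one)

lemma word_product_closed [simp]: "set xs \<subseteq> carrier A \<Longrightarrow> word_product A xs \<in> carrier A"
  by (induction xs) (auto simp: word_product_def)

lemma word_product_simps [simp]:
  "word_product A [] = \<one>" "word_product A (x # xs) = x \<otimes> word_product A xs"
  by (simp_all add: word_product_def)

lemma word_product_append:
  "set xs \<subseteq> carrier A \<Longrightarrow> set ys \<subseteq> carrier A \<Longrightarrow>
    word_product A (xs @ ys) = word_product A xs \<otimes> word_product A ys"
  by (induction xs) (auto simp: m_assoc)

context
  fixes z :: "'x \<Rightarrow> 'a" and I :: "'x set"
  assumes z: "z ` I \<subseteq> carrier A"
begin

lemma word_eval_closed: "w \<in> words I \<Longrightarrow> word_product A (map z (letters w)) \<in> carrier A"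
  using z by (intro word_product_closed) (auto simp: words_def)

lemma free_eval_superset:
  assumes "finite S" "Poly_Mapping.keys f \<subseteq> S" "S \<subseteq> words I"
  shows "free_eval A \<iota> z f = (\<Oplus>w\<in>S. \<iota> (Poly_Mapping.lookup f w) \<otimes> word_product A (map z (letters w)))"
proof -
  have "w \<in> S - Poly_Mapping.keys f \<Longrightarrow> \<iota> (Poly_Mapping.lookup f w) \<otimes> word_product A (map z (letters w)) = \<zero>" for w
    using assms word_eval_closed[of w] by (auto simp: in_keys_iff)
  then show ?thesis
    unfolding free_eval_def using assms word_eval_closed
    by (intro add.finprod_mono_neutral_cong_left) auto
qed

lemma free_eval_zero [simp]: "free_eval A \<iota> z 0 = \<zero>"
  by (simp add: free_eval_def)

lemma free_eval_single [simp]: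
  assumes "w \<in> words I"
  shows "free_eval A \<iota> z (Poly_Mapping.single w a) = \<iota> a \<otimes> word_product A (map z (letters w))"
  using assms word_eval_closed[OF assms]
  by (subst free_eval_superset[where S="{w}"]) (auto simp: Poly_Mapping.keys_single)

lemma free_eval_closed [simp]:
  assumes "f \<in> supported_on (words I)" shows "free_eval A \<iota> z f \<in> carrier A"
  unfolding free_eval_def using assms word_eval_closed
  by (intro finsum_closed) (auto simp: supported_on_def)

lemma free_eval_add [simp]:
  assumes "f \<in> supported_on (words I)" "g \<in> supported_on (words I)"
  shows "free_eval A \<iota> z (f + g) = free_eval A \<iota> z f \<oplus> free_eval A \<iota> z g"
proof -
  let ?S = "Poly_Mapping.keys f \<union> Poly_Mapping.keys g"
  have S: "finite ?S" "?S \<subseteq> words I" "Poly_Mapping.keys (f + g) \<subseteq> ?S"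
    using assms Poly_Mapping.keys_add[of f g] by (auto simp: supported_on_def)
  have "free_eval A \<iota> z (f + g) =
    (\<Oplus>w\<in>?S. \<iota> (Poly_Mapping.lookup f w) \<otimes> word_product A (map z (letters w)) \<oplus>
             \<iota> (Poly_Mapping.lookup g w) \<otimes> word_product A (map z (letters w)))"
    unfolding free_eval_superset[OF S(1,3,2)] using S word_eval_closed
    by (intro add.finprod_cong') (auto simp: lookup_add scalar_add l_distr subset_iff)
  also have "\<dots> = free_eval A \<iota> z f \<oplus> free_eval A \<iota> z g"
    using S word_eval_closed
    by (subst (1 2) free_eval_superset[where S="?S"]) (auto intro!: finsum_addf simp: subset_iff)
  finally show ?thesis .
qed

lemma free_eval_mult [simp]:
  assumes f: "f \<in> supported_on (words I)" and g: "g \<in> supported_on (words I)"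
  shows "free_eval A \<iota> z (f * g) = free_eval A \<iota> z f \<otimes> free_eval A \<iota> z g"
  using f
proof (induction f rule: supported_on_induct)
  case (single v a)
  from g show ?case
  proof (induction g rule: supported_on_induct)
    case (single w b)
    have V: "word_product A (map z (letters v)) \<in> carrier A" and W: "word_product A (map z (letters w)) \<in> carrier A"
      using word_eval_closed \<open>v \<in> words I\<close> single by auto
    have "set (map z (letters v)) \<subseteq> carrier A" "set (map z (letters w)) \<subseteq> carrier A"
      using z \<open>v \<in> words I\<close> single by (auto simp: words_def)
    then have "free_eval A \<iota> z (Poly_Mapping.single v a * Poly_Mapping.single w b) =
      \<iota> a \<otimes> \<iota> b \<otimes> (word_product A (map z (letters v)) \<otimes> word_product A (map z (letters w)))"
      using \<open>v \<in> words I\<close> single by (simp add: mult_single word_product_append scalar_mult)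
    also have "\<dots> = \<iota> a \<otimes> (\<iota> b \<otimes> word_product A (map z (letters v))) \<otimes> word_product A (map z (letters w))"
      using V W by (simp add: m_assoc)
    also have "\<dots> = \<iota> a \<otimes> (word_product A (map z (letters v)) \<otimes> \<iota> b) \<otimes> word_product A (map z (letters w))"
      using V by (simp add: scalar_central)
    finally show ?case
      using \<open>v \<in> words I\<close> single V W by (simp add: m_assoc)
  next
    case zero
    then show ?case using \<open>v \<in> words I\<close> word_eval_closed[of v] by simp
  next
    case (add f g)
    then show ?case using \<open>v \<in> words I\<close> word_eval_closed[of v] by (simp add: distrib_left r_distr)
  qed
next
  case zero
  then show ?case using g by simp
next
  case (add f f')
  then show ?case using g by (simp add: distrib_right l_distr)
qed

lemma free_eval_scalar [simp]: "free_eval A \<iota> z (free_scalar a) = \<iota> a"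
  using free_eval_single[of 0 a] by (simp add: free_scalar_def)

lemma free_eval_one [simp]: "free_eval A \<iota> z 1 = \<one>"
  using free_eval_scalar[of 1] by (simp add: free_scalar_simps scalar_one)

lemma free_eval_gen [simp]: "x \<in> I \<Longrightarrow> free_eval A \<iota> z (free_gen x) = z x"
  using free_eval_single[of "Word [x]" 1] z by (auto simp: free_gen_def words_def scalar_one image_subset_iff)

lemma free_eval_hom: "free_eval A \<iota> z \<in> ring_hom (free_algebra I) A"
  by (rule ring_hom_memI) (simp_all add: carrier_free_algebra)

lemma free_eval_ring_hom: "ring_hom_ring (free_algebra I) A (free_eval A \<iota> z)"
  by (intro ring_hom_ringI2 ring_free_algebra ring_axioms free_eval_hom)

lemma free_eval_uminus [simp]:
  assumes "f \<in> supported_on (words I)" shows "free_eval A \<iota> z (- f) = \<ominus> free_eval A \<iota> z f"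
proof -
  have "free_eval A \<iota> z (- f) \<oplus> free_eval A \<iota> z f = \<zero>"
    using assms free_eval_add[of "- f" f] by simp
  then show ?thesis
    using assms minus_equality by auto
qed

lemma free_eval_diff [simp]:
  assumes "f \<in> supported_on (words I)" "g \<in> supported_on (words I)"
  shows "free_eval A \<iota> z (f - g) = free_eval A \<iota> z f \<ominus> free_eval A \<iota> z g"
  using assms free_eval_add[of f "- g"] by (simp add: a_minus_def)

lemma free_eval_sum:
  assumes "finite S" "\<And>k. k \<in> S \<Longrightarrow> f k \<in> supported_on (words I)"
  shows "free_eval A \<iota> z (\<Sum>k\<in>S. f k) = (\<Oplus>k\<in>S. free_eval A \<iota> z (f k))"
  using assms
proof (induction S)
  case (insert k S)
  then show ?case by (simp add: supported_on_sum Pi_def)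
qed simp

lemma free_eval_power [simp]:
  assumes "f \<in> supported_on (words I)"
  shows "free_eval A \<iota> z (f ^ m) = free_eval A \<iota> z f [^] m"
  using assms by (induction m) (auto simp: power_Suc2 simp del: power_Suc)

end

end

section \<open>Rescaling words\<close>

definition word_scale :: "('w \<Rightarrow> complex) \<Rightarrow> ('w \<Rightarrow>\<^sub>0 complex) \<Rightarrow> ('w \<Rightarrow>\<^sub>0 complex)"
  where "word_scale \<chi> f = Poly_Mapping.mapp (\<lambda>w c. \<chi> w * c) f"

lemma lookup_word_scale [simp]: "Poly_Mapping.lookup (word_scale \<chi> f) w = \<chi> w * Poly_Mapping.lookup f w"
  by (simp add: word_scale_def mapp.rep_eq when_def in_keys_iff)

lemma word_scale_simps [simp]:
  "word_scale \<chi> 0 = 0"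
  "word_scale \<chi> (f + g) = word_scale \<chi> f + word_scale \<chi> g"
  "word_scale \<chi> (f - g) = word_scale \<chi> f - word_scale \<chi> g"
  "word_scale \<chi> (Poly_Mapping.single w a) = Poly_Mapping.single w (\<chi> w * a)"
  by (rule poly_mapping_eqI; simp add: lookup_add lookup_minus distrib_left right_diff_distrib lookup_single when_def)+

lemma word_scale_compose: "word_scale \<chi> (word_scale \<psi> f) = word_scale (\<lambda>w. \<chi> w * \<psi> w) f"
  by (rule poly_mapping_eqI) (simp add: mult.assoc)

lemma word_scale_cong:
  "f \<in> supported_on W \<Longrightarrow> (\<And>w. w \<in> W \<Longrightarrow> \<chi> w = \<psi> w) \<Longrightarrow> word_scale \<chi> f = word_scale \<psi> f"
  by (rule poly_mapping_eqI) (auto simp: supported_on_def in_keys_iff)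

lemma word_scale_id [simp]: "word_scale (\<lambda>w. 1) f = f"
  by (rule poly_mapping_eqI) simp

lemma word_scale_supported [simp]: "f \<in> supported_on W \<Longrightarrow> word_scale \<chi> f \<in> supported_on W"
  by (auto simp: supported_on_def in_keys_iff)

text \<open>For a multiplicative \<open>\<chi>\<close> this makes the rescaling an algebra endomorphism.  Both the weight action on the
  quadratic algebra and the automorphisms of the Ore extensions arise in this way.\<close>

lemma word_scale_mult:
  fixes f g :: "'w::monoid_add \<Rightarrow>\<^sub>0 complex"
  assumes "\<And>v w. \<chi> (v + w) = \<chi> v * \<chi> w"
  shows "word_scale \<chi> (f * g) = word_scale \<chi> f * word_scale \<chi> g"
proof -
  have f: "f \<in> supported_on UNIV" and g: "g \<in> supported_on UNIV" by (simp_all add: supported_on_def)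
  from f show ?thesis
  proof (induction f rule: supported_on_induct)
    case (single v a)
    from g show ?case
      by (induction g rule: supported_on_induct) (simp_all add: mult_single assms mult_ac distrib_left)
  qed (simp_all add: distrib_right)
qed

section \<open>Rewriting to ordered words\<close>

text \<open>The ideal \<open>K\<close> is arbitrary, because the rewriting is needed twice: modulo the ideal generated by the
  relations, and modulo the kernel of an evaluation map.\<close>

locale ordered_rewriting =
  fixes I :: "'x::linorder set" and K :: "('x free_word \<Rightarrow>\<^sub>0 complex) set" and c :: "'x \<Rightarrow> 'x \<Rightarrow> complex"
  assumes finite_letters: "finite I"
    and K_ideal: "ideal K (free_algebra I)"
    and exchange: "a \<in> I \<Longrightarrow> b \<in> I \<Longrightarrow> a < b \<Longrightarrow>
      \<exists>p\<in>supported_on (words_of_length {x\<in>I. x < b} 2).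
        free_gen b * free_gen a - free_scalar (c b a) * free_gen a * free_gen b - p \<in> K"
begin

definition eqv :: "('x free_word \<Rightarrow>\<^sub>0 complex) \<Rightarrow> ('x free_word \<Rightarrow>\<^sub>0 complex) \<Rightarrow> bool" (infix "\<sim>\<^sub>K" 50)
  where "f \<sim>\<^sub>K g \<longleftrightarrow> f - g \<in> K"

lemma K_closed:
  "0 \<in> K" "f \<in> K \<Longrightarrow> g \<in> K \<Longrightarrow> f + g \<in> K" "f \<in> K \<Longrightarrow> f \<in> supported_on (words I)" "f \<in> K \<Longrightarrow> - f \<in> K"
  "f \<in> K \<Longrightarrow> g \<in> supported_on (words I) \<Longrightarrow> f * g \<in> K" "f \<in> K \<Longrightarrow> g \<in> supported_on (words I) \<Longrightarrow> g * f \<in> K"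
proof -
  interpret ideal K "free_algebra I" by (rule K_ideal)
  note sub = ideal.axioms(1)[OF K_ideal]
  show "0 \<in> K" "f \<in> K \<Longrightarrow> g \<in> K \<Longrightarrow> f + g \<in> K"
    using additive_subgroup.zero_closed[OF sub] additive_subgroup.a_closed[OF sub, of f g] by auto
  show F: "f \<in> K \<Longrightarrow> f \<in> supported_on (words I)" for f
    using a_subset by (auto simp: carrier_free_algebra)
  show "f \<in> K \<Longrightarrow> - f \<in> K"
    using additive_subgroup.a_inv_closed[OF sub, of f] F by (simp add: free_a_inv)
  show "f \<in> K \<Longrightarrow> g \<in> supported_on (words I) \<Longrightarrow> f * g \<in> K" "f \<in> K \<Longrightarrow> g \<in> supported_on (words I) \<Longrightarrow> g * f \<in> K"
    using I_l_closed[of f g] I_r_closed[of f g] by (simp_all add: carrier_free_algebra)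
qed

lemma eqv_refl [simp]: "f \<sim>\<^sub>K f"
  by (simp add: eqv_def K_closed)

lemma eqv_trans [trans]: "f \<sim>\<^sub>K g \<Longrightarrow> g \<sim>\<^sub>K h \<Longrightarrow> f \<sim>\<^sub>K h"
  unfolding eqv_def using K_closed(2)[of "f - g" "g - h"] by simp

lemma eqv_add: "f \<sim>\<^sub>K g \<Longrightarrow> f' \<sim>\<^sub>K g' \<Longrightarrow> f + f' \<sim>\<^sub>K g + g'"
  unfolding eqv_def using K_closed(2)[of "f - g" "f' - g'"] by (simp add: add_diff_add)

lemma eqv_sum: "(\<And>m. m \<in> S \<Longrightarrow> f m \<sim>\<^sub>K g m) \<Longrightarrow> (\<Sum>m\<in>S. f m) \<sim>\<^sub>K (\<Sum>m\<in>S. g m)"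
  by (induction S rule: infinite_finite_induct) (auto intro: eqv_add)

lemma eqv_mult_left: "h \<in> supported_on (words I) \<Longrightarrow> f \<sim>\<^sub>K g \<Longrightarrow> h * f \<sim>\<^sub>K h * g"
  unfolding eqv_def using K_closed(6)[of "f - g" h] by (simp add: right_diff_distrib)

lemma eqv_mult_right: "h \<in> supported_on (words I) \<Longrightarrow> f \<sim>\<^sub>K g \<Longrightarrow> f * h \<sim>\<^sub>K g * h"
  unfolding eqv_def using K_closed(5)[of "f - g" h] by (simp add: left_diff_distrib)

definition exchange_char :: "'x \<Rightarrow> 'x free_word \<Rightarrow> complex"
  where "exchange_char b w = prod_list (map (c b) (letters w))"

lemma exchange_char_add: "exchange_char b (v + w) = exchange_char b v * exchange_char b w"
  by (simp add: exchange_char_def)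

lemma words_of_length_simps:
  "v \<in> words_of_length J d \<Longrightarrow> w \<in> words_of_length J e \<Longrightarrow> v + w \<in> words_of_length J (d + e)"
  "words_of_length J d \<subseteq> words J"
  by (auto simp: words_of_length_def)

lemma words_mono: "J \<subseteq> J' \<Longrightarrow> words J \<subseteq> words J'" "J \<subseteq> J' \<Longrightarrow> words_of_length J d \<subseteq> words_of_length J' d"
  by (auto simp: words_of_length_def words_def)

lemma homogeneous_mult:
  fixes f g :: "'x free_word \<Rightarrow>\<^sub>0 complex"
  shows "f \<in> supported_on (words_of_length J d) \<Longrightarrow> g \<in> supported_on (words_of_length J e) \<Longrightarrow>
   f * g \<in> supported_on (words_of_length J (d + e))"
  by (rule supported_on_mult) (auto intro: words_of_length_simps)

lemma homogeneous_in_carrier: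
  "J \<subseteq> I \<Longrightarrow> f \<in> supported_on (words_of_length J d) \<Longrightarrow> f \<in> supported_on (words I)"
  by (rule subsetD[OF supported_on_mono[OF order_trans[OF words_of_length_simps(2) words_mono(1)]]])

text \<open>Moving \<open>b\<close> past the letters of a word one at a time multiplies the word by the exchange
  coefficients; every correction term loses the letter \<open>b\<close>, so it involves smaller letters only.\<close>

lemma exchange_word:
  assumes b: "b \<in> I" and xs: "set xs \<subseteq> {x\<in>I. x < b}"
  shows "\<exists>g\<in>supported_on (words_of_length {x\<in>I. x < b} (Suc (length xs))).
    free_gen b * Poly_Mapping.single (Word xs) a \<sim>\<^sub>K
    word_scale (exchange_char b) (Poly_Mapping.single (Word xs) a) * free_gen b + g"
  using xs
proof (induction xs)
  case Nil
  have "free_gen b * Poly_Mapping.single (Word []) a =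
    word_scale (exchange_char b) (Poly_Mapping.single (Word []) a) * free_gen b"
    by (simp add: free_gen_def mult_single exchange_char_def plus_free_word_def)
  then show ?case by (intro bexI[of _ 0]) auto
next
  case (Cons x xs)
  let ?J = "{x\<in>I. x < b}" and ?s = "Poly_Mapping.single (Word xs) a"
  have x: "x \<in> I" "x < b" and xs: "Word xs \<in> words_of_length ?J (length xs)"
    using Cons.prems by (auto simp: words_of_length_def words_def)
  obtain g where g: "g \<in> supported_on (words_of_length ?J (Suc (length xs)))"
    and IH: "free_gen b * ?s \<sim>\<^sub>K word_scale (exchange_char b) ?s * free_gen b + g"
    using Cons by auto
  obtain p where p: "p \<in> supported_on (words_of_length ?J 2)"
    and rel: "free_gen b * free_gen x \<sim>\<^sub>K free_scalar (c b x) * free_gen x * free_gen b + p"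
    using exchange[OF x(1) b x(2)] unfolding eqv_def by (auto simp: algebra_simps)
  have s: "?s \<in> supported_on (words_of_length ?J (length xs))"
    using xs by simp
  have mem: "?s \<in> supported_on (words I)" "p \<in> supported_on (words I)" "g \<in> supported_on (words I)"
    using s p g by (blast intro: homogeneous_in_carrier[rotated])+
  have gx: "free_gen x \<in> supported_on (words_of_length ?J 1)"
    using x by (simp add: free_gen_def words_of_length_def words_def)
  have "free_gen b * Poly_Mapping.single (Word (x # xs)) a = free_gen b * free_gen x * ?s"
    by (simp add: single_Cons mult.assoc)
  also have "\<dots> \<sim>\<^sub>K (free_scalar (c b x) * free_gen x * free_gen b + p) * ?s"
    by (intro eqv_mult_right rel mem)
  also have "\<dots> = free_scalar (c b x) * free_gen x * (free_gen b * ?s) + p * ?s"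
    by (simp add: algebra_simps)
  also have "\<dots> \<sim>\<^sub>K free_scalar (c b x) * free_gen x * (word_scale (exchange_char b) ?s * free_gen b + g) + p * ?s"
    using x by (intro eqv_add eqv_mult_left IH eqv_refl) auto
  also have "\<dots> = word_scale (exchange_char b) (Poly_Mapping.single (Word (x # xs)) a) * free_gen b +
      (free_scalar (c b x) * free_gen x * g + p * ?s)"
    by (simp add: exchange_char_def free_scalar_def free_gen_def mult_single plus_free_word_def algebra_simps)
  finally have "free_gen b * Poly_Mapping.single (Word (x # xs)) a \<sim>\<^sub>K
    word_scale (exchange_char b) (Poly_Mapping.single (Word (x # xs)) a) * free_gen b +
      (free_scalar (c b x) * free_gen x * g + p * ?s)" .
  moreover have "free_scalar (c b x) \<in> supported_on (words_of_length ?J 0)"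
    by (simp add: free_scalar_def words_of_length_def)
  from homogeneous_mult[OF homogeneous_mult[OF this gx] g] homogeneous_mult[OF p s]
  have "free_scalar (c b x) * free_gen x * g + p * ?s \<in> supported_on (words_of_length ?J (Suc (length (x # xs))))"
    by simp
  ultimately show ?case by (intro bexI)
qed

lemma exchange_linear:
  assumes f: "f \<in> supported_on W"
    and word: "\<And>w a. w \<in> W \<Longrightarrow> \<exists>g\<in>supported_on V. free_gen b * Poly_Mapping.single w a \<sim>\<^sub>K
          word_scale (exchange_char b) (Poly_Mapping.single w a) * free_gen b + g"
  shows "\<exists>g\<in>supported_on V. free_gen b * f \<sim>\<^sub>K word_scale (exchange_char b) f * free_gen b + g"
  using f
proof (induction f rule: supported_on_induct)
  case zero
  show ?case by (rule bexI[of _ 0]) simp_all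
next
  case (single w a)
  then show ?case by (rule word)
next
  case (add f f')
  obtain g g' where g: "g \<in> supported_on V" "g' \<in> supported_on V"
    and eq: "free_gen b * f \<sim>\<^sub>K word_scale (exchange_char b) f * free_gen b + g"
    "free_gen b * f' \<sim>\<^sub>K word_scale (exchange_char b) f' * free_gen b + g'"
    using add.IH by blast
  have "free_gen b * (f + f') \<sim>\<^sub>K word_scale (exchange_char b) (f + f') * free_gen b + (g + g')"
    using eqv_add[OF eq] by (simp add: distrib_left distrib_right add_ac)
  with g show ?case by (intro bexI[of _ "g + g'"]) simp_all
qed

lemma exchange_homogeneous:
  assumes b: "b \<in> I" and f: "f \<in> supported_on (words_of_length {x\<in>I. x < b} d)"
  shows "\<exists>g\<in>supported_on (words_of_length {x\<in>I. x < b} (Suc d)).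
    free_gen b * f \<sim>\<^sub>K word_scale (exchange_char b) f * free_gen b + g"
proof (rule exchange_linear[OF f])
  fix w a assume w: "w \<in> words_of_length {x\<in>I. x < b} d"
  then have "set (letters w) \<subseteq> {x\<in>I. x < b}" "length (letters w) = d"
    by (simp_all only: words_of_length_def words_def mem_Collect_eq)
  with exchange_word[OF b this(1), of a]
  show "\<exists>g\<in>supported_on (words_of_length {x\<in>I. x < b} (Suc d)). free_gen b * Poly_Mapping.single w a \<sim>\<^sub>K
          word_scale (exchange_char b) (Poly_Mapping.single w a) * free_gen b + g"
    by (simp only: free_word.collapse)
qed

lemma exchange_any:
  assumes b: "b \<in> I" and f: "f \<in> supported_on (words {x\<in>I. x < b})"
  shows "\<exists>g\<in>supported_on (words {x\<in>I. x < b}).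
    free_gen b * f \<sim>\<^sub>K word_scale (exchange_char b) f * free_gen b + g"
proof (rule exchange_linear[OF f])
  fix w a assume w: "w \<in> words {x\<in>I. x < b}"
  then have "set (letters w) \<subseteq> {x\<in>I. x < b}"
    by (simp only: words_def mem_Collect_eq)
  from exchange_word[OF b this, of a] obtain g
    where g: "g \<in> supported_on (words_of_length {x\<in>I. x < b} (Suc (length (letters w))))"
      and eq: "free_gen b * Poly_Mapping.single w a \<sim>\<^sub>K
          word_scale (exchange_char b) (Poly_Mapping.single w a) * free_gen b + g"
    unfolding free_word.collapse by (elim bexE)
  have "g \<in> supported_on (words {x\<in>I. x < b})"
    by (rule subsetD[OF supported_on_mono[OF words_of_length_simps(2)] g])
  with eq show "\<exists>g\<in>supported_on (words {x\<in>I. x < b}). free_gen b * Poly_Mapping.single w a \<sim>\<^sub>K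
          word_scale (exchange_char b) (Poly_Mapping.single w a) * free_gen b + g"
    by (intro bexI)
qed

text \<open>By induction on words: a letter below \<open>b\<close> is absorbed into the coefficients, and the letter \<open>b\<close> itself is
  moved past them with the exchange rule, which raises the exponent or leaves a correction
  of the same total degree.\<close>

lemma power_expansion:
  assumes b: "b \<in> I" and f: "f \<in> supported_on (words_of_length (insert b {x\<in>I. x < b}) d)"
  shows "\<exists>h. (\<forall>m. h m \<in> supported_on (words_of_length {x\<in>I. x < b} (d - m))) \<and>
    f \<sim>\<^sub>K (\<Sum>m\<le>d. h m * free_gen b ^ m)"
proof -
  let ?J = "{x\<in>I. x < b}"
  define good where "good d f h \<longleftrightarrow> (\<forall>m. h m \<in> supported_on (words_of_length ?J (d - m))) \<and>
    f \<sim>\<^sub>K (\<Sum>m\<le>d. h m * free_gen b ^ m)" for d f and h :: "nat \<Rightarrow> _"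
  have word: "\<exists>h. good (length xs) (Poly_Mapping.single (Word xs) a) h" if "set xs \<subseteq> insert b ?J" for xs a
    using that
  proof (induction xs)
    case Nil
    have "Word [] \<in> words_of_length ?J 0" by (simp add: words_of_length_def words_def)
    then show ?case
      by (intro exI[of _ "\<lambda>m. Poly_Mapping.single (Word []) a"]) (simp add: good_def)
  next
    case (Cons x xs)
    let ?s = "Poly_Mapping.single (Word xs) a" and ?n = "length xs"
    obtain h where h: "\<And>m. h m \<in> supported_on (words_of_length ?J (?n - m))"
      and eq: "?s \<sim>\<^sub>K (\<Sum>m\<le>?n. h m * free_gen b ^ m)"
      using Cons by (auto simp: good_def)
    have "x \<in> I" using Cons.prems b by auto
    have x1: "Poly_Mapping.single (Word (x # xs)) a \<sim>\<^sub>K (\<Sum>m\<le>?n. free_gen x * h m * free_gen b ^ m)"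
      using eqv_mult_left[OF _ eq, of "free_gen x"] \<open>x \<in> I\<close>
      by (simp add: single_Cons sum_distrib_left mult.assoc)
    show ?case
    proof (cases "x = b")
      case False
      then have gx: "free_gen x \<in> supported_on (words_of_length ?J 1)"
        using Cons.prems by (auto simp: free_gen_def words_of_length_def words_def)
      show ?thesis
      proof (intro exI[of _ "\<lambda>m. if m \<le> ?n then free_gen x * h m else 0"], unfold good_def, intro conjI allI)
        show "Poly_Mapping.single (Word (x # xs)) a \<sim>\<^sub>K
          (\<Sum>m\<le>length (x # xs). (if m \<le> ?n then free_gen x * h m else 0) * free_gen b ^ m)"
          using x1 by simp
        show "(if m \<le> ?n then free_gen x * h m else 0) \<in> supported_on (words_of_length ?J (length (x # xs) - m))" for m
          using homogeneous_mult[OF gx h[of m]] by (simp add: Suc_diff_le)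
      qed
    next
      case True
      let ?\<chi> = "word_scale (exchange_char b)"
      obtain g where g: "\<And>m. g m \<in> supported_on (words_of_length ?J (Suc (?n - m)))"
        and ex: "\<And>m. free_gen b * h m \<sim>\<^sub>K ?\<chi> (h m) * free_gen b + g m"
        using exchange_homogeneous[OF b h] by metis
      let ?h = "\<lambda>m. (if m = 0 then 0 else ?\<chi> (h (m - 1))) + (if m \<le> ?n then g m else 0)"
      note x1
      also have "(\<Sum>m\<le>?n. free_gen x * h m * free_gen b ^ m) \<sim>\<^sub>K
        (\<Sum>m\<le>?n. (?\<chi> (h m) * free_gen b + g m) * free_gen b ^ m)"
        unfolding \<open>x = b\<close> using b by (intro eqv_sum eqv_mult_right ex) auto
      also have "\<dots> = (\<Sum>m\<le>?n. ?\<chi> (h m) * free_gen b ^ Suc m) + (\<Sum>m\<le>?n. g m * free_gen b ^ m)"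
        by (simp add: algebra_simps sum.distrib)
      also have "(\<Sum>m\<le>?n. ?\<chi> (h m) * free_gen b ^ Suc m) =
        (\<Sum>m\<le>Suc ?n. (if m = 0 then 0 else ?\<chi> (h (m - 1))) * free_gen b ^ m)"
        by (subst sum.atMost_Suc_shift) simp
      also have "(\<Sum>m\<le>?n. g m * free_gen b ^ m) = (\<Sum>m\<le>Suc ?n. (if m \<le> ?n then g m else 0) * free_gen b ^ m)"
        by simp
      also have "(\<Sum>m\<le>Suc ?n. (if m = 0 then 0 else ?\<chi> (h (m - 1))) * free_gen b ^ m) + \<dots> =
        (\<Sum>m\<le>length (x # xs). ?h m * free_gen b ^ m)"
        by (simp only: sum.distrib distrib_right length_Cons)
      finally have "Poly_Mapping.single (Word (x # xs)) a \<sim>\<^sub>K (\<Sum>m\<le>length (x # xs). ?h m * free_gen b ^ m)" .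
      moreover have "?h m \<in> supported_on (words_of_length ?J (length (x # xs) - m))" for m
        using h[of "m - 1"] g[of m] by (cases m) (auto simp: Suc_diff_le Suc_diff_Suc)
      ultimately show ?thesis
        unfolding good_def by (intro exI[of _ ?h] conjI allI)
    qed
  qed
  from f show ?thesis
  proof (induction f rule: supported_on_induct)
    case zero
    then show ?case by (intro exI[of _ "\<lambda>m. 0"]) auto
  next
    case (single w a)
    then show ?case using word[of "letters w" a] by (auto simp: good_def words_of_length_def words_def)
  next
    case (add f f')
    then obtain h h' where "good d f h" "good d f' h'" by (auto simp: good_def)
    then have "good d (f + f') (\<lambda>m. h m + h' m)"
      using eqv_add by (fastforce simp: good_def algebra_simps sum.distrib)
    then show ?case
      unfolding good_def by (intro exI[of _ "\<lambda>m. h m + h' m"])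
  qed
qed

lemma sorted_times_power:
  assumes "g \<in> supported_on (sorted_words {x\<in>I. x < b} \<inter> words_of_length {x\<in>I. x < b} d)"
  shows "g * free_gen b ^ m \<in> supported_on (sorted_words (insert b {x\<in>I. x < b}) \<inter>
           words_of_length (insert b {x\<in>I. x < b}) (d + m))"
proof -
  have "free_gen b ^ m = Poly_Mapping.single (Word (replicate m b)) 1" for m
    by (induction m) (simp_all add: free_gen_def mult_single plus_free_word_def flip: single_one zero_free_word_def)
  then have "free_gen b ^ m \<in> supported_on {Word (replicate m b)}"
    by simp
  from assms this show ?thesis
    by (rule supported_on_mult)
      (auto simp: sorted_words_def words_of_length_def words_def sorted_append less_imp_le)
qed

text \<open>Induction on the largest letter: collect its powers on the right and rewrite their
  coefficients, which use smaller letters.\<close>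

lemma homogeneous_normal_form:
  assumes "finite J" "J \<subseteq> I" "\<And>x y. x \<in> J \<Longrightarrow> y \<in> I \<Longrightarrow> y < x \<Longrightarrow> y \<in> J"
    and "f \<in> supported_on (words_of_length J d)"
  shows "\<exists>g\<in>supported_on (sorted_words J \<inter> words_of_length J d). f \<sim>\<^sub>K g"
  using assms
proof (induction J arbitrary: f d rule: finite_linorder_max_induct)
  case empty
  then show ?case
    by (intro bexI[of _ f]) (auto simp: supported_on_def sorted_words_def words_of_length_def words_def)
next
  case (insert b J)
  have b: "b \<in> I" and J: "J = {x\<in>I. x < b}"
    using insert.hyps insert.prems by auto
  obtain h where h: "\<And>m. h m \<in> supported_on (words_of_length J (d - m))"
    and eq: "f \<sim>\<^sub>K (\<Sum>m\<le>d. h m * free_gen b ^ m)"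
    using power_expansion[OF b] insert.prems(3) unfolding J by blast
  have "\<exists>g\<in>supported_on (sorted_words J \<inter> words_of_length J (d - m)). h m \<sim>\<^sub>K g" for m
    by (rule insert.IH[OF _ _ h]) (auto simp: J)
  then obtain g where g: "\<And>m. g m \<in> supported_on (sorted_words J \<inter> words_of_length J (d - m))"
    and hg: "\<And>m. h m \<sim>\<^sub>K g m" by metis
  have "f \<sim>\<^sub>K (\<Sum>m\<le>d. g m * free_gen b ^ m)"
    using eq by (rule eqv_trans) (intro eqv_sum eqv_mult_right hg, use b in auto)
  moreover have "(\<Sum>m\<le>d. g m * free_gen b ^ m) \<in> supported_on (sorted_words (insert b J) \<inter> words_of_length (insert b J) d)"
  proof (rule supported_on_sum)
    fix m assume "m \<in> {..d}"
    then show "g m * free_gen b ^ m \<in> supported_on (sorted_words (insert b J) \<inter> words_of_length (insert b J) d)"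
      using sorted_times_power[of "g m" b "d - m" m, folded J, OF g] by simp
  qed
  ultimately show ?case by (intro bexI)
qed

lemma normal_form:
  assumes J: "finite J" "J \<subseteq> I" "\<And>x y. x \<in> J \<Longrightarrow> y \<in> I \<Longrightarrow> y < x \<Longrightarrow> y \<in> J"
    and f: "f \<in> supported_on (words J)"
  shows "\<exists>g\<in>supported_on (sorted_words J). f \<sim>\<^sub>K g"
  using f
proof (induction f rule: supported_on_induct)
  case zero
  show ?case by (rule bexI[of _ 0]) simp_all
next
  case (single w a)
  then have "Poly_Mapping.single w a \<in> supported_on (words_of_length J (length (letters w)))"
    by (simp add: words_of_length_def)
  from homogeneous_normal_form[OF J this] obtain g
    where "g \<in> supported_on (sorted_words J \<inter> words_of_length J (length (letters w)))"
      "Poly_Mapping.single w a \<sim>\<^sub>K g" by (rule bexE)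
  then show ?case
    using supported_on_mono[of "sorted_words J \<inter> words_of_length J (length (letters w))" "sorted_words J"]
    by (intro bexI[of _ g]) auto
next
  case (add f f')
  obtain g where g: "g \<in> supported_on (sorted_words J)" "f \<sim>\<^sub>K g" using add.IH(1) by (rule bexE)
  obtain g' where g': "g' \<in> supported_on (sorted_words J)" "f' \<sim>\<^sub>K g'" using add.IH(2) by (rule bexE)
  show ?case
    using eqv_add[OF g(2) g'(2)] g(1) g'(1) by (intro bexI[of _ "g + g'"]) simp_all
qed

end

section \<open>Ore extensions of domains\<close>

text \<open>The set of all \<open>\<Sum>i<m. r\<^sub>i x\<^sup>i\<close> with \<open>r\<^sub>i \<in> S\<close>, defined by recursion so that degree arguments become
  inductions on \<open>m\<close>.\<close>

fun (in ring) low_terms :: "'a set \<Rightarrow> 'a \<Rightarrow> nat \<Rightarrow> 'a set"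
  where "low_terms S x 0 = {\<zero>}"
  | "low_terms S x (Suc m) = {r \<otimes> x [^] m \<oplus> l | r l. r \<in> S \<and> l \<in> low_terms S x m}"

text \<open>If \<open>t\<close> and \<open>t'\<close> have leading terms \<open>r x\<^sup>a\<close> and \<open>r' x\<^sup>b\<close>, then \<open>t t'\<close> has leading coefficient
  \<open>r \<sigma>\<^sup>a(r')\<close>, which is nonzero because \<open>\<sigma>\<close> is injective.\<close>

lemma (in ring) Ore_extension_no_zero_divisors:
  assumes Ore: "Ore_extension R S T"
    and S: "\<And>a b. a \<in> S \<Longrightarrow> b \<in> S \<Longrightarrow> a \<otimes> b = \<zero> \<Longrightarrow> a = \<zero> \<or> b = \<zero>"
    and t: "t \<in> T" "t' \<in> T" "t \<otimes> t' = \<zero>"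
  shows "t = \<zero> \<or> t' = \<zero>"
proof -
  have subS: "subring S R" and subT: "subring T R"
    using Ore unfolding Ore_extension_def by (auto simp only:)
  obtain x \<sigma> \<delta> where x: "x \<in> T"
    and \<sigma>: "\<sigma> \<in> ring_iso (R\<lparr>carrier := S\<rparr>) (R\<lparr>carrier := S\<rparr>)"
    and skew: "skew_derivation R S \<sigma> \<delta>"
    and comm_all: "\<forall>r\<in>S. x \<otimes> r = \<sigma> r \<otimes> x \<oplus> \<delta> r"
    and expand_all: "\<forall>t\<in>T. \<exists>!c :: nat \<Rightarrow> 'a. (\<forall>i. c i \<in> S) \<and> finite {i. c i \<noteq> \<zero>} \<and>
      t = (\<Oplus>i\<in>{i. c i \<noteq> \<zero>}. c i \<otimes> (x [^] i))"
    using Ore unfolding Ore_extension_def by (elim conjE bexE exE) (rule that)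
  have \<delta>: "\<delta> \<in> S \<rightarrow> S"
    using skew by (simp add: skew_derivation_def)
  note comm = bspec[OF comm_all] and expand = bspec[OF expand_all]
  note Sc [simp] = subringE(1)[OF subS, THEN subsetD]
  have S_closed [simp]: "\<zero> \<in> S" "\<one> \<in> S" "a \<in> S \<Longrightarrow> b \<in> S \<Longrightarrow> a \<oplus> b \<in> S" "a \<in> S \<Longrightarrow> b \<in> S \<Longrightarrow> a \<otimes> b \<in> S" for a b
    using subringE[OF subS] by auto
  have xc [simp]: "x \<in> carrier R"
    using subringE(1)[OF subT] x by auto
  have \<sigma>S [simp]: "\<sigma> r \<in> S" and \<delta>S [simp]: "\<delta> r \<in> S" if "r \<in> S" for r
    using \<sigma> \<delta> that by (auto simp: ring_iso_def ring_hom_def)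
  have \<sigma>0: "r = \<zero>" if "r \<in> S" "\<sigma> r = \<zero>" for r
  proof -
    have "\<forall>a\<in>S. \<forall>b\<in>S. \<sigma> (a \<oplus> b) = \<sigma> a \<oplus> \<sigma> b"
      using \<sigma> by (simp add: ring_iso_def ring_hom_def)
    from bspec[OF bspec[OF this S_closed(1)] S_closed(1)] \<sigma>S[OF S_closed(1)] have "\<sigma> \<zero> = \<zero>" by (simp add: add.l_cancel_one)
    moreover have "inj_on \<sigma> S"
      using \<sigma> by (auto simp: ring_iso_def bij_betw_def)
    ultimately show ?thesis using that by (metis S_closed(1) inj_onD)
  qed
  define L where "L = low_terms S x"
  have L_0: "L 0 = {\<zero>}" and L_Suc: "L (Suc m) = {r \<otimes> x [^] m \<oplus> l | r l. r \<in> S \<and> l \<in> L m}" for m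
    by (simp_all add: L_def)
  have L_SucI: "r \<in> S \<Longrightarrow> k \<in> L m \<Longrightarrow> l = r \<otimes> x [^] m \<oplus> k \<Longrightarrow> l \<in> L (Suc m)" for r k l m
    by (auto simp: L_Suc)
  have L_carrier [simp]: "l \<in> L m \<Longrightarrow> l \<in> carrier R" for l m
    by (induction m arbitrary: l) (auto simp: L_0 L_Suc)
  have L_zero [simp]: "\<zero> \<in> L m" for m
  proof (induction m)
    case (Suc m)
    then show ?case by - (rule L_SucI[of \<zero> \<zero>], simp_all)
  qed (simp add: L_0)
  have L_add: "l \<in> L m \<Longrightarrow> l' \<in> L m \<Longrightarrow> l \<oplus> l' \<in> L m" for l l' m
  proof (induction m arbitrary: l l')
    case (Suc m)
    then obtain r k r' k' where "l = r \<otimes> x [^] m \<oplus> k" "r \<in> S" "k \<in> L m" "l' = r' \<otimes> x [^] m \<oplus> k'" "r' \<in> S" "k' \<in> L m"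
      by (auto simp: L_Suc)
    moreover from this have "l \<oplus> l' = (r \<oplus> r') \<otimes> x [^] m \<oplus> (k \<oplus> k')"
      by (simp add: l_distr a_ac)
    ultimately show ?case using Suc.IH[of k k'] by - (rule L_SucI[of "r \<oplus> r'" "k \<oplus> k'"], simp_all)
  qed (simp add: L_0)
  have L_term: "r \<in> S \<Longrightarrow> r \<otimes> x [^] m \<in> L (Suc m)" for r m
    by (rule L_SucI[of r \<zero>]) simp_all
  have L_step: "l \<in> L m \<Longrightarrow> l \<in> L (Suc m)" for l m
    by (rule L_SucI[of \<zero> l]) simp_all
  have L_smult: "r \<in> S \<Longrightarrow> l \<in> L m \<Longrightarrow> r \<otimes> l \<in> L m" for r l m
  proof (induction m arbitrary: l)
    case (Suc m)
    then obtain r' k where l: "l = r' \<otimes> x [^] m \<oplus> k" "r' \<in> S" "k \<in> L m"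
      by (auto simp: L_Suc)
    then have "r \<otimes> l = r \<otimes> r' \<otimes> x [^] m \<oplus> r \<otimes> k"
      using Suc.prems by (simp add: r_distr m_assoc)
    with l Suc show ?case by - (rule L_SucI[of "r \<otimes> r'" "r \<otimes> k"], simp_all)
  qed (simp add: L_0)
  have L_x: "l \<in> L m \<Longrightarrow> l \<otimes> x \<in> L (Suc m)" for l m
  proof (induction m arbitrary: l)
    case (Suc m)
    then obtain r k where l: "l = r \<otimes> x [^] m \<oplus> k" "r \<in> S" "k \<in> L m"
      by (auto simp: L_Suc)
    then have "l \<otimes> x = r \<otimes> x [^] Suc m \<oplus> k \<otimes> x"
      by (simp add: l_distr m_assoc)
    with l Suc.IH[of k] show ?case by - (rule L_SucI[of r "k \<otimes> x"], simp_all)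
  next
    case 0
    then have "l \<otimes> x = \<zero>" by (simp add: L_0)
    then show ?case by simp
  qed
  have L_power: "l \<in> L m \<Longrightarrow> l \<otimes> x [^] j \<in> L (m + j)" for l m and j :: nat
    by (induction j) (auto simp: m_assoc[symmetric] intro: L_x)
  have \<sigma>_pow: "(\<sigma> ^^ a) r \<in> S" if "r \<in> S" for a r
    using that by (induction a) auto
  have commute: "\<exists>l\<in>L a. x [^] a \<otimes> r = (\<sigma> ^^ a) r \<otimes> x [^] a \<oplus> l" if "r \<in> S" for a :: nat and r
    using that
  proof (induction a arbitrary: r)
    case (Suc a)
    then obtain l l' where l: "l \<in> L a" "x [^] a \<otimes> \<sigma> r = (\<sigma> ^^ a) (\<sigma> r) \<otimes> x [^] a \<oplus> l"
      and l': "l' \<in> L a" "x [^] a \<otimes> \<delta> r = (\<sigma> ^^ a) (\<delta> r) \<otimes> x [^] a \<oplus> l'"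
      by (meson \<sigma>S \<delta>S)
    have "x [^] Suc a \<otimes> r = x [^] a \<otimes> \<sigma> r \<otimes> x \<oplus> x [^] a \<otimes> \<delta> r"
      using Suc.prems by (simp add: m_assoc comm r_distr)
    also have "\<dots> = (\<sigma> ^^ Suc a) r \<otimes> x [^] Suc a \<oplus> (l \<otimes> x \<oplus> ((\<sigma> ^^ a) (\<delta> r) \<otimes> x [^] a \<oplus> l'))"
      using Suc.prems l(1) l'(1) \<sigma>_pow[of "\<sigma> r" a] \<sigma>_pow[of "\<delta> r" a]
      by (simp add: l(2) l'(2) l_distr m_assoc a_assoc funpow_swap1 del: funpow.simps(2)) (simp add: funpow_swap1)
    finally show ?case
      using Suc.prems l(1) l'(1) \<sigma>_pow[of "\<delta> r" a] by (intro bexI) (auto intro!: L_add L_x L_term L_step[of l' a])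
  next
    case 0
    then show ?case by (intro bexI[of _ \<zero>]) auto
  qed
  have L_power_left: "l \<in> L b \<Longrightarrow> x [^] a \<otimes> l \<in> L (a + b)" for l b and a :: nat
  proof (induction b arbitrary: l)
    case (Suc b)
    then obtain r k where l: "l = r \<otimes> x [^] b \<oplus> k" "r \<in> S" "k \<in> L b"
      by (auto simp: L_Suc)
    obtain k' where k': "k' \<in> L a" "x [^] a \<otimes> r = (\<sigma> ^^ a) r \<otimes> x [^] a \<oplus> k'"
      using commute[OF l(2)] by blast
    have "x [^] a \<otimes> l = x [^] a \<otimes> r \<otimes> x [^] b \<oplus> x [^] a \<otimes> k"
      using l by (simp add: r_distr m_assoc)
    also have "\<dots> = (\<sigma> ^^ a) r \<otimes> x [^] (a + b) \<oplus> (k' \<otimes> x [^] b \<oplus> x [^] a \<otimes> k)"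
      using l k' \<sigma>_pow[OF l(2), of a] by (simp add: l_distr m_assoc nat_pow_mult a_assoc)
    finally show ?case
      using L_add[OF L_power[OF k'(1), of b] Suc.IH[OF l(3)]] \<sigma>_pow[OF l(2), of a]
      unfolding add_Suc_right by (intro L_SucI)
  qed (simp add: L_0)
  have L_mult: "l \<in> L a \<Longrightarrow> l' \<in> L (Suc b) \<Longrightarrow> l \<otimes> l' \<in> L (a + b)" for l l' a b
  proof (induction a arbitrary: l)
    case (Suc a)
    then obtain r k where l: "l = r \<otimes> x [^] a \<oplus> k" "r \<in> S" "k \<in> L a"
      by (auto simp: L_Suc)
    then have "l \<otimes> l' = r \<otimes> (x [^] a \<otimes> l') \<oplus> k \<otimes> l'"
      using Suc.prems by (simp add: l_distr m_assoc)
    with l Suc show ?case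
      using L_add[of _ "Suc a + b"] L_smult[OF l(2)] L_power_left[of l' "Suc b" a] L_step by simp
  qed (simp add: L_0)
  have L_sum: "\<exists>c. (\<forall>i. c i \<in> S) \<and> (\<forall>i\<ge>m. c i = \<zero>) \<and> l = (\<Oplus>i\<in>{..<m}. c i \<otimes> x [^] i)" if "l \<in> L m" for l m
    using that
  proof (induction m arbitrary: l)
    case (Suc m)
    then obtain r k where l: "l = r \<otimes> x [^] m \<oplus> k" "r \<in> S" "k \<in> L m"
      by (auto simp: L_Suc)
    obtain c where c: "\<And>i. c i \<in> S" "\<And>i. i \<ge> m \<Longrightarrow> c i = \<zero>" "k = (\<Oplus>i\<in>{..<m}. c i \<otimes> x [^] i)"
      using Suc.IH[OF l(3)] by blast
    have "(\<Oplus>i\<in>{..<m}. (c(m := r)) i \<otimes> x [^] i) = k"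
      unfolding c(3) by (rule add.finprod_cong') (use c(1) in auto)
    then have "l = (\<Oplus>i\<in>{..<Suc m}. (c(m := r)) i \<otimes> x [^] i)"
      using l c(1) by (simp add: lessThan_Suc Pi_def)
    with c l show ?case by (intro exI[of _ "c(m := r)"]) auto
  next
    case 0
    then show ?case by (intro exI[of _ "\<lambda>i. \<zero>"]) (simp add: L_0)
  qed
  have leading: "r = \<zero>" if r: "r \<in> S" "l \<in> L m" "r \<otimes> x [^] m \<oplus> l = \<zero>" for r l m
  proof -
    obtain c where c: "\<And>i. c i \<in> S" "\<And>i. i \<ge> m \<Longrightarrow> c i = \<zero>" "l = (\<Oplus>i\<in>{..<m}. c i \<otimes> x [^] i)"
      using L_sum[OF r(2)] by blast
    let ?c = "c(m := r)"
    have supp: "{i. ?c i \<noteq> \<zero>} \<subseteq> {..<Suc m}"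
    proof (rule subsetI)
      fix i assume "i \<in> {i. ?c i \<noteq> \<zero>}"
      then show "i \<in> {..<Suc m}"
        using c(2)[of i] by (cases "m \<le> i") (auto simp: less_Suc_eq split: if_splits)
    qed
    have "(\<Oplus>i\<in>{..<m}. ?c i \<otimes> x [^] i) = l"
      unfolding c(3) by (rule add.finprod_cong') (use c(1) in auto)
    then have "\<zero> = (\<Oplus>i\<in>{..<Suc m}. ?c i \<otimes> x [^] i)"
      using r c(1) by (simp add: lessThan_Suc Pi_def)
    also have "\<dots> = (\<Oplus>i\<in>{i. ?c i \<noteq> \<zero>}. ?c i \<otimes> x [^] i)"
      using supp r c(1) by (intro add.finprod_mono_neutral_cong_right) (auto simp: Pi_def)
    finally have eq: "\<zero> = (\<Oplus>i\<in>{i. ?c i \<noteq> \<zero>}. ?c i \<otimes> x [^] i)" .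
    define P where "P c \<longleftrightarrow> (\<forall>i. c i \<in> S) \<and> finite {i. c i \<noteq> \<zero>} \<and>
      \<zero> = (\<Oplus>i\<in>{i. c i \<noteq> \<zero>}. c i \<otimes> (x [^] i))" for c :: "nat \<Rightarrow> 'a"
    have "\<exists>!c. P c"
      unfolding P_def by (rule expand[OF subringE(2)[OF subT]])
    moreover have "P ?c"
      using finite_subset[OF supp] r(1) c(1) eq by (simp add: P_def)
    moreover have "P (\<lambda>i. \<zero>)"
      by (simp add: P_def)
    ultimately have "?c = (\<lambda>i. \<zero>)" by blast
    then show ?thesis by (metis fun_upd_same)
  qed
  have nonzero: "\<exists>r\<in>S. \<exists>m. \<exists>l\<in>L m. r \<noteq> \<zero> \<and> t = r \<otimes> x [^] m \<oplus> l" if "t \<in> T" "t \<noteq> \<zero>" for t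
  proof -
    define P where "P c \<longleftrightarrow> (\<forall>i. c i \<in> S) \<and> finite {i. c i \<noteq> \<zero>} \<and>
      t = (\<Oplus>i\<in>{i. c i \<noteq> \<zero>}. c i \<otimes> (x [^] i))" for c :: "nat \<Rightarrow> 'a"
    have "\<exists>c. P c"
      unfolding P_def by (rule ex1_implies_ex[OF expand[OF \<open>t \<in> T\<close>]])
    then obtain c where "P c" by blast
    then have c: "\<And>i. c i \<in> S" "finite {i. c i \<noteq> \<zero>}" "t = (\<Oplus>i\<in>{i. c i \<noteq> \<zero>}. c i \<otimes> (x [^] i))"
      by (simp_all add: P_def)
    have ne: "{i. c i \<noteq> \<zero>} \<noteq> {}"
    proof
      assume "{i. c i \<noteq> \<zero>} = {}"
      then show False using c(3) \<open>t \<noteq> \<zero>\<close> by (simp only: finsum_empty)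
    qed
    define m where "m = Max {i. c i \<noteq> \<zero>}"
    have m: "c m \<noteq> \<zero>" "\<And>i. c i \<noteq> \<zero> \<Longrightarrow> i \<le> m"
      using Max_in[OF c(2) ne] Max_ge[OF c(2)] by (auto simp: m_def)
    have "t = (\<Oplus>i\<in>{..<Suc m}. c i \<otimes> x [^] i)"
      unfolding c(3) using m(2) c(1) by (intro add.finprod_mono_neutral_cong_left) (auto simp: less_Suc_eq_le)
    then have "t = c m \<otimes> x [^] m \<oplus> (\<Oplus>i\<in>{..<m}. c i \<otimes> x [^] i)"
      using c(1) by (simp add: lessThan_Suc Pi_def)
    moreover have "(\<Oplus>i\<in>{..<k}. c i \<otimes> x [^] i) \<in> L k" for k
    proof (induction k)
      case (Suc k)
      then show ?case using c(1) by (auto simp: lessThan_Suc Pi_def L_Suc)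
    qed (simp add: L_0)
    ultimately show ?thesis using c(1) m(1) by blast
  qed
  show ?thesis
  proof (rule ccontr)
    assume "\<not> ?thesis"
    then have "t \<noteq> \<zero>" "t' \<noteq> \<zero>" by auto
    with nonzero t obtain r a l r' b l' where
      r: "r \<in> S" "l \<in> L a" "r \<noteq> \<zero>" "t = r \<otimes> x [^] a \<oplus> l" and
      r': "r' \<in> S" "l' \<in> L b" "r' \<noteq> \<zero>" "t' = r' \<otimes> x [^] b \<oplus> l'" by metis
    obtain k where k: "k \<in> L a" "x [^] a \<otimes> r' = (\<sigma> ^^ a) r' \<otimes> x [^] a \<oplus> k"
      using commute[OF r'(1)] by blast
    have \<sigma>r': "(\<sigma> ^^ a) r' \<in> S" "(\<sigma> ^^ a) r' \<noteq> \<zero>"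
    proof -
      show "(\<sigma> ^^ a) r' \<in> S" using r'(1) by (rule \<sigma>_pow)
      show "(\<sigma> ^^ a) r' \<noteq> \<zero>"
        using r'(1,3) by (induction a) (auto dest: \<sigma>0[rotated] intro: \<sigma>_pow)
    qed
    have t': "t' \<in> L (Suc b)" using r' by (intro L_SucI)
    have "t \<otimes> t' = r \<otimes> (x [^] a \<otimes> t') \<oplus> l \<otimes> t'"
      using r(1,2) t' unfolding r(4) by (simp add: l_distr m_assoc)
    also have "x [^] a \<otimes> t' = x [^] a \<otimes> r' \<otimes> x [^] b \<oplus> x [^] a \<otimes> l'"
      using r'(1,2) unfolding r'(4) by (simp add: r_distr m_assoc)
    also have "r \<otimes> (x [^] a \<otimes> r' \<otimes> x [^] b \<oplus> x [^] a \<otimes> l') \<oplus> l \<otimes> t' =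
      r \<otimes> (x [^] a \<otimes> r') \<otimes> x [^] b \<oplus> r \<otimes> (x [^] a \<otimes> l') \<oplus> l \<otimes> t'"
      using r(1,2) r'(1,2) t' by (simp add: r_distr m_assoc)
    also have "\<dots> = r \<otimes> (\<sigma> ^^ a) r' \<otimes> x [^] (a + b) \<oplus> (r \<otimes> (k \<otimes> x [^] b) \<oplus> r \<otimes> (x [^] a \<otimes> l') \<oplus> l \<otimes> t')"
      using r(1,2) r'(1,2) k t' \<sigma>r'(1) by (simp add: l_distr r_distr m_assoc a_assoc nat_pow_mult)
    finally have "r \<otimes> (\<sigma> ^^ a) r' \<otimes> x [^] (a + b) \<oplus> (r \<otimes> (k \<otimes> x [^] b) \<oplus> r \<otimes> (x [^] a \<otimes> l') \<oplus> l \<otimes> t') = \<zero>"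
      using t(3) by simp
    moreover have "r \<otimes> (k \<otimes> x [^] b) \<oplus> r \<otimes> (x [^] a \<otimes> l') \<oplus> l \<otimes> t' \<in> L (a + b)"
      using r(1,2) r'(2) k(1) t' by (intro L_add L_smult L_power L_power_left L_mult)
    ultimately have "r \<otimes> (\<sigma> ^^ a) r' = \<zero>"
      using leading[of "r \<otimes> (\<sigma> ^^ a) r'"] r(1) \<sigma>r'(1) by simp
    then show False using S r(1,3) \<sigma>r' by blast
  qed
qed

lemma (in ring) iterated_Ore_extension_no_zero_divisors:
  assumes "iterated_Ore_extension R K T"
    and "\<And>a b. a \<in> K \<Longrightarrow> b \<in> K \<Longrightarrow> a \<otimes> b = \<zero> \<Longrightarrow> a = \<zero> \<or> b = \<zero>"
  shows "a \<in> T \<Longrightarrow> b \<in> T \<Longrightarrow> a \<otimes> b = \<zero> \<Longrightarrow> a = \<zero> \<or> b = \<zero>"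
  using assms
proof (induction arbitrary: a b rule: iterated_Ore_extension.induct)
  case (step S T)
  then show ?case using Ore_extension_no_zero_divisors[of S T a b] by blast
qed blast

text \<open>The common core of two uniqueness statements: \<open>g i a = a x\<^sup>i\<close> gives the expansions in an Ore extension,
  and \<open>g i a = a\<close> the decomposition into homogeneous components.\<close>

lemma (in ring) unique_finite_expansion:
  fixes V :: "nat \<Rightarrow> 'a set" and g :: "nat \<Rightarrow> 'a \<Rightarrow> 'a"
  assumes V: "\<And>i. V i \<subseteq> carrier R" "\<And>i. \<zero> \<in> V i" "\<And>i a b. a \<in> V i \<Longrightarrow> b \<in> V i \<Longrightarrow> a \<ominus> b \<in> V i"
    and g: "\<And>i a. a \<in> V i \<Longrightarrow> g i a \<in> carrier R" "\<And>i. g i \<zero> = \<zero>"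
      "\<And>i a b. a \<in> V i \<Longrightarrow> b \<in> V i \<Longrightarrow> g i (a \<ominus> b) = g i a \<ominus> g i b"
    and indep: "\<And>S c. finite S \<Longrightarrow> (\<And>i. c i \<in> V i) \<Longrightarrow> (\<Oplus>i\<in>S. g i (c i)) = \<zero> \<Longrightarrow> \<forall>i\<in>S. c i = \<zero>"
    and ex: "\<And>i. d i \<in> V i" "\<And>i. i > N \<Longrightarrow> d i = \<zero>" "a = (\<Oplus>i\<in>{..N::nat}. g i (d i))"
  shows "\<exists>!c. (\<forall>i. c i \<in> V i) \<and> finite {i. c i \<noteq> \<zero>} \<and> a = (\<Oplus>i\<in>{i. c i \<noteq> \<zero>}. g i (c i))"
proof -
  have extend: "(\<Oplus>i\<in>{i. c i \<noteq> \<zero>}. g i (c i)) = (\<Oplus>i\<in>S. g i (c i))"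
    if "finite S" "{i. c i \<noteq> \<zero>} \<subseteq> S" "\<And>i. c i \<in> V i" for S c
    using that g by (intro add.finprod_mono_neutral_cong_left) auto
  show ?thesis
  proof (rule ex1I[of _ d])
    have "{i. d i \<noteq> \<zero>} \<subseteq> {..N}"
      using ex(2) not_le by auto
    then show "(\<forall>i. d i \<in> V i) \<and> finite {i. d i \<noteq> \<zero>} \<and> a = (\<Oplus>i\<in>{i. d i \<noteq> \<zero>}. g i (d i))"
      using ex(1) extend[of "{..N}" d] ex(3) finite_subset by auto
  next
    fix c assume c: "(\<forall>i. c i \<in> V i) \<and> finite {i. c i \<noteq> \<zero>} \<and> a = (\<Oplus>i\<in>{i. c i \<noteq> \<zero>}. g i (c i))"
    let ?S = "{i. c i \<noteq> \<zero>} \<union> {..N}"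
    have cV: "\<And>i. c i \<in> V i" using c by blast
    have S: "finite ?S" using c by simp
    have d0: "{i. d i \<noteq> \<zero>} \<subseteq> {..N}"
      using ex(2) not_le by auto
    have "a = (\<Oplus>i\<in>?S. g i (d i))"
      using extend[of "{..N}" d] extend[of ?S d] d0 ex S by auto
    moreover have "a = (\<Oplus>i\<in>?S. g i (c i))"
      using extend[of ?S c] cV S c by auto
    moreover have "(\<Oplus>i\<in>?S. g i (c i \<ominus> d i)) \<oplus> (\<Oplus>i\<in>?S. g i (d i)) = (\<Oplus>i\<in>?S. g i (c i \<ominus> d i) \<oplus> g i (d i))"
      using cV ex(1) V(3) g(1) by (intro finsum_addf[symmetric]) auto
    moreover have "(\<Oplus>i\<in>?S. g i (c i \<ominus> d i) \<oplus> g i (d i)) = (\<Oplus>i\<in>?S. g i (c i))"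
    proof (rule add.finprod_cong')
      fix i
      have "g i (c i) \<in> carrier R" "g i (d i) \<in> carrier R" using cV ex(1) g(1) by auto
      then show "g i (c i \<ominus> d i) \<oplus> g i (d i) = g i (c i)"
        using cV ex(1) g(3) by (simp add: a_minus_def a_assoc l_neg)
    qed (use cV g(1) in auto)
    moreover have "(\<Oplus>i\<in>?S. g i (c i \<ominus> d i)) \<in> carrier R" "(\<Oplus>i\<in>?S. g i (d i)) \<in> carrier R"
      using cV ex(1) V(3) g(1) by (auto intro!: finsum_closed)
    ultimately have "(\<Oplus>i\<in>?S. g i (c i \<ominus> d i)) = \<zero>"
      by (metis add.r_cancel_one)
    then have "\<forall>i\<in>?S. c i \<ominus> d i = \<zero>"
      using cV ex(1) V(3) S by (intro indep) auto
    moreover have "c i = d i" if "i \<notin> ?S" for i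
      using that ex(2)[of i] by auto
    ultimately show "c = d"
      using cV ex(1) V(1) r_right_minus_eq by (metis ext subsetD)
  qed
qed

section \<open>Algebras with a basis of ordered monomials\<close>

text \<open>The last assumption makes the ordered words a basis; the others say that they span.\<close>

locale pbw_algebra = complex_algebra A \<iota> for A :: "('a, 'm) ring_scheme" (structure) and \<iota> +
  fixes z :: "'x::linorder \<Rightarrow> 'a" and I :: "'x set" and c :: "'x \<Rightarrow> 'x \<Rightarrow> complex"
  assumes finite_I: "finite I"
    and gen_closed: "z ` I \<subseteq> carrier A"
    and generated: "carrier A \<subseteq> free_eval A \<iota> z ` supported_on (words I)"
    and exchange_coeff: "a \<in> I \<Longrightarrow> b \<in> I \<Longrightarrow> a < b \<Longrightarrow> c b a \<noteq> 0"
    and exchange_gen: "a \<in> I \<Longrightarrow> b \<in> I \<Longrightarrow> a < b \<Longrightarrow>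
      \<exists>p\<in>supported_on (words_of_length {x\<in>I. x < b} 2).
        free_eval A \<iota> z (free_gen b * free_gen a - free_scalar (c b a) * free_gen a * free_gen b - p) = \<zero>"
    and independent_words: "f \<in> supported_on (sorted_words I) \<Longrightarrow> free_eval A \<iota> z f = \<zero> \<Longrightarrow> f = 0"
begin

abbreviation "\<phi> \<equiv> free_eval A \<iota> z"

definition K where "K = {f \<in> supported_on (words I). \<phi> f = \<zero>}"

lemmas \<phi>_simps [simp] =
  free_eval_closed[OF gen_closed] free_eval_add[OF gen_closed] free_eval_mult[OF gen_closed]
  free_eval_scalar[OF gen_closed] free_eval_one[OF gen_closed] free_eval_gen[OF gen_closed]
  free_eval_uminus[OF gen_closed] free_eval_diff[OF gen_closed] free_eval_zero[OF gen_closed]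
  free_eval_power[OF gen_closed]

lemmas \<phi>_sum = free_eval_sum[OF gen_closed]

lemma gen_in_carrier [simp]: "x \<in> I \<Longrightarrow> z x \<in> carrier A"
  using gen_closed by auto

lemma K_ideal: "ideal K (free_algebra I)"
proof -
  interpret ring_hom_ring "free_algebra I" A \<phi>
    by (rule free_eval_ring_hom[OF gen_closed])
  have "K = a_kernel (free_algebra I) A \<phi>"
    unfolding K_def a_kernel_def' carrier_free_algebra by (rule refl)
  with kernel_is_ideal show ?thesis by (simp only:)
qed

lemma words_subset: "J \<subseteq> I \<Longrightarrow> f \<in> supported_on (words J) \<Longrightarrow> f \<in> supported_on (words I)"
  by (rule subsetD[OF supported_on_mono]) (auto simp: words_def)

lemma words_of_length_subset:
  "J \<subseteq> I \<Longrightarrow> f \<in> supported_on (words_of_length J d) \<Longrightarrow> f \<in> supported_on (words I)"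
  by (rule subsetD[OF supported_on_mono]) (auto simp: words_def words_of_length_def)

lemma sorted_words_subset:
  "J \<subseteq> I \<Longrightarrow> f \<in> supported_on (sorted_words J) \<Longrightarrow> f \<in> supported_on (words I)"
  by (rule subsetD[OF supported_on_mono]) (auto simp: words_def sorted_words_def)

sublocale ordered_rewriting I K c
proof (intro ordered_rewriting.intro finite_I K_ideal)
  show "\<exists>p\<in>supported_on (words_of_length {x \<in> I. x < b} 2).
          free_gen b * free_gen a - free_scalar (c b a) * free_gen a * free_gen b - p \<in> K"
    if ab: "a \<in> I" "b \<in> I" "a < b" for a b
  proof -
    obtain p where p: "p \<in> supported_on (words_of_length {x\<in>I. x < b} 2)"
      and eq: "\<phi> (free_gen b * free_gen a - free_scalar (c b a) * free_gen a * free_gen b - p) = \<zero>"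
      using exchange_gen[OF ab] by (rule bexE)
    have p': "p \<in> supported_on (words I)"
      using p by (rule words_of_length_subset[rotated]) auto
    have "free_gen b * free_gen a - free_scalar (c b a) * free_gen a * free_gen b - p \<in> K"
      unfolding K_def using ab p' eq by (intro CollectI conjI supported_on_diff free_closed) simp_all
    then show ?thesis
      using p by (rule bexI)
  qed
qed

end

context pbw_algebra
begin

lemma eqv_iff:
  assumes "f \<in> supported_on (words I)" "g \<in> supported_on (words I)"
  shows "eqv f g \<longleftrightarrow> \<phi> f = \<phi> g"
  using assms unfolding eqv_def unfolding K_def by simp

definition initial :: "'x set \<Rightarrow> bool"
  where "initial J \<longleftrightarrow> J \<subseteq> I \<and> (\<forall>x\<in>J. \<forall>y\<in>I. y < x \<longrightarrow> y \<in> J)"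

lemma initial_less: "initial {x\<in>I. x < b}"
  by (auto simp: initial_def)

lemma homogeneous_normal_form_value:
  assumes J: "initial J" and f: "f \<in> supported_on (words_of_length J d)"
  shows "\<exists>g\<in>supported_on (sorted_words J \<inter> words_of_length J d). \<phi> f = \<phi> g"
proof -
  obtain g where g: "g \<in> supported_on (sorted_words J \<inter> words_of_length J d)" "eqv f g"
    using homogeneous_normal_form[of J f d] J f finite_subset[OF _ finite_I] unfolding initial_def by auto
  moreover have "f \<in> supported_on (words I)" "g \<in> supported_on (words I)"
    using J f words_of_length_subset[of J] g(1) supported_on_mono[of "sorted_words J \<inter> words_of_length J d" "words_of_length J d"]
    by (auto simp: initial_def)
  ultimately show ?thesis using eqv_iff by auto
qed

lemma normal_form_value:
  assumes J: "initial J" and f: "f \<in> supported_on (words J)"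
  shows "\<exists>g\<in>supported_on (sorted_words J). \<phi> f = \<phi> g"
proof -
  have J': "J \<subseteq> I" using J by (simp add: initial_def)
  obtain g where g: "g \<in> supported_on (sorted_words J)" "eqv f g"
    using normal_form[of J f] J f finite_subset[OF J' finite_I] unfolding initial_def by auto
  then show ?thesis
    using eqv_iff[OF words_subset[OF J' f] sorted_words_subset[OF J' g(1)]] by (intro bexI[of _ g]) simp_all
qed

lemma sorted_zero:
  "J \<subseteq> I \<Longrightarrow> f \<in> supported_on (sorted_words J) \<Longrightarrow> \<phi> f = \<zero> \<Longrightarrow> f = 0"
  by (rule independent_words[OF subsetD[OF supported_on_mono]]) (auto simp: sorted_words_def words_def)

lemma free_gen_power: "free_gen b ^ m = Poly_Mapping.single (Word (replicate m b)) 1"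
  by (induction m) (simp_all add: free_gen_def mult_single plus_free_word_def flip: single_one zero_free_word_def)

lemma lookup_times_single:
  fixes f :: "'x free_word \<Rightarrow>\<^sub>0 complex"
  shows "Poly_Mapping.lookup (f * Poly_Mapping.single u 1) (v + u) = Poly_Mapping.lookup f v"
    "(\<And>w. w \<in> Poly_Mapping.keys f \<Longrightarrow> w + u \<noteq> v') \<Longrightarrow> Poly_Mapping.lookup (f * Poly_Mapping.single u 1) v' = 0"
proof -
  have f: "f \<in> supported_on UNIV" by (simp add: supported_on_def)
  have cancel: "w + u = v + u \<longleftrightarrow> w = v" for w
    by (simp add: plus_free_word_def) (metis free_word.expand)
  from f show "Poly_Mapping.lookup (f * Poly_Mapping.single u 1) (v + u) = Poly_Mapping.lookup f v"
    by (induction f rule: supported_on_induct)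
      (simp_all add: mult_single lookup_single when_def cancel lookup_add distrib_right)
  show "Poly_Mapping.lookup (f * Poly_Mapping.single u 1) v' = 0"
    if "\<And>w. w \<in> Poly_Mapping.keys f \<Longrightarrow> w + u \<noteq> v'"
  proof -
    have "v' \<notin> Poly_Mapping.keys (f * Poly_Mapping.single u 1)"
      using that keys_mult[of f "Poly_Mapping.single u 1"] by auto
    then show ?thesis by (simp add: in_keys_iff)
  qed
qed

text \<open>The words \<open>v b\<^sup>m\<close> with \<open>v\<close> an ordered word below \<open>b\<close> are ordered and pairwise different, since \<open>m\<close> is the number
  of occurrences of \<open>b\<close>.\<close>

lemma power_expansion_unique:
  assumes b: "b \<in> I" and S: "finite S"
    and h: "\<And>m. h m \<in> supported_on (sorted_words {x\<in>I. x < b})"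
    and zero: "\<phi> (\<Sum>m\<in>S. h m * free_gen b ^ m) = \<zero>" and m: "m \<in> S"
  shows "h m = 0"
proof -
  let ?J = "{x\<in>I. x < b}"
  have "h m * free_gen b ^ m \<in> supported_on (sorted_words (insert b ?J))" for m
  proof (rule supported_on_mult[OF h])
    show "free_gen b ^ m \<in> supported_on {Word (replicate m b)}"
      by (simp add: free_gen_power)
  qed (auto simp: sorted_words_def words_def sorted_append less_imp_le)
  then have "(\<Sum>m\<in>S. h m * free_gen b ^ m) \<in> supported_on (sorted_words (insert b ?J))"
    by (rule supported_on_sum)
  with zero have sum0: "(\<Sum>m\<in>S. h m * free_gen b ^ m) = 0"
    using sorted_zero[of "insert b ?J"] b by auto
  show ?thesis
  proof (rule poly_mapping_eqI)
    fix v
    show "Poly_Mapping.lookup (h m) v = Poly_Mapping.lookup 0 v"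
    proof (cases "v \<in> Poly_Mapping.keys (h m)")
      case True
      let ?v = "v + Word (replicate m b)"
      have count: "count_list (letters w) b = 0" if "w \<in> Poly_Mapping.keys (h k)" for w k
      proof -
        have "w \<in> sorted_words ?J" using h[of k] that by (auto simp: supported_on_def)
        then have "b \<notin> set (letters w)" by (auto simp: sorted_words_def words_def)
        then show ?thesis by (simp add: count_list_0_iff)
      qed
      have rep: "count_list (replicate k b) b = k" for k by (induction k) auto
      have "Poly_Mapping.lookup (h k * free_gen b ^ k) ?v = (if k = m then Poly_Mapping.lookup (h m) v else 0)" for k
      proof (cases "k = m")
        case True
        then show ?thesis by (simp add: free_gen_power lookup_times_single(1))
      next
        case False
        have "w + Word (replicate k b) \<noteq> ?v" if "w \<in> Poly_Mapping.keys (h k)" for w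
        proof
          assume "w + Word (replicate k b) = ?v"
          then have "letters w @ replicate k b = letters v @ replicate m b"
            by (simp add: plus_free_word_def)
          then have "count_list (letters w @ replicate k b) b = count_list (letters v @ replicate m b) b"
            by simp
          then show False using count[OF that] count[OF True] False by (simp add: rep)
        qed
        then show ?thesis using False by (simp add: free_gen_power lookup_times_single(2))
      qed
      then have "Poly_Mapping.lookup (\<Sum>k\<in>S. h k * free_gen b ^ k) ?v = Poly_Mapping.lookup (h m) v"
        using S m by (simp add: lookup_sum)
      then show ?thesis by (simp add: sum0)
    qed (simp add: in_keys_iff)
  qed
qed

subsection \<open>The iterated Ore extension\<close>

definition layer :: "'x set \<Rightarrow> 'a set"
  where "layer J = \<phi> ` supported_on (words J)"

lemma layerE:
  assumes "r \<in> layer J" "J \<subseteq> I"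
  obtains f where "f \<in> supported_on (words J)" "f \<in> supported_on (words I)" "r = \<phi> f"
  using assms words_subset unfolding layer_def by blast

lemma subring_layer:
  assumes "J \<subseteq> I" shows "subring (layer J) A"
proof (rule subringI)
  show "layer J \<subseteq> carrier A"
    using assms by (auto elim: layerE)
  show "\<one> \<in> layer J"
    unfolding layer_def by (rule image_eqI[of _ _ 1]) simp_all
  show "\<ominus> h \<in> layer J" if h: "h \<in> layer J" for h
  proof -
    obtain f where "f \<in> supported_on (words J)" "f \<in> supported_on (words I)" "h = \<phi> f"
      by (rule layerE[OF h assms])
    then show ?thesis unfolding layer_def by (intro image_eqI[of _ _ "- f"]) simp_all
  qed
  fix h h' assume "h \<in> layer J" "h' \<in> layer J"
  obtain f where "f \<in> supported_on (words J)" "f \<in> supported_on (words I)" "h = \<phi> f"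
    by (rule layerE[OF \<open>h \<in> layer J\<close> assms])
  moreover obtain f' where "f' \<in> supported_on (words J)" "f' \<in> supported_on (words I)" "h' = \<phi> f'"
    by (rule layerE[OF \<open>h' \<in> layer J\<close> assms])
  ultimately have "h \<otimes> h' = \<phi> (f * f')" "h \<oplus> h' = \<phi> (f + f')"
    "f * f' \<in> supported_on (words J)" "f + f' \<in> supported_on (words J)"
    by simp_all
  then show "h \<otimes> h' \<in> layer J" "h \<oplus> h' \<in> layer J"
    unfolding layer_def by (simp_all only: imageI)
qed

lemma exchange_char_nonzero:
  assumes "b \<in> I" "w \<in> words {x\<in>I. x < b}"
  shows "exchange_char b w \<noteq> 0"
  using assms exchange_coeff by (auto simp: exchange_char_def words_def prod_list_zero_iff)

text \<open>This is what makes \<open>\<sigma>\<close> well defined and injective.  If \<open>f\<close> evaluates to zero, then so does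
  \<open>b f\<close>, that is \<open>\<chi>(f) b + g\<close>, and by uniqueness of the expansion in powers of \<open>b\<close> the
  coefficient of \<open>b\<close> vanishes.  Conversely, replace \<open>f\<close> by its ordered form \<open>h\<close>: if \<open>\<chi>(h)\<close>, which is
  again ordered, evaluates to zero, it is zero, and \<open>\<chi>\<close> only rescales coefficients by nonzero numbers.\<close>

lemma scale_kernel:
  assumes b: "b \<in> I" and f: "f \<in> supported_on (words {x\<in>I. x < b})"
  shows "\<phi> (word_scale (exchange_char b) f) = \<zero> \<longleftrightarrow> \<phi> f = \<zero>"
proof -
  let ?J = "{x\<in>I. x < b}" and ?\<chi> = "word_scale (exchange_char b)"
  have J: "initial ?J" "?J \<subseteq> I" by (auto simp: initial_def)
  note sub = words_subset[OF J(2)]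
  have kernel: "\<phi> (?\<chi> f) = \<zero>" if f: "f \<in> supported_on (words ?J)" "\<phi> f = \<zero>" for f
  proof -
    obtain g where g: "g \<in> supported_on (words ?J)" "eqv (free_gen b * f) (?\<chi> f * free_gen b + g)"
      using exchange_any[OF b f(1)] by auto
    obtain h where h1: "h \<in> supported_on (sorted_words ?J)" "\<phi> (?\<chi> f) = \<phi> h"
      using normal_form_value[OF J(1) word_scale_supported[OF f(1)]] by (rule bexE)
    obtain h' where h2: "h' \<in> supported_on (sorted_words ?J)" "\<phi> g = \<phi> h'"
      using normal_form_value[OF J(1) g(1)] by (rule bexE)
    note h = h1 h2
    note mem = sub[OF f(1)] sub[OF g(1)] sub[OF word_scale_supported[OF f(1)], of "exchange_char b"]
      sorted_words_subset[OF J(2) h(1)] sorted_words_subset[OF J(2) h(3)]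
    have "\<phi> (free_gen b * f) = \<phi> (?\<chi> f * free_gen b + g)"
      using g(2) mem b by (subst eqv_iff[symmetric]) simp_all
    then have "\<phi> h \<otimes> z b \<oplus> \<phi> h' = \<zero>"
      using mem b f(2) h by simp
    \<comment> \<open>The left-hand side as an expansion in powers of \<open>b\<close>, with coefficients \<open>h'\<close> and \<open>h\<close>.\<close>
    moreover define k where "k m = (if m = 0 then h' else h)" for m :: nat
    ultimately have "\<phi> (\<Sum>m\<in>{0,1}. k m * free_gen b ^ m) = \<zero>"
      using mem b by (simp add: a_comm)
    from power_expansion_unique[OF b _ _ this, of 1] have "h = 0"
      using h by (simp add: k_def)
    then show ?thesis using h(2) by simp
  qed
  show ?thesis
  proof
    assume zero: "\<phi> (?\<chi> f) = \<zero>"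
    obtain h where h: "h \<in> supported_on (sorted_words ?J)" "\<phi> f = \<phi> h"
      using normal_form_value[OF J(1) f] by auto
    have h': "h \<in> supported_on (words ?J)"
      using h(1) supported_on_mono[of "sorted_words ?J" "words ?J"] by (auto simp: sorted_words_def)
    have "\<phi> (?\<chi> (f - h)) = \<zero>"
      using f h h' sub[OF f] sub[OF h'] by (intro kernel) (simp_all add: r_right_minus_eq)
    then have "\<phi> (?\<chi> h) = \<zero>"
      using zero sub[OF word_scale_supported[OF f]] sub[OF word_scale_supported[OF h']]
      by (simp add: r_right_minus_eq)
    then have "?\<chi> h = 0"
      using h(1) J(2) by (intro sorted_zero[of ?J]) simp_all
    moreover have "word_scale (\<lambda>w. inverse (exchange_char b w)) (?\<chi> h) = h"
      unfolding word_scale_compose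
      using h' exchange_char_nonzero[OF b] by (subst word_scale_cong[of _ _ _ "\<lambda>w. 1"]) auto
    ultimately have "h = 0" by simp
    then show "\<phi> f = \<zero>" using h(2) by simp
  qed (rule kernel[OF f])
qed

text \<open>The automorphism is induced by rescaling words, and \<open>\<delta>\<close> is the defect \<open>z\<^sub>b r - \<sigma>(r) z\<^sub>b\<close>.  Thus the Leibniz rule
  is a formal consequence of \<open>\<sigma>\<close> being a homomorphism; that \<open>\<delta>\<close> maps into the smaller layer is the
  exchange rule.\<close>

lemma Ore_extension_layer:
  assumes b: "b \<in> I"
  shows "Ore_extension A (layer {x\<in>I. x < b}) (layer (insert b {x\<in>I. x < b}))"
proof -
  let ?J = "{x\<in>I. x < b}" and ?\<chi> = "word_scale (exchange_char b)"
  let ?R = "layer ?J" and ?T = "layer (insert b ?J)"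
  have J: "initial ?J" "?J \<subseteq> I" by (auto simp: initial_def)
  have J': "insert b ?J \<subseteq> I" using b by auto
  note sub = words_subset[OF J(2)]
  interpret R: subring ?R A by (rule subring_layer[OF J(2)])
  have RA: "r \<in> carrier A" if "r \<in> ?R" for r using R.subset that by auto
  define \<sigma> where "\<sigma> r = \<phi> (?\<chi> (SOME f. f \<in> supported_on (words ?J) \<and> r = \<phi> f))" for r
  have \<sigma>: "\<sigma> (\<phi> f) = \<phi> (?\<chi> f)" if f: "f \<in> supported_on (words ?J)" for f
  proof -
    define g where "g = (SOME g. g \<in> supported_on (words ?J) \<and> \<phi> f = \<phi> g)"
    have g: "g \<in> supported_on (words ?J)" "\<phi> f = \<phi> g"
      unfolding g_def using someI[of "\<lambda>g. g \<in> supported_on (words ?J) \<and> \<phi> f = \<phi> g" f] f by simp_all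
    have "\<phi> (g - f) = \<zero>"
      using g sub[OF f] sub[OF g(1)] by (simp add: r_right_minus_eq)
    then have "\<phi> (?\<chi> (g - f)) = \<zero>"
      using scale_kernel[OF b, of "g - f"] f g(1) by simp
    then show ?thesis
      unfolding \<sigma>_def g_def[symmetric]
      using sub[OF word_scale_supported[OF f]] sub[OF word_scale_supported[OF g(1)]]
      by (simp add: r_right_minus_eq)
  qed
  have repr: "\<exists>f. f \<in> supported_on (words ?J) \<and> f \<in> supported_on (words I) \<and>
      ?\<chi> f \<in> supported_on (words ?J) \<and> ?\<chi> f \<in> supported_on (words I) \<and> r = \<phi> f \<and> \<sigma> r = \<phi> (?\<chi> f)"
    if r: "r \<in> ?R" for r
  proof -
    obtain f where "f \<in> supported_on (words ?J)" "f \<in> supported_on (words I)" "r = \<phi> f"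
      by (rule layerE[OF r J(2)])
    then show ?thesis using \<sigma> sub word_scale_supported by (intro exI[of _ f]) simp
  qed
  have layerI: "\<phi> f \<in> ?R" if "f \<in> supported_on (words ?J)" for f
    using that unfolding layer_def by (rule imageI)
  have \<sigma>R: "\<sigma> r \<in> ?R" if "r \<in> ?R" for r
    using repr[OF that] layerI by auto
  have \<sigma>_add: "\<sigma> (r \<oplus> s) = \<sigma> r \<oplus> \<sigma> s" and \<sigma>_mult: "\<sigma> (r \<otimes> s) = \<sigma> r \<otimes> \<sigma> s" if rs: "r \<in> ?R" "s \<in> ?R" for r s
  proof -
    obtain f g where f: "f \<in> supported_on (words ?J)" "f \<in> supported_on (words I)"
      "?\<chi> f \<in> supported_on (words I)" "r = \<phi> f" "\<sigma> r = \<phi> (?\<chi> f)"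
      and g: "g \<in> supported_on (words ?J)" "g \<in> supported_on (words I)"
      "?\<chi> g \<in> supported_on (words I)" "s = \<phi> g" "\<sigma> s = \<phi> (?\<chi> g)"
      using repr[OF rs(1)] repr[OF rs(2)] by auto
    show "\<sigma> (r \<oplus> s) = \<sigma> r \<oplus> \<sigma> s"
      using \<sigma>[of "f + g"] f g by simp
    show "\<sigma> (r \<otimes> s) = \<sigma> r \<otimes> \<sigma> s"
      using \<sigma>[of "f * g"] f g by (simp add: word_scale_mult[OF exchange_char_add])
  qed
  have \<sigma>_one: "\<sigma> \<one> = \<one>"
  proof -
    have "?\<chi> 1 = 1"
      by (simp add: exchange_char_def flip: single_one)
    then show ?thesis using \<sigma>[of 1] by simp
  qed
  have \<sigma>_inj: "inj_on \<sigma> ?R"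
  proof (rule inj_onI)
    fix r s assume rs: "r \<in> ?R" "s \<in> ?R" "\<sigma> r = \<sigma> s"
    obtain f g where f: "f \<in> supported_on (words ?J)" "f \<in> supported_on (words I)"
      "?\<chi> f \<in> supported_on (words I)" "r = \<phi> f" "\<sigma> r = \<phi> (?\<chi> f)"
      and g: "g \<in> supported_on (words ?J)" "g \<in> supported_on (words I)"
      "?\<chi> g \<in> supported_on (words I)" "s = \<phi> g" "\<sigma> s = \<phi> (?\<chi> g)"
      using repr[OF rs(1)] repr[OF rs(2)] by auto
    have "\<phi> (?\<chi> (f - g)) = \<zero>"
      using f g rs(3) by (simp add: r_right_minus_eq)
    then have "\<phi> (f - g) = \<zero>"
      using scale_kernel[OF b, of "f - g"] f(1) g(1) by simp
    then show "r = s" using f g by (simp add: r_right_minus_eq)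
  qed
  have \<sigma>_surj: "\<sigma> ` ?R = ?R"
  proof (rule antisym)
    show "?R \<subseteq> \<sigma> ` ?R"
    proof
      fix r assume r: "r \<in> ?R"
      obtain f where f: "f \<in> supported_on (words ?J)" "r = \<phi> f"
        using repr[OF r] by auto
      define g where "g = word_scale (\<lambda>w. inverse (exchange_char b w)) f"
      have g: "g \<in> supported_on (words ?J)"
        using f by (simp add: g_def)
      have "?\<chi> g = f"
        unfolding g_def word_scale_compose
        using f(1) exchange_char_nonzero[OF b] by (subst word_scale_cong[of _ _ _ "\<lambda>w. 1"]) auto
      then have "r = \<sigma> (\<phi> g)" using \<sigma>[OF g] f by simp
      then show "r \<in> \<sigma> ` ?R" using layerI[OF g] by blast
    qed
  qed (use \<sigma>R in auto)
  have iso: "\<sigma> \<in> ring_iso (A\<lparr>carrier := ?R\<rparr>) (A\<lparr>carrier := ?R\<rparr>)"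
    using \<sigma>R \<sigma>_add \<sigma>_mult \<sigma>_one \<sigma>_inj \<sigma>_surj
    by (intro ring_iso_memI) (simp_all add: bij_betw_def)
  define \<delta> where "\<delta> r = z b \<otimes> r \<ominus> \<sigma> r \<otimes> z b" for r
  have zb: "z b \<in> carrier A" using b by simp
  have \<sigma>A: "\<sigma> r \<in> carrier A" if "r \<in> ?R" for r using RA \<sigma>R that by blast
  have comm: "z b \<otimes> r = \<sigma> r \<otimes> z b \<oplus> \<delta> r" if "r \<in> ?R" for r
    using that zb RA[OF that] \<sigma>A[OF that] by (simp add: \<delta>_def a_minus_def a_ac r_neg1 r_neg)
  have \<delta>R: "\<delta> r \<in> ?R" if r: "r \<in> ?R" for r
  proof -
    obtain f where f: "f \<in> supported_on (words ?J)" "f \<in> supported_on (words I)"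
      "?\<chi> f \<in> supported_on (words I)" "r = \<phi> f" "\<sigma> r = \<phi> (?\<chi> f)"
      using repr[OF r] by auto
    obtain g where g: "g \<in> supported_on (words ?J)" "eqv (free_gen b * f) (?\<chi> f * free_gen b + g)"
      using exchange_any[OF b f(1)] by (rule bexE)
    have "\<phi> (free_gen b * f) = \<phi> (?\<chi> f * free_gen b + g)"
      using g(2) f(2,3) b sub[OF g(1)] by (subst eqv_iff[symmetric]) simp_all
    then have "z b \<otimes> r = \<sigma> r \<otimes> z b \<oplus> \<phi> g"
      using f b sub[OF g(1)] by simp
    with comm[OF r] have eq: "\<sigma> r \<otimes> z b \<oplus> \<delta> r = \<sigma> r \<otimes> z b \<oplus> \<phi> g"
      by (rule subst)
    have mem: "\<delta> r \<in> carrier A" "\<sigma> r \<otimes> z b \<in> carrier A" "\<phi> g \<in> carrier A"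
      using RA[OF r] \<sigma>A[OF r] zb sub[OF g(1)] by (simp_all add: \<delta>_def)
    from add.l_cancel[of "\<sigma> r \<otimes> z b" "\<delta> r" "\<phi> g"] have "\<delta> r = \<phi> g"
      using mem eq by blast
    then show ?thesis using layerI[OF g(1)] by simp
  qed
  have skew: "skew_derivation A ?R \<sigma> \<delta>"
    unfolding skew_derivation_def
  proof (intro conjI ballI)
    show "\<delta> \<in> ?R \<rightarrow> ?R" using \<delta>R by auto
    fix r s assume rs: "r \<in> ?R" "s \<in> ?R"
    have mem: "r \<in> carrier A" "s \<in> carrier A" "\<sigma> r \<in> carrier A" "\<sigma> s \<in> carrier A"
      using rs RA \<sigma>A by auto
    show "\<delta> (r \<oplus> s) = \<delta> r \<oplus> \<delta> s"
      using mem zb rs by (simp add: \<delta>_def \<sigma>_add a_minus_def r_distr l_distr minus_add a_ac)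
    have "\<sigma> r \<otimes> \<delta> s \<oplus> \<delta> r \<otimes> s =
      \<sigma> r \<otimes> (z b \<otimes> s) \<oplus> \<ominus> (\<sigma> r \<otimes> (\<sigma> s \<otimes> z b)) \<oplus> (z b \<otimes> (r \<otimes> s) \<oplus> \<ominus> (\<sigma> r \<otimes> (z b \<otimes> s)))"
      using mem zb by (simp add: \<delta>_def a_minus_def r_distr l_distr r_minus l_minus m_assoc)
    also have "\<dots> = \<delta> (r \<otimes> s)"
      using mem zb rs by (simp add: \<delta>_def \<sigma>_mult a_minus_def m_assoc a_ac r_neg1 r_neg2 r_neg)
    finally show "\<delta> (r \<otimes> s) = \<sigma> r \<otimes> \<delta> s \<oplus> \<delta> r \<otimes> s" by simp
  qed
  have expand: "\<exists>!c :: nat \<Rightarrow> 'a. (\<forall>i. c i \<in> ?R) \<and> finite {i. c i \<noteq> \<zero>} \<and>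
      t = (\<Oplus>i\<in>{i. c i \<noteq> \<zero>}. c i \<otimes> (z b [^] i))" if t: "t \<in> ?T" for t
  proof -
    obtain f where f: "f \<in> supported_on (words (insert b ?J))" "f \<in> supported_on (words I)" "t = \<phi> f"
      by (rule layerE[OF t J'])
    define good where "good f h N \<longleftrightarrow> (\<forall>m. h m \<in> supported_on (words ?J)) \<and> (\<forall>m>N. h m = 0) \<and>
        eqv f (\<Sum>m\<le>N. h m * free_gen b ^ m)" for f and h :: "nat \<Rightarrow> _" and N
    have "\<exists>h N. good f h N"
      using f(1)
    proof (induction f rule: supported_on_induct)
      case zero
      have "good 0 (\<lambda>m. 0) 0" by (simp add: good_def)
      then show ?case by blast
    next
      case (single w a)
      let ?d = "length (letters w)"
      have "Poly_Mapping.single w a \<in> supported_on (words_of_length (insert b ?J) ?d)"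
        using single by (simp add: words_of_length_def)
      from power_expansion[OF b this] obtain h
        where h: "\<forall>m. h m \<in> supported_on (words_of_length ?J (?d - m))"
          and eq: "eqv (Poly_Mapping.single w a) (\<Sum>m\<le>?d. h m * free_gen b ^ m)"
        by (elim exE conjE) (rule that)
      have "(\<Sum>m\<le>?d. (if m \<le> ?d then h m else 0) * free_gen b ^ m) = (\<Sum>m\<le>?d. h m * free_gen b ^ m)"
        by (rule sum.cong) auto
      then have "good (Poly_Mapping.single w a) (\<lambda>m. if m \<le> ?d then h m else 0) ?d"
        using eq subsetD[OF supported_on_mono[OF words_of_length_simps(2)] h[rule_format]]
        by (simp add: good_def)
      then show ?case by (intro exI)
    next
      case (add f f')
      then obtain h N h' N' where good: "good f h N" "good f' h' N'" by auto
      have vanish: "\<not> m \<le> N \<Longrightarrow> h m = 0" "\<not> m \<le> N' \<Longrightarrow> h' m = 0" for m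
        using good by (simp_all add: good_def not_le)
      have grow: "(\<Sum>m\<le>max N N'. h m * free_gen b ^ m) = (\<Sum>m\<le>N. h m * free_gen b ^ m)"
        "(\<Sum>m\<le>max N N'. h' m * free_gen b ^ m) = (\<Sum>m\<le>N'. h' m * free_gen b ^ m)"
        by (intro sum.mono_neutral_right; simp add: vanish)+
      have "good (f + f') (\<lambda>m. h m + h' m) (max N N')"
        using good eqv_add[of f _ f'] by (simp add: good_def distrib_right sum.distrib grow)
      then show ?case by (intro exI)
    qed
    then obtain h N where h: "\<And>m. h m \<in> supported_on (words ?J)" "\<And>m. m > N \<Longrightarrow> h m = 0"
      and eq: "eqv f (\<Sum>m\<le>N. h m * free_gen b ^ m)"
      unfolding good_def by (elim exE conjE) (rule that, simp_all)
    have hb: "h m * free_gen b ^ m \<in> supported_on (words I)" for m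
      using sub[OF h(1)] b by simp
    have "t = \<phi> (\<Sum>m\<le>N. h m * free_gen b ^ m)"
      using eq f hb by (simp add: eqv_iff supported_on_sum)
    also have "\<dots> = (\<Oplus>m\<in>{..N}. \<phi> (h m * free_gen b ^ m))"
      using hb by (intro \<phi>_sum) auto
    also have "\<dots> = (\<Oplus>m\<in>{..N}. \<phi> (h m) \<otimes> z b [^] m)"
      using sub[OF h(1)] b by (intro add.finprod_cong') auto
    finally have t_eq: "t = (\<Oplus>m\<in>{..N}. \<phi> (h m) \<otimes> z b [^] m)" .
    show ?thesis
    proof (rule unique_finite_expansion[where d = "\<lambda>m. \<phi> (h m)" and N = N and V = "\<lambda>i. ?R"
        and g = "\<lambda>i a. a \<otimes> z b [^] i"])
      show "t = (\<Oplus>m\<in>{..N}. \<phi> (h m) \<otimes> z b [^] m)" by (rule t_eq)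
      show "\<forall>i\<in>S. c i = \<zero>" if S: "finite S" and c: "\<And>i. c i \<in> ?R"
        and zero: "(\<Oplus>i\<in>S. c i \<otimes> z b [^] i) = \<zero>" for S and c :: "nat \<Rightarrow> 'a"
      proof -
        have "\<exists>f. f \<in> supported_on (sorted_words ?J) \<and> c i = \<phi> f" for i
        proof -
          obtain f where "f \<in> supported_on (words ?J)" "c i = \<phi> f" using repr[OF c] by auto
          then show ?thesis using normal_form_value[OF J(1), of f] by auto
        qed
        then obtain k where k: "\<And>i. k i \<in> supported_on (sorted_words ?J)" "\<And>i. c i = \<phi> (k i)"
          by metis
        have kI: "k i \<in> supported_on (words I)" for i
          by (rule sorted_words_subset[OF J(2) k(1)])
        have "\<phi> (\<Sum>i\<in>S. k i * free_gen b ^ i) = (\<Oplus>i\<in>S. \<phi> (k i * free_gen b ^ i))"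
          using kI b S by (intro \<phi>_sum) auto
        also have "\<dots> = (\<Oplus>i\<in>S. c i \<otimes> z b [^] i)"
          using kI b by (intro add.finprod_cong') (auto simp: k(2))
        finally have "\<phi> (\<Sum>i\<in>S. k i * free_gen b ^ i) = \<zero>" using zero by simp
        from power_expansion_unique[OF b S k(1) this] show ?thesis by (simp add: k(2))
      qed
      show "r \<ominus> s \<in> ?R" if "r \<in> ?R" "s \<in> ?R" for r s
        using that subringE[OF subring_layer[OF J(2)]] by (simp add: a_minus_def)
    qed (use zb RA layerI h subringE(2)[OF subring_layer[OF J(2)]] in \<open>auto simp: a_minus_def l_distr l_minus\<close>)
  qed
  show ?thesis
    unfolding Ore_extension_def
  proof (intro conjI; (rule bexI[of _ "z b"], rule exI[of _ \<sigma>], rule exI[of _ \<delta>], intro conjI ballI)?)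
    show "subring ?R A" by (rule subring_layer[OF J(2)])
    show "subring ?T A" by (rule subring_layer[OF J'])
    show "?R \<subseteq> ?T"
      unfolding layer_def by (intro image_mono supported_on_mono) (auto simp: words_def)
    show "z b \<in> ?T"
      unfolding layer_def using b by (intro image_eqI[of _ _ "free_gen b"]) simp_all
  qed (use iso skew comm expand in auto)
qed

lemma iterated_Ore_extension_layer:
  assumes "finite J" "initial J"
  shows "iterated_Ore_extension A (range \<iota>) (layer J)"
  using assms
proof (induction J rule: finite_linorder_max_induct)
  case empty
  have "layer {} = range \<iota>"
  proof -
    have "(supported_on (words {}) :: ('x free_word \<Rightarrow>\<^sub>0 complex) set) = range free_scalar"
    proof (intro antisym subsetI)
      fix f :: "'x free_word \<Rightarrow>\<^sub>0 complex" assume "f \<in> supported_on (words {})"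
      moreover have "w = 0" if "w \<in> words {}" for w :: "'x free_word"
        using that by (cases w) (simp add: words_def zero_free_word_def)
      ultimately have "Poly_Mapping.keys f \<subseteq> {0}"
        by (auto simp: supported_on_def)
      then have "f = free_scalar (Poly_Mapping.lookup f 0)"
        by (intro poly_mapping_eqI) (auto simp: free_scalar_def lookup_single when_def in_keys_iff)
      then show "f \<in> range free_scalar" by (rule range_eqI)
    qed auto
    then show ?thesis
      unfolding layer_def by (auto simp: image_image)
  qed
  then show ?case
    using subring_layer[of "{}"] by (auto intro: iterated_Ore_extension.base)
next
  case (insert b J)
  then have b: "b \<in> I" and J: "J = {x\<in>I. x < b}" by (auto simp: initial_def)
  have "iterated_Ore_extension A (range \<iota>) (layer J)"
    using insert.IH initial_less unfolding J by blast
  moreover have "Ore_extension A (layer J) (layer (insert b J))"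
    unfolding J by (rule Ore_extension_layer[OF b])
  ultimately show ?case by (rule iterated_Ore_extension.step)
qed

lemma layer_I: "layer I = carrier A"
  unfolding layer_def using generated by auto

theorem iterated_Ore_extension_carrier: "iterated_Ore_extension A (range \<iota>) (carrier A)"
  using iterated_Ore_extension_layer[OF finite_I] by (simp add: initial_def layer_I)

lemma one_not_zero: "\<one> \<noteq> \<zero>"
proof
  assume "\<one> = \<zero>"
  then have "\<phi> 1 = \<zero>" by simp
  moreover have "1 \<in> supported_on (sorted_words I)"
    by (simp add: sorted_words_def flip: single_one)
  ultimately have "(1 :: 'x free_word \<Rightarrow>\<^sub>0 complex) = 0"
    using independent_words by blast
  then show False by simp
qed

lemma scalar_eq_zero: "\<iota> a = \<zero> \<longleftrightarrow> a = 0"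
proof
  assume "\<iota> a = \<zero>"
  show "a = 0"
  proof (rule ccontr)
    assume "a \<noteq> 0"
    then have "\<iota> (inverse a) \<otimes> \<iota> a = \<one>"
      by (simp flip: scalar_mult scalar_one)
    then show False using \<open>\<iota> a = \<zero>\<close> one_not_zero by simp
  qed
qed simp

theorem noncomm_domain: "noncomm_domain A"
proof -
  have "a = \<zero> \<or> b = \<zero>" if "a \<in> range \<iota>" "b \<in> range \<iota>" "a \<otimes> b = \<zero>" for a b
    using that by (auto simp: scalar_eq_zero simp flip: scalar_mult)
  from iterated_Ore_extension_no_zero_divisors[OF iterated_Ore_extension_carrier this]
  show ?thesis
    unfolding noncomm_domain_def using ring_axioms one_not_zero by blast
qed

subsection \<open>The Hilbert series\<close>

definition homogeneous :: "nat \<Rightarrow> 'a set"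
  where "homogeneous d = \<phi> ` supported_on (words_of_length I d)"

lemma homogeneousE:
  assumes "a \<in> homogeneous d"
  obtains f where "f \<in> supported_on (words_of_length I d)" "f \<in> supported_on (words I)" "a = \<phi> f"
  using assms words_of_length_subset[OF order_refl] unfolding homogeneous_def by blast

lemma initial_I: "initial I"
  by (simp add: initial_def)

lemma homogeneousE_sorted:
  assumes "a \<in> homogeneous d"
  obtains f where "f \<in> supported_on (sorted_words I \<inter> words_of_length I d)"
    "f \<in> supported_on (words I)" "a = \<phi> f"
proof -
  obtain g where "g \<in> supported_on (words_of_length I d)" "a = \<phi> g"
    by (rule homogeneousE[OF assms])
  then obtain f where f: "f \<in> supported_on (sorted_words I \<inter> words_of_length I d)" "a = \<phi> f"
    using homogeneous_normal_form_value[OF initial_I] by metis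
  have "f \<in> supported_on (words I)"
    by (rule subsetD[OF supported_on_mono f(1)]) (auto simp: words_of_length_def)
  from that[OF f(1) this f(2)] show ?thesis .
qed

definition word_value :: "'x free_word \<Rightarrow> 'a"
  where "word_value w = word_product A (map z (letters w))"

lemma word_value: "w \<in> words I \<Longrightarrow> word_value w = \<phi> (Poly_Mapping.single w 1)"
  by (simp add: word_value_def free_eval_single[OF gen_closed] scalar_one word_eval_closed[OF gen_closed])

lemma Span_words:
  assumes "set ws \<subseteq> words I"
  shows "Span (range \<iota>) (map word_value ws) = \<phi> ` supported_on (set ws)"
  using assms
proof (induction ws)
  case Nil
  have "(supported_on {} :: ('x free_word \<Rightarrow>\<^sub>0 complex) set) = {0}"
    by (auto simp: supported_on_def)
  then show ?case by simp
next
  case (Cons w ws)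
  have sub: "f \<in> supported_on (words I)" if "f \<in> supported_on (set ws)" for f
    using Cons.prems that supported_on_mono[of "set ws" "words I"] by auto
  have step: "\<phi> (Poly_Mapping.single w a + f) = \<iota> a \<otimes> word_value w \<oplus> \<phi> f" if "f \<in> supported_on (set ws)" for a f
    using Cons.prems sub[OF that] by (simp add: word_value_def free_eval_single[OF gen_closed])
  show ?case
  proof (intro antisym subsetI)
    fix u assume "u \<in> Span (range \<iota>) (map word_value (w # ws))"
    then obtain a v where "v \<in> Span (range \<iota>) (map word_value ws)" "u = \<iota> a \<otimes> word_value w \<oplus> v"
      by (auto simp: line_extension_mem_iff)
    then obtain f where f: "f \<in> supported_on (set ws)" "u = \<iota> a \<otimes> word_value w \<oplus> \<phi> f"
      using Cons by auto
    moreover have "Poly_Mapping.single w a + f \<in> supported_on (set (w # ws))"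
      using f(1) supported_on_mono[of "set ws" "set (w # ws)"] by (intro supported_on_closed) auto
    ultimately show "u \<in> \<phi> ` supported_on (set (w # ws))"
      using step[OF f(1), of a] by (intro image_eqI) auto
  next
    fix u assume "u \<in> \<phi> ` supported_on (set (w # ws))"
    then obtain f where f: "f \<in> supported_on (set (w # ws))" "u = \<phi> f" by auto
    let ?g = "f - Poly_Mapping.single w (Poly_Mapping.lookup f w)"
    have "Poly_Mapping.keys ?g \<subseteq> set ws"
    proof
      fix v assume v: "v \<in> Poly_Mapping.keys ?g"
      then have "v \<noteq> w" by (auto simp: in_keys_iff lookup_minus)
      with v have "v \<in> Poly_Mapping.keys f" by (auto simp: in_keys_iff lookup_minus lookup_single)
      with \<open>v \<noteq> w\<close> f show "v \<in> set ws" by (auto simp: supported_on_def)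
    qed
    then have g: "?g \<in> supported_on (set ws)" by (simp add: supported_on_def)
    have "u = \<iota> (Poly_Mapping.lookup f w) \<otimes> word_value w \<oplus> \<phi> ?g"
      using step[OF g, of "Poly_Mapping.lookup f w"] f by simp
    moreover have "\<phi> ?g \<in> Span (range \<iota>) (map word_value ws)"
      using g Cons by auto
    ultimately show "u \<in> Span (range \<iota>) (map word_value (w # ws))"
      by (auto simp: line_extension_mem_iff)
  qed
qed

lemma independent_sorted_words:
  assumes "distinct ws" "set ws \<subseteq> sorted_words I"
  shows "independent (range \<iota>) (map word_value ws)"
  using assms
proof (induction ws)
  case (Cons w ws)
  have w: "w \<in> words I" and ws: "set ws \<subseteq> words I"
    using Cons.prems by (auto simp: sorted_words_def)
  have "word_value w \<notin> Span (range \<iota>) (map word_value ws)"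
  proof
    assume "word_value w \<in> Span (range \<iota>) (map word_value ws)"
    then obtain f where f: "f \<in> supported_on (set ws)" "word_value w = \<phi> f"
      using Span_words[OF ws] by auto
    let ?g = "Poly_Mapping.single w 1 - f"
    have f': "f \<in> supported_on (sorted_words I)"
      using f(1) Cons.prems supported_on_mono[of "set ws" "sorted_words I"] by auto
    have "\<phi> ?g = \<zero>"
      using w f sorted_words_subset[OF order_refl f'] by (simp add: r_right_minus_eq word_value)
    moreover have "?g \<in> supported_on (sorted_words I)"
      using f' Cons.prems by (intro supported_on_diff) simp_all
    ultimately have "?g = 0" by (intro independent_words)
    then have "f = Poly_Mapping.single w 1" by simp
    then have "w \<in> set ws" using f(1) by (auto simp: supported_on_def in_keys_iff)
    then show False using Cons.prems by simp
  qed
  moreover have "word_value w \<in> carrier A"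
    using w by (simp add: word_value)
  ultimately show ?case using Cons by (simp add: li_Cons del: Span.simps)
qed simp

lemma finite_words_of_length: "finite (words_of_length I d)"
proof -
  have "words_of_length I d \<subseteq> Word ` {xs. set xs \<subseteq> I \<and> length xs = d}"
  proof
    fix w assume "w \<in> words_of_length I d"
    then show "w \<in> Word ` {xs. set xs \<subseteq> I \<and> length xs = d}"
      by (intro image_eqI[of _ _ "letters w"]) (simp_all add: words_of_length_def words_def)
  qed
  then show ?thesis
    by (rule finite_subset[OF _ finite_imageI[OF finite_lists_length_eq[OF finite_I]]])
qed

lemma homogeneous_Span_sorted:
  assumes "set ws = sorted_words I \<inter> words_of_length I d"
  shows "homogeneous d = Span (range \<iota>) (map word_value ws)"
proof -
  have ws: "set ws \<subseteq> words I" using assms by (auto simp: sorted_words_def)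
  show ?thesis
    unfolding Span_words[OF ws] assms
  proof (intro antisym subsetI)
    fix a assume "a \<in> homogeneous d"
    then obtain f where "f \<in> supported_on (sorted_words I \<inter> words_of_length I d)" "a = \<phi> f"
      by (rule homogeneousE_sorted)
    then show "a \<in> \<phi> ` supported_on (sorted_words I \<inter> words_of_length I d)" by blast
  next
    fix a assume "a \<in> \<phi> ` supported_on (sorted_words I \<inter> words_of_length I d)"
    then show "a \<in> homogeneous d"
      unfolding homogeneous_def using supported_on_mono[of "sorted_words I \<inter> words_of_length I d" "words_of_length I d"]
      by auto
  qed
qed

text \<open>The degree part is a union of spans of arbitrary lists of monomials; the span of the list of all
  words of length \<open>d\<close> contains the others.\<close>

lemma degree_part_eq: "degree_part A (range \<iota>) (z ` I) d = homogeneous d"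
proof -
  define monomials where "monomials = {word_product A xs | xs. set xs \<subseteq> z ` I \<and> length xs = d}"
  have monomials: "monomials = word_value ` words_of_length I d"
  proof (intro antisym subsetI)
    fix a assume "a \<in> monomials"
    then obtain xs where xs: "a = word_product A xs" "set xs \<subseteq> z ` I" "length xs = d"
      by (auto simp: monomials_def)
    then have "xs \<in> map z ` {ys. set ys \<subseteq> I}"
      by (metis lists_image lists_eq_set mem_Collect_eq)
    then obtain ys where "xs = map z ys" "set ys \<subseteq> I" by auto
    then show "a \<in> word_value ` words_of_length I d"
      using xs by (intro image_eqI[of _ _ "Word ys"]) (auto simp: word_value_def words_of_length_def words_def)
  next
    fix a assume "a \<in> word_value ` words_of_length I d"
    then obtain w where "w \<in> words_of_length I d" "a = word_value w" by auto
    then show "a \<in> monomials"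
      unfolding monomials_def word_value_def
      by (intro CollectI exI[of _ "map z (letters w)"]) (auto simp: words_of_length_def words_def)
  qed
  have "\<Union> {Span (range \<iota>) us | us. set us \<subseteq> monomials} = homogeneous d"
  proof (intro antisym subsetI)
    fix a assume "a \<in> \<Union> {Span (range \<iota>) us | us. set us \<subseteq> monomials}"
    then obtain us where us: "set us \<subseteq> monomials" "a \<in> Span (range \<iota>) us" by auto
    then have "us \<in> map word_value ` {ws. set ws \<subseteq> words_of_length I d}"
      unfolding monomials by (metis lists_image lists_eq_set mem_Collect_eq)
    then obtain ws where ws: "us = map word_value ws" "set ws \<subseteq> words_of_length I d" by auto
    have "a \<in> \<phi> ` supported_on (set ws)"
      using us(2) Span_words[of ws] ws words_of_length_simps(2)[of I d] by auto
    then show "a \<in> homogeneous d"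
      unfolding homogeneous_def using supported_on_mono[OF ws(2)] by blast
  next
    fix a assume "a \<in> homogeneous d"
    then obtain f where f: "f \<in> supported_on (words_of_length I d)" "f \<in> supported_on (words I)" "a = \<phi> f"
      by (rule homogeneousE)
    obtain ws where ws: "set ws = words_of_length I d"
      using finite_list[OF finite_words_of_length] by blast
    have "a \<in> Span (range \<iota>) (map word_value ws)"
      using Span_words[of ws] ws f words_of_length_simps(2)[of I d] by auto
    moreover have "set (map word_value ws) \<subseteq> monomials"
      unfolding monomials using ws by simp
    ultimately show "a \<in> \<Union> {Span (range \<iota>) us | us. set us \<subseteq> monomials}"
      by blast
  qed
  then show ?thesis
    unfolding degree_part_def monomials_def .
qed

lemma homogeneous_closed:
  "homogeneous d \<subseteq> carrier A" "\<zero> \<in> homogeneous d"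
  "a \<in> homogeneous d \<Longrightarrow> b \<in> homogeneous d \<Longrightarrow> a \<oplus> b \<in> homogeneous d"
  "a \<in> homogeneous d \<Longrightarrow> \<ominus> a \<in> homogeneous d"
  "a \<in> homogeneous d \<Longrightarrow> b \<in> homogeneous e \<Longrightarrow> a \<otimes> b \<in> homogeneous (d + e)"
proof -
  show "homogeneous d \<subseteq> carrier A"
    by (auto elim: homogeneousE)
  show "\<zero> \<in> homogeneous d"
    unfolding homogeneous_def by (rule image_eqI[of _ _ 0]) simp_all
  have image: "\<phi> f \<in> homogeneous d" if "f \<in> supported_on (words_of_length I d)" for f d
    using that unfolding homogeneous_def by (rule imageI)
  show "\<ominus> a \<in> homogeneous d" if a: "a \<in> homogeneous d"
  proof -
    obtain f where "f \<in> supported_on (words_of_length I d)" "f \<in> supported_on (words I)" "a = \<phi> f"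
      by (rule homogeneousE[OF a])
    then show ?thesis using image[of "- f" d] by simp
  qed
  show "a \<oplus> b \<in> homogeneous d" if a: "a \<in> homogeneous d" and b: "b \<in> homogeneous d"
  proof -
    obtain f where "f \<in> supported_on (words_of_length I d)" "f \<in> supported_on (words I)" "a = \<phi> f"
      by (rule homogeneousE[OF a])
    moreover obtain g where "g \<in> supported_on (words_of_length I d)" "g \<in> supported_on (words I)" "b = \<phi> g"
      by (rule homogeneousE[OF b])
    ultimately show ?thesis using image[of "f + g" d] by simp
  qed
  show "a \<otimes> b \<in> homogeneous (d + e)" if a: "a \<in> homogeneous d" and b: "b \<in> homogeneous e"
  proof -
    obtain f where "f \<in> supported_on (words_of_length I d)" "f \<in> supported_on (words I)" "a = \<phi> f"
      by (rule homogeneousE[OF a])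
    moreover obtain g where "g \<in> supported_on (words_of_length I e)" "g \<in> supported_on (words I)" "b = \<phi> g"
      by (rule homogeneousE[OF b])
    ultimately show ?thesis
      using image[OF homogeneous_mult, of f d g e] by simp
  qed
qed

lemma homogeneous_independent:
  fixes u :: "nat \<Rightarrow> 'a"
  assumes S: "finite S" and u: "\<And>d. u d \<in> homogeneous d" and zero: "(\<Oplus>d\<in>S. u d) = \<zero>"
  shows "\<forall>d\<in>S. u d = \<zero>"
proof
  fix d assume d: "d \<in> S"
  have "\<exists>f. f \<in> supported_on (sorted_words I \<inter> words_of_length I d) \<and> f \<in> supported_on (words I) \<and> u d = \<phi> f" for d
    by (rule homogeneousE_sorted[OF u[of d]]) blast
  then obtain f where f: "\<And>d. f d \<in> supported_on (sorted_words I \<inter> words_of_length I d)"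
    "\<And>d. f d \<in> supported_on (words I)" "\<And>d. u d = \<phi> (f d)"
    by metis
  have "\<phi> (\<Sum>d\<in>S. f d) = (\<Oplus>d\<in>S. \<phi> (f d))"
    using f(2) S by (intro \<phi>_sum)
  also have "\<dots> = \<zero>"
    using zero by (simp add: f(3))
  finally have "\<phi> (\<Sum>d\<in>S. f d) = \<zero>" .
  moreover have "(\<Sum>d\<in>S. f d) \<in> supported_on (sorted_words I)"
    using subsetD[OF supported_on_mono f(1)] by (intro supported_on_sum) blast
  ultimately have sum0: "(\<Sum>d\<in>S. f d) = 0"
    by (intro independent_words)
  have "f d = 0"
  proof (rule poly_mapping_eqI)
    fix w
    have other: "Poly_Mapping.lookup (f e) w = 0" if "length (letters w) \<noteq> e" for e
      using f(1)[of e] that by (auto simp: supported_on_def words_of_length_def in_keys_iff)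
    show "Poly_Mapping.lookup (f d) w = Poly_Mapping.lookup 0 w"
    proof (cases "length (letters w) = d")
      case True
      have "Poly_Mapping.lookup (\<Sum>e\<in>S. f e) w = (\<Sum>e\<in>S. if e = d then Poly_Mapping.lookup (f d) w else 0)"
        unfolding lookup_sum using True other by (intro sum.cong) auto
      then show ?thesis using S d by (simp add: sum0)
    qed (simp add: other)
  qed
  then show "u d = \<zero>" by (simp add: f(3))
qed

lemma is_grading_homogeneous: "is_grading A homogeneous"
  unfolding is_grading_def
proof (intro conjI allI ballI)
  show "subgroup (homogeneous d) (add_monoid A)" for d
    using homogeneous_closed(1-4)[where d = d]
    by (intro add.subgroupI) (auto simp flip: a_inv_def)
  show "\<one> \<in> homogeneous 0"
  proof -
    have "1 \<in> supported_on (words_of_length I 0)"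
      by (simp add: words_of_length_def flip: single_one)
    then show ?thesis
      unfolding homogeneous_def by (intro image_eqI[of _ _ 1]) simp_all
  qed
  show "a \<otimes> b \<in> homogeneous (d + e)" if "a \<in> homogeneous d" "b \<in> homogeneous e" for a b d e
    using that by (rule homogeneous_closed(5))
  fix a assume "a \<in> carrier A"
  then obtain f where f: "f \<in> supported_on (words I)" "a = \<phi> f"
    using generated by auto
  define part where "part d = (\<Sum>w\<in>{w\<in>Poly_Mapping.keys f. length (letters w) = d}.
      Poly_Mapping.single w (Poly_Mapping.lookup f w))" for d
  define N where "N = Max (insert 0 ((\<lambda>w. length (letters w)) ` Poly_Mapping.keys f))"
  have N: "length (letters w) \<le> N" if "w \<in> Poly_Mapping.keys f" for w
    unfolding N_def using that by (intro Max_ge) auto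
  have part_hom: "part d \<in> supported_on (words_of_length I d)" for d
    unfolding part_def using f(1)
    by (intro supported_on_sum) (auto simp: supported_on_def words_of_length_def)
  have part_zero: "part d = 0" if "d > N" for d
    unfolding part_def using N that by (intro sum.neutral) force
  have "f = (\<Sum>w\<in>Poly_Mapping.keys f. Poly_Mapping.single w (Poly_Mapping.lookup f w))"
    by (rule poly_mapping_sum_single[symmetric])
  also have "\<dots> = (\<Sum>d\<le>N. part d)"
    unfolding part_def using N by (intro sum.group[symmetric]) auto
  finally have "a = \<phi> (\<Sum>d\<le>N. part d)" using f(2) by simp
  also have "\<dots> = (\<Oplus>d\<in>{..N}. \<phi> (part d))"
    using words_of_length_subset[OF order_refl part_hom] by (intro \<phi>_sum) auto
  finally have a: "a = (\<Oplus>d\<in>{..N}. \<phi> (part d))" .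
  show "\<exists>!c. (\<forall>d. c d \<in> homogeneous d) \<and> finite {d. c d \<noteq> \<zero>} \<and> a = (\<Oplus>d\<in>{d. c d \<noteq> \<zero>}. c d)"
  proof (rule unique_finite_expansion[where d = "\<lambda>d. \<phi> (part d)" and N = N and g = "\<lambda>d a. a" and V = homogeneous])
    show "\<phi> (part d) \<in> homogeneous d" for d
      using part_hom unfolding homogeneous_def by (rule imageI)
    show "r \<ominus> s \<in> homogeneous d" if "r \<in> homogeneous d" "s \<in> homogeneous d" for r s d
      using that homogeneous_closed(3,4) by (simp add: a_minus_def)
    show "\<forall>d\<in>S. u d = \<zero>" if "finite S" "\<And>d. u d \<in> homogeneous d" "(\<Oplus>d\<in>S. u d) = \<zero>" for S u
      using that by (rule homogeneous_independent)
  qed (use homogeneous_closed(1,2) a part_zero in auto)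
qed

theorem has_Hilbert_series_sorted_words:
  "has_Hilbert_series A (range \<iota>) (z ` I) (Abs_fps (\<lambda>d. card (sorted_words I \<inter> words_of_length I d)))"
  unfolding has_Hilbert_series_def
proof (intro conjI allI)
  have "degree_part A (range \<iota>) (z ` I) = homogeneous"
    using degree_part_eq by (rule ext)
  then show "is_grading A (degree_part A (range \<iota>) (z ` I))"
    using is_grading_homogeneous by simp
  fix d
  have "finite (sorted_words I \<inter> words_of_length I d)"
    using finite_words_of_length by blast
  then obtain ws where ws: "set ws = sorted_words I \<inter> words_of_length I d" "distinct ws"
    using finite_distinct_list by blast
  have "independent (range \<iota>) (map word_value ws)"
    using ws by (intro independent_sorted_words) auto
  then have "dimension (length (map word_value ws)) (range \<iota>) (Span (range \<iota>) (map word_value ws))"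
    by (rule dimension_independent)
  then show "dimension (fps_nth (Abs_fps (\<lambda>d. card (sorted_words I \<inter> words_of_length I d))) d) (range \<iota>)
      (degree_part A (range \<iota>) (z ` I) d)"
    using ws distinct_card[OF ws(2)] homogeneous_Span_sorted[OF ws(1)] by (simp add: degree_part_eq)
qed

end

section \<open>Smash products\<close>

locale smash_action = M: ring M for M :: "('m, 'b) ring_scheme" (structure) +
  fixes P :: "'p::ab_group_add set" and act :: "'p \<Rightarrow> 'm \<Rightarrow> 'm"
  assumes P_zero: "0 \<in> P" and P_add: "l \<in> P \<Longrightarrow> m \<in> P \<Longrightarrow> l + m \<in> P"
    and act_hom: "l \<in> P \<Longrightarrow> act l \<in> ring_hom M M"
    and act_zero: "a \<in> carrier M \<Longrightarrow> act 0 a = a"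
    and act_add: "l \<in> P \<Longrightarrow> m \<in> P \<Longrightarrow> a \<in> carrier M \<Longrightarrow> act (l + m) a = act l (act m a)"
begin

abbreviation "S \<equiv> smash_product M P act"

lemma act_simps [simp]:
  assumes "l \<in> P"
  shows "a \<in> carrier M \<Longrightarrow> act l a \<in> carrier M"
    "a \<in> carrier M \<Longrightarrow> b \<in> carrier M \<Longrightarrow> act l (a \<oplus> b) = act l a \<oplus> act l b"
    "a \<in> carrier M \<Longrightarrow> b \<in> carrier M \<Longrightarrow> act l (a \<otimes> b) = act l a \<otimes> act l b"
    "act l \<one> = \<one>" "act l \<zero> = \<zero>"
proof -
  have h: "act l \<in> ring_hom M M" using assms by (rule act_hom)
  show "a \<in> carrier M \<Longrightarrow> act l a \<in> carrier M"
    "a \<in> carrier M \<Longrightarrow> b \<in> carrier M \<Longrightarrow> act l (a \<oplus> b) = act l a \<oplus> act l b"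
    "a \<in> carrier M \<Longrightarrow> b \<in> carrier M \<Longrightarrow> act l (a \<otimes> b) = act l a \<otimes> act l b"
    "act l \<one> = \<one>"
    using ring_hom_memE[OF h] by auto
  show "act l \<zero> = \<zero>"
    using ring_hom_zero[OF h M.ring_axioms M.ring_axioms] .
qed

lemma act_finsum:
  assumes "l \<in> P" "finite T" "\<And>i. i \<in> T \<Longrightarrow> f i \<in> carrier M"
  shows "act l (\<Oplus>i\<in>T. f i) = (\<Oplus>i\<in>T. act l (f i))"
  using assms(2,3)
proof (induction T)
  case (insert i T)
  then show ?case using assms(1) by (simp add: Pi_def)
qed (simp add: assms(1))

definition supp :: "('p \<Rightarrow> 'm) \<Rightarrow> 'p set"
  where "supp f = {l. f l \<noteq> \<zero>}"

lemma carrier_S: "f \<in> carrier S \<longleftrightarrow> (\<forall>l. f l \<in> carrier M) \<and> finite (supp f) \<and> supp f \<subseteq> P"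
  by (simp add: smash_product_def supp_def)

lemma S_simps:
  "(f \<oplus>\<^bsub>S\<^esub> g) l = f l \<oplus> g l" "\<zero>\<^bsub>S\<^esub> = (\<lambda>l. \<zero>)" "\<one>\<^bsub>S\<^esub> = (\<lambda>l. if l = 0 then \<one> else \<zero>)"
  by (simp_all add: smash_product_def)

lemma carrierD [simp]: "f \<in> carrier S \<Longrightarrow> f l \<in> carrier M"
  by (simp add: carrier_S)

text \<open>As \<open>P\<close> lies in a group, the second index is determined by the first.  The sum may run over any finite
  superset of the support, so that two products can be compared over a common index set.\<close>

lemma S_mult:
  assumes f: "f \<in> carrier S" and g: "g \<in> carrier S" and T: "finite T" "supp f \<subseteq> T" "T \<subseteq> P"
  shows "(f \<otimes>\<^bsub>S\<^esub> g) l = (\<Oplus>m\<in>T. f m \<otimes> act m (g (l - m)))"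
proof -
  let ?Q = "{(m, m'). f m \<noteq> \<zero> \<and> g m' \<noteq> \<zero> \<and> m + m' = l}"
  let ?T = "{m \<in> T. f m \<noteq> \<zero> \<and> g (l - m) \<noteq> \<zero>}"
  have bij: "?Q = (\<lambda>m. (m, l - m)) ` ?T" 
    using T(2) by (auto simp: supp_def image_iff algebra_simps)
  have inj: "inj_on (\<lambda>m. (m, l - m)) ?T" by (auto simp: inj_on_def)
  have mem: "f m \<otimes> act m (g (l - m)) \<in> carrier M" if "m \<in> T" for m
    using that f g T by auto
  have "(f \<otimes>\<^bsub>S\<^esub> g) l = (\<Oplus>p\<in>?Q. f (fst p) \<otimes> act (fst p) (g (snd p)))"
    by (simp only: smash_product_def monoid.select_convs)
  also have "\<dots> = (\<Oplus>m\<in>?T. f (fst (m, l - m)) \<otimes> act (fst (m, l - m)) (g (snd (m, l - m))))"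
    unfolding bij
  proof (rule M.add.finprod_reindex[OF _ inj])
    show "(\<lambda>p. f (fst p) \<otimes> act (fst p) (g (snd p))) \<in> (\<lambda>m. (m, l - m)) ` ?T \<rightarrow> carrier M"
      using mem by auto
  qed
  also have "\<dots> = (\<Oplus>m\<in>?T. f m \<otimes> act m (g (l - m)))"
    by (simp only: fst_conv snd_conv)
  also have "\<dots> = (\<Oplus>m\<in>T. f m \<otimes> act m (g (l - m)))"
  proof (rule M.add.finprod_mono_neutral_cong_left[OF T(1)])
    fix m assume "m \<in> T - ?T"
    then show "f m \<otimes> act m (g (l - m)) = \<zero>"
      using T(3) f g by (cases "f m = \<zero>") auto
  qed (use mem in auto)
  finally show ?thesis .
qed

lemma S_add_closed: "f \<in> carrier S \<Longrightarrow> g \<in> carrier S \<Longrightarrow> f \<oplus>\<^bsub>S\<^esub> g \<in> carrier S"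
proof -
  assume fg: "f \<in> carrier S" "g \<in> carrier S"
  have "supp (f \<oplus>\<^bsub>S\<^esub> g) \<subseteq> supp f \<union> supp g"
    by (auto simp: supp_def S_simps)
  with fg show ?thesis
    by (auto simp: carrier_S S_simps dest: finite_subset)
qed

lemma supp_mult:
  assumes f: "f \<in> carrier S" and g: "g \<in> carrier S"
  shows "supp (f \<otimes>\<^bsub>S\<^esub> g) \<subseteq> (\<lambda>(m, m'). m + m') ` (supp f \<times> supp g)"
proof
  fix l assume l: "l \<in> supp (f \<otimes>\<^bsub>S\<^esub> g)"
  have P: "finite (supp f)" "supp f \<subseteq> P" using f by (auto simp: carrier_S)
  show "l \<in> (\<lambda>(m, m'). m + m') ` (supp f \<times> supp g)"
  proof (rule ccontr)
    assume no: "l \<notin> (\<lambda>(m, m'). m + m') ` (supp f \<times> supp g)"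
    have "g (l - m) = \<zero>" if "m \<in> supp f" for m
    proof (rule ccontr)
      assume "g (l - m) \<noteq> \<zero>"
      then have "(m, l - m) \<in> supp f \<times> supp g" using that by (simp add: supp_def)
      from imageI[OF this, of "\<lambda>(m, m'). m + m'"] no show False by simp
    qed
    then have "(\<Oplus>m\<in>supp f. f m \<otimes> act m (g (l - m))) = (\<Oplus>m\<in>supp f. \<zero>)"
      using P f by (intro M.add.finprod_cong') auto
    then show False using l S_mult[OF f g P(1) order_refl P(2), of l] by (simp add: supp_def)
  qed
qed

lemma S_mult_closed:
  assumes f: "f \<in> carrier S" and g: "g \<in> carrier S" shows "f \<otimes>\<^bsub>S\<^esub> g \<in> carrier S"
proof -
  have P: "finite (supp f)" "supp f \<subseteq> P" "finite (supp g)" "supp g \<subseteq> P"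
    using f g by (auto simp: carrier_S)
  have "(f \<otimes>\<^bsub>S\<^esub> g) l \<in> carrier M" for l
    unfolding S_mult[OF f g P(1) order_refl P(2)] using f g P by (intro M.finsum_closed) auto
  moreover have "finite (supp (f \<otimes>\<^bsub>S\<^esub> g))"
    using P by (intro finite_subset[OF supp_mult[OF f g]]) simp
  moreover have "supp (f \<otimes>\<^bsub>S\<^esub> g) \<subseteq> P"
  proof
    fix l assume "l \<in> supp (f \<otimes>\<^bsub>S\<^esub> g)"
    with supp_mult[OF f g] obtain m m' where "m \<in> supp f" "m' \<in> supp g" "l = m + m'" by auto
    then show "l \<in> P" using P P_add by auto
  qed
  ultimately show ?thesis by (simp add: carrier_S)
qed

lemma S_one_closed: "\<one>\<^bsub>S\<^esub> \<in> carrier S"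
proof -
  have "supp \<one>\<^bsub>S\<^esub> \<subseteq> {0}" by (auto simp: supp_def S_simps)
  then show ?thesis using P_zero by (auto simp: carrier_S S_simps dest: finite_subset)
qed

lemma finsum_swap:
  assumes "finite T" "finite U" "\<And>i j. i \<in> T \<Longrightarrow> j \<in> U \<Longrightarrow> f i j \<in> carrier M"
  shows "(\<Oplus>i\<in>T. \<Oplus>j\<in>U. f i j) = (\<Oplus>j\<in>U. \<Oplus>i\<in>T. f i j)"
  using assms(1,3)
proof (induction T)
  case empty
  then show ?case by simp
next
  case (insert i T)
  have "(\<Oplus>i\<in>insert i T. \<Oplus>j\<in>U. f i j) = (\<Oplus>j\<in>U. f i j) \<oplus> (\<Oplus>j\<in>U. \<Oplus>i\<in>T. f i j)"
    using insert by (simp add: Pi_def M.finsum_closed)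
  also have "\<dots> = (\<Oplus>j\<in>U. f i j \<oplus> (\<Oplus>i\<in>T. f i j))"
    using insert by (intro M.finsum_addf[symmetric]) (auto intro!: M.finsum_closed)
  also have "\<dots> = (\<Oplus>j\<in>U. \<Oplus>i\<in>insert i T. f i j)"
    using insert by (intro M.add.finprod_cong') (auto simp: Pi_def intro!: M.finsum_closed M.add.m_closed)
  finally show ?case .
qed

text \<open>Both sides expand to the double sum of \<open>f m (m . g j) ((m + j) . h (l - m - j))\<close> over the supports of
  \<open>f\<close> and \<open>g\<close>; on the left, \<open>k = m + j\<close> is the outer index.\<close>

lemma S_mult_assoc:
  assumes f: "f \<in> carrier S" and g: "g \<in> carrier S" and h: "h \<in> carrier S"
  shows "(f \<otimes>\<^bsub>S\<^esub> g) \<otimes>\<^bsub>S\<^esub> h = f \<otimes>\<^bsub>S\<^esub> (g \<otimes>\<^bsub>S\<^esub> h)"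
proof
  fix l
  let ?F = "supp f" and ?G = "supp g"
  let ?FG = "(\<lambda>(m, m'). m + m') ` (?F \<times> ?G)"
  have P: "finite ?F" "?F \<subseteq> P" "finite ?G" "?G \<subseteq> P"
    using f g by (auto simp: carrier_S)
  have FG: "finite ?FG" "?FG \<subseteq> P"
    using P P_add by auto
  note fg = S_mult_closed[OF f g] and gh = S_mult_closed[OF g h]
  have FP: "m \<in> ?F \<Longrightarrow> m \<in> P" "k \<in> ?FG \<Longrightarrow> k \<in> P" "j \<in> ?G \<Longrightarrow> j \<in> P" for m k j
    using P FG by blast+
  have "((f \<otimes>\<^bsub>S\<^esub> g) \<otimes>\<^bsub>S\<^esub> h) l = (\<Oplus>k\<in>?FG. (f \<otimes>\<^bsub>S\<^esub> g) k \<otimes> act k (h (l - k)))"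
    by (rule S_mult[OF fg h FG(1) supp_mult[OF f g] FG(2)])
  also have "\<dots> = (\<Oplus>k\<in>?FG. \<Oplus>m\<in>?F. f m \<otimes> act m (g (k - m)) \<otimes> act k (h (l - k)))"
  proof (rule M.add.finprod_cong')
    fix k assume k: "k \<in> ?FG"
    show "(f \<otimes>\<^bsub>S\<^esub> g) k \<otimes> act k (h (l - k)) = (\<Oplus>m\<in>?F. f m \<otimes> act m (g (k - m)) \<otimes> act k (h (l - k)))"
      unfolding S_mult[OF f g P(1) order_refl P(2)]
      using P(1) FP f g h FP(2)[OF k] by (intro M.finsum_ldistr) auto
  qed (use f g h FP in \<open>auto intro!: M.finsum_closed M.m_closed simp del: image_iff\<close>)
  also have "\<dots> = (\<Oplus>m\<in>?F. \<Oplus>k\<in>?FG. f m \<otimes> act m (g (k - m)) \<otimes> act k (h (l - k)))"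
    using FG(1) P(1) f g h FP by (intro finsum_swap) auto
  also have "\<dots> = (\<Oplus>m\<in>?F. f m \<otimes> act m ((g \<otimes>\<^bsub>S\<^esub> h) (l - m)))"
  proof (rule M.add.finprod_cong')
    fix m assume m: "m \<in> ?F"
    have mP: "m \<in> P" using FP m by blast
    have sub: "(\<lambda>j. m + j) ` ?G \<subseteq> ?FG" using m by auto
    have mem: "f m \<otimes> act m (g (k - m)) \<otimes> act k (h (l - k)) \<in> carrier M" if "k \<in> P" for k
      using f g h mP that by simp
    have "(\<Oplus>k\<in>?FG. f m \<otimes> act m (g (k - m)) \<otimes> act k (h (l - k))) =
          (\<Oplus>k\<in>(\<lambda>j. m + j) ` ?G. f m \<otimes> act m (g (k - m)) \<otimes> act k (h (l - k)))"
    proof (rule M.add.finprod_mono_neutral_cong_right[OF FG(1) sub])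
      fix k assume k: "k \<in> ?FG - (\<lambda>j. m + j) ` ?G"
      then have "k - m \<notin> ?G" by (auto simp: image_iff)
      then have "g (k - m) = \<zero>" by (simp add: supp_def)
      then show "f m \<otimes> act m (g (k - m)) \<otimes> act k (h (l - k)) = \<zero>"
        using f h mP FP(2)[of k] k by simp
    qed (use mem FP in auto)
    also have "\<dots> = (\<Oplus>j\<in>?G. f m \<otimes> act m (g j) \<otimes> act (m + j) (h (l - (m + j))))"
      using mem sub FG(2) by (subst M.add.finprod_reindex) (auto simp: inj_on_def)
    also have "\<dots> = (\<Oplus>j\<in>?G. f m \<otimes> act m (g j \<otimes> act j (h (l - m - j))))"
    proof (rule M.add.finprod_cong')
      fix j assume "j \<in> ?G"
      then show "f m \<otimes> act m (g j) \<otimes> act (m + j) (h (l - (m + j))) = f m \<otimes> act m (g j \<otimes> act j (h (l - m - j)))"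
        using f g h mP FP(3) by (simp add: act_add M.m_assoc diff_diff_add)
    qed (use f g h mP FP in auto)
    also have "\<dots> = f m \<otimes> (\<Oplus>j\<in>?G. act m (g j \<otimes> act j (h (l - m - j))))"
      using f g h mP FP P(3) by (intro M.finsum_rdistr[symmetric]) auto
    also have "\<dots> = f m \<otimes> act m ((g \<otimes>\<^bsub>S\<^esub> h) (l - m))"
      unfolding S_mult[OF g h P(3) order_refl P(4)]
      using g h FP P(3) mP by (subst act_finsum) auto
    finally show "(\<Oplus>k\<in>?FG. f m \<otimes> act m (g (k - m)) \<otimes> act k (h (l - k))) = f m \<otimes> act m ((g \<otimes>\<^bsub>S\<^esub> h) (l - m))" .
  qed (use f gh FP in auto)
  also have "\<dots> = (f \<otimes>\<^bsub>S\<^esub> (g \<otimes>\<^bsub>S\<^esub> h)) l"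
    by (rule S_mult[OF f gh P(1) order_refl P(2), symmetric])
  finally show "((f \<otimes>\<^bsub>S\<^esub> g) \<otimes>\<^bsub>S\<^esub> h) l = (f \<otimes>\<^bsub>S\<^esub> (g \<otimes>\<^bsub>S\<^esub> h)) l" .
qed

lemma smash_tensor_closed: "a \<in> carrier M \<Longrightarrow> l \<in> P \<Longrightarrow> smash_tensor M a l \<in> carrier S"
proof -
  assume a: "a \<in> carrier M" "l \<in> P"
  have "supp (smash_tensor M a l) \<subseteq> {l}" by (auto simp: supp_def smash_tensor_def)
  with a show ?thesis by (auto simp: carrier_S smash_tensor_def dest: finite_subset)
qed

lemma smash_tensor_mult:
  assumes "a \<in> carrier M" "b \<in> carrier M" "l \<in> P" "m \<in> P"
  shows "smash_tensor M a l \<otimes>\<^bsub>S\<^esub> smash_tensor M b m = smash_tensor M (a \<otimes> act l b) (l + m)"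
proof
  fix k
  have "supp (smash_tensor M a l) \<subseteq> {l}" by (auto simp: supp_def smash_tensor_def)
  then have "(smash_tensor M a l \<otimes>\<^bsub>S\<^esub> smash_tensor M b m) k =
      (\<Oplus>j\<in>{l}. smash_tensor M a l j \<otimes> act j (smash_tensor M b m (k - j)))"
    using assms by (intro S_mult smash_tensor_closed) auto
  also have "\<dots> = smash_tensor M (a \<otimes> act l b) (l + m) k"
    using assms by (auto simp: smash_tensor_def algebra_simps)
  finally show "(smash_tensor M a l \<otimes>\<^bsub>S\<^esub> smash_tensor M b m) k = smash_tensor M (a \<otimes> act l b) (l + m) k" .
qed

lemma smash_tensor_add:
  "a \<in> carrier M \<Longrightarrow> b \<in> carrier M \<Longrightarrow>
    smash_tensor M a l \<oplus>\<^bsub>S\<^esub> smash_tensor M b l = smash_tensor M (a \<oplus> b) l"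
  by (rule ext) (simp add: S_simps smash_tensor_def)

theorem ring_smash_product: "ring S"
proof (rule ringI)
  show "abelian_group S"
  proof (rule abelian_groupI)
    fix f assume f: "f \<in> carrier S"
    have "supp (\<lambda>l. \<ominus> f l) \<subseteq> supp f" by (auto simp: supp_def)
    then have "(\<lambda>l. \<ominus> f l) \<in> carrier S" using f by (auto simp: carrier_S dest: finite_subset)
    moreover have "(\<lambda>l. \<ominus> f l) \<oplus>\<^bsub>S\<^esub> f = \<zero>\<^bsub>S\<^esub>"
      using f by (intro ext) (simp add: S_simps M.l_neg)
    ultimately show "\<exists>g\<in>carrier S. g \<oplus>\<^bsub>S\<^esub> f = \<zero>\<^bsub>S\<^esub>" by blast
    show "\<zero>\<^bsub>S\<^esub> \<oplus>\<^bsub>S\<^esub> f = f" using f by (intro ext) (simp add: S_simps)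
    fix g assume g: "g \<in> carrier S"
    show "f \<oplus>\<^bsub>S\<^esub> g \<in> carrier S" using f g by (rule S_add_closed)
    show "f \<oplus>\<^bsub>S\<^esub> g = g \<oplus>\<^bsub>S\<^esub> f" using f g by (intro ext) (simp add: S_simps M.a_comm)
    fix h assume h: "h \<in> carrier S"
    show "f \<oplus>\<^bsub>S\<^esub> g \<oplus>\<^bsub>S\<^esub> h = f \<oplus>\<^bsub>S\<^esub> (g \<oplus>\<^bsub>S\<^esub> h)"
      using f g h by (intro ext) (simp add: S_simps M.a_assoc)
  qed (simp add: carrier_S S_simps supp_def)
  show "Group.monoid S"
  proof (rule monoidI)
    fix f assume f: "f \<in> carrier S"
    have one: "supp \<one>\<^bsub>S\<^esub> \<subseteq> {0}" by (auto simp: supp_def S_simps)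
    show "\<one>\<^bsub>S\<^esub> \<otimes>\<^bsub>S\<^esub> f = f"
      using f P_zero by (intro ext, subst S_mult[OF S_one_closed f _ one]) (auto simp: S_simps act_zero)
    show "f \<otimes>\<^bsub>S\<^esub> \<one>\<^bsub>S\<^esub> = f"
    proof
      fix l
      let ?T = "insert l (supp f)"
      have P: "finite (supp f)" "supp f \<subseteq> P" using f by (auto simp: carrier_S)
      have "(f \<otimes>\<^bsub>S\<^esub> \<one>\<^bsub>S\<^esub>) l = (\<Oplus>m\<in>supp f. f m \<otimes> act m (\<one>\<^bsub>S\<^esub> (l - m)))"
        using P by (intro S_mult f S_one_closed) auto
      also have "\<dots> = (\<Oplus>m\<in>supp f. if l = m then f m else \<zero>)"
        using P f by (intro M.add.finprod_cong') (auto simp: S_simps subset_iff)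
      also have "\<dots> = f l"
        using M.add.finprod_singleton[of l "supp f" f] P(1) f
        by (cases "l \<in> supp f") (auto simp: supp_def intro!: M.add.finprod_one_eqI)
      finally show "(f \<otimes>\<^bsub>S\<^esub> \<one>\<^bsub>S\<^esub>) l = f l" .
    qed
  qed (auto intro: S_mult_closed S_one_closed S_mult_assoc)
  fix f g h assume fgh: "f \<in> carrier S" "g \<in> carrier S" "h \<in> carrier S"
  let ?T = "supp f \<union> supp g"
  have T: "finite ?T" "supp f \<subseteq> ?T" "supp g \<subseteq> ?T" "?T \<subseteq> P" "supp h \<subseteq> P" "finite (supp h)"
    using fgh by (auto simp: carrier_S)
  have TP: "m \<in> ?T \<Longrightarrow> m \<in> P" for m using T(4) by blast
  have HP: "m \<in> supp h \<Longrightarrow> m \<in> P" for m using T(5) by blast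
  note fg = S_add_closed[OF fgh(1,2)]
  show "(f \<oplus>\<^bsub>S\<^esub> g) \<otimes>\<^bsub>S\<^esub> h = f \<otimes>\<^bsub>S\<^esub> h \<oplus>\<^bsub>S\<^esub> g \<otimes>\<^bsub>S\<^esub> h"
  proof
    fix l
    have "supp (f \<oplus>\<^bsub>S\<^esub> g) \<subseteq> ?T" by (auto simp: supp_def S_simps)
    then have "((f \<oplus>\<^bsub>S\<^esub> g) \<otimes>\<^bsub>S\<^esub> h) l = (\<Oplus>m\<in>?T. (f m \<oplus> g m) \<otimes> act m (h (l - m)))"
      using S_mult[OF fg fgh(3) T(1) _ T(4)] by (simp add: S_simps)
    also have "\<dots> = (\<Oplus>m\<in>?T. f m \<otimes> act m (h (l - m)) \<oplus> g m \<otimes> act m (h (l - m)))"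
      using fgh TP by (intro M.add.finprod_cong') (auto simp: M.l_distr)
    also have "\<dots> = (\<Oplus>m\<in>?T. f m \<otimes> act m (h (l - m))) \<oplus> (\<Oplus>m\<in>?T. g m \<otimes> act m (h (l - m)))"
      using fgh TP by (intro M.finsum_addf) auto
    also have "\<dots> = (f \<otimes>\<^bsub>S\<^esub> h \<oplus>\<^bsub>S\<^esub> g \<otimes>\<^bsub>S\<^esub> h) l"
      unfolding S_simps(1) S_mult[OF fgh(1,3) T(1,2,4)] S_mult[OF fgh(2,3) T(1,3,4)] ..
    finally show "((f \<oplus>\<^bsub>S\<^esub> g) \<otimes>\<^bsub>S\<^esub> h) l = (f \<otimes>\<^bsub>S\<^esub> h \<oplus>\<^bsub>S\<^esub> g \<otimes>\<^bsub>S\<^esub> h) l" .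
  qed
  show "h \<otimes>\<^bsub>S\<^esub> (f \<oplus>\<^bsub>S\<^esub> g) = h \<otimes>\<^bsub>S\<^esub> f \<oplus>\<^bsub>S\<^esub> h \<otimes>\<^bsub>S\<^esub> g"
  proof
    fix l
    have "(h \<otimes>\<^bsub>S\<^esub> (f \<oplus>\<^bsub>S\<^esub> g)) l = (\<Oplus>m\<in>supp h. h m \<otimes> act m (f (l - m) \<oplus> g (l - m)))"
      using S_mult[OF fgh(3) fg T(6) order_refl T(5)] by (simp add: S_simps)
    also have "\<dots> = (\<Oplus>m\<in>supp h. h m \<otimes> act m (f (l - m)) \<oplus> h m \<otimes> act m (g (l - m)))"
      using fgh HP by (intro M.add.finprod_cong') (auto simp: M.r_distr)
    also have "\<dots> = (\<Oplus>m\<in>supp h. h m \<otimes> act m (f (l - m))) \<oplus> (\<Oplus>m\<in>supp h. h m \<otimes> act m (g (l - m)))"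
      using fgh HP by (intro M.finsum_addf) auto
    also have "\<dots> = (h \<otimes>\<^bsub>S\<^esub> f \<oplus>\<^bsub>S\<^esub> h \<otimes>\<^bsub>S\<^esub> g) l"
      unfolding S_simps(1) S_mult[OF fgh(3,1) T(6) order_refl T(5)] S_mult[OF fgh(3,2) T(6) order_refl T(5)] ..
    finally show "(h \<otimes>\<^bsub>S\<^esub> (f \<oplus>\<^bsub>S\<^esub> g)) l = (h \<otimes>\<^bsub>S\<^esub> f \<oplus>\<^bsub>S\<^esub> h \<otimes>\<^bsub>S\<^esub> g) l" .
  qed
qed

end

section \<open>Quantum matrices\<close>

text \<open>The equation \<open>R A\<^sub>1 A\<^sub>2 = A\<^sub>2 A\<^sub>1 R\<close> of Faddeev, Reshetikhin and Takhtajan in coordinates, with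
  \<open>Q = q\<close> and \<open>L = q - q\<^sup>-\<^sup>1\<close>.  For the various relative positions of \<open>(i, j)\<close> and \<open>(s, t)\<close> it specialises
  to the four families of defining relations.\<close>

definition quantum_matrix :: "'r::ring_1 \<Rightarrow> 'r \<Rightarrow> nat set \<Rightarrow> nat set \<Rightarrow> (nat \<Rightarrow> nat \<Rightarrow> 'r) \<Rightarrow> bool"
  where "quantum_matrix Q L I J A \<longleftrightarrow> (\<forall>i\<in>I. \<forall>s\<in>I. \<forall>j\<in>J. \<forall>t\<in>J.
    (if i = s then Q else 1) * A i j * A s t + (if s < i then L else 0) * A s j * A i t =
    (if j = t then Q else 1) * A s t * A i j + (if j < t then L else 0) * A s j * A i t)"

lemma quantum_matrixD:
  assumes "quantum_matrix Q L I J A" "i \<in> I" "s \<in> I" "j \<in> J" "t \<in> J"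
  shows "(if i = s then Q else 1) * A i j * A s t + (if s < i then L else 0) * A s j * A i t =
    (if j = t then Q else 1) * A s t * A i j + (if j < t then L else 0) * A s j * A i t"
  using assms unfolding quantum_matrix_def by blast

lemma quantum_matrix_relations:
  assumes A: "quantum_matrix Q L I J A"
  shows "\<lbrakk>i \<in> I; j \<in> J; k \<in> J; j < k\<rbrakk> \<Longrightarrow> A i j * A i k = Q * A i k * A i j"
    and "\<lbrakk>i \<in> I; k \<in> I; j \<in> J; i < k\<rbrakk> \<Longrightarrow> A i j * A k j = Q * A k j * A i j"
    and "\<lbrakk>i \<in> I; s \<in> I; j \<in> J; t \<in> J; i < s; t < j\<rbrakk> \<Longrightarrow> A i j * A s t = A s t * A i j"
    and "\<lbrakk>i \<in> I; s \<in> I; j \<in> J; t \<in> J; i < s; j < t\<rbrakk> \<Longrightarrow>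
           A i j * A s t = A s t * A i j + L * A i t * A s j"
proof -
  show "\<lbrakk>i \<in> I; j \<in> J; k \<in> J; j < k\<rbrakk> \<Longrightarrow> A i j * A i k = Q * A i k * A i j"
    using quantum_matrixD[OF A, of i i k j] by simp
  show "\<lbrakk>i \<in> I; k \<in> I; j \<in> J; i < k\<rbrakk> \<Longrightarrow> A i j * A k j = Q * A k j * A i j"
    using quantum_matrixD[OF A, of i k j j] by simp
  show anti: "A i j * A s t = A s t * A i j"
    if "i \<in> I" "s \<in> I" "j \<in> J" "t \<in> J" "i < s" "t < j" for i s j t
    using quantum_matrixD[OF A, of i s j t] that by simp
  show "A i j * A s t = A s t * A i j + L * A i t * A s j"
    if "i \<in> I" "s \<in> I" "j \<in> J" "t \<in> J" "i < s" "j < t"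
    using quantum_matrixD[OF A, of i s j t] anti[of i s t j] that by (simp add: mult.assoc)
qed

text \<open>In the double sum for two entries of the product, the equation for \<open>A\<close> exchanges the factors from \<open>A\<close>
  at the cost of coefficients depending on the summation indices, and the equation for \<open>B\<close> turns
  these into coefficients depending on the outer column indices.\<close>

lemma quantum_matrix_mult:
  fixes A B :: "nat \<Rightarrow> nat \<Rightarrow> 'r::ring_1"
  assumes A: "quantum_matrix Q L I K A" and B: "quantum_matrix Q L K J B"
    and comm: "\<And>i k l j. i \<in> I \<Longrightarrow> k \<in> K \<Longrightarrow> l \<in> K \<Longrightarrow> j \<in> J \<Longrightarrow> A i k * B l j = B l j * A i k"
    and central: "\<And>x. Q * x = x * Q" "\<And>x. L * x = x * L"
    and K: "finite K"
  shows "quantum_matrix Q L I J (\<lambda>i j. \<Sum>k\<in>K. A i k * B k j)"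
  unfolding quantum_matrix_def
proof (intro ballI)
  fix i s j t assume m: "i \<in> I" "s \<in> I" "j \<in> J" "t \<in> J"
  let ?C = "\<lambda>i j. \<Sum>k\<in>K. A i k * B k j"
  define a where "a = (if i = s then Q else 1)"
  define a' where "a' = (if s < i then L else 0)"
  define b where "b k l = (if k = l then Q else 1)" for k l :: nat
  define b' where "b' k l = (if k < l then L else 0)" for k l :: nat
  have cen: "b k l * x = x * b k l" "b' k l * x = x * b' k l" for k l x
    by (auto simp: b_def b'_def central)
  have prod: "?C i' j' * ?C s' t' = (\<Sum>k\<in>K. \<Sum>l\<in>K. A i' k * A s' l * (B k j' * B l t'))"
    if "i' \<in> I" "s' \<in> I" "j' \<in> J" "t' \<in> J" for i' s' j' t'
  proof -
    have "?C i' j' * ?C s' t' = (\<Sum>k\<in>K. \<Sum>l\<in>K. A i' k * (B k j' * A s' l) * B l t')"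
      by (simp add: sum_product mult.assoc)
    also have "\<dots> = (\<Sum>k\<in>K. \<Sum>l\<in>K. A i' k * (A s' l * B k j') * B l t')"
      using that by (intro sum.cong refl) (simp add: comm)
    finally show ?thesis by (simp add: mult.assoc)
  qed
  have relA: "a * A i k * A s l + a' * A s k * A i l = b k l * A s l * A i k + b' k l * A s k * A i l"
    if "k \<in> K" "l \<in> K" for k l
    using quantum_matrixD[OF A m(1,2) that] by (simp add: a_def a'_def b_def b'_def)
  have relB: "b k l * B k j * B l t + b' l k * B l j * B k t = b j t * B l t * B k j + b' j t * B l j * B k t"
    if "k \<in> K" "l \<in> K" for k l
    using quantum_matrixD[OF B that m(3,4)] by (simp add: b_def b'_def)
  have "a * ?C i j * ?C s t + a' * ?C s j * ?C i t =
        (\<Sum>k\<in>K. \<Sum>l\<in>K. (a * A i k * A s l + a' * A s k * A i l) * (B k j * B l t))"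
    unfolding mult.assoc[of a "?C i j"] mult.assoc[of a' "?C s j"] prod[OF m] prod[OF m(2,1,3,4)]
    by (simp add: mult.assoc sum_distrib_left sum.distrib distrib_right)
  also have "\<dots> = (\<Sum>k\<in>K. \<Sum>l\<in>K. A s l * A i k * (b k l * B k j * B l t)) +
                  (\<Sum>k\<in>K. \<Sum>l\<in>K. A s k * A i l * (b' k l * B k j * B l t))"
    unfolding sum.distrib[symmetric]
  proof (intro sum.cong refl)
    fix k l assume kl: "k \<in> K" "l \<in> K"
    have "(b k l * A s l * A i k + b' k l * A s k * A i l) * (B k j * B l t) =
       (b k l * (A s l * A i k)) * (B k j * B l t) + (b' k l * (A s k * A i l)) * (B k j * B l t)"
      by (simp add: distrib_right mult.assoc)
    also have "\<dots> = A s l * A i k * (b k l * B k j * B l t) + A s k * A i l * (b' k l * B k j * B l t)"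
      unfolding cen by (simp add: mult.assoc cen)
    finally show "(a * A i k * A s l + a' * A s k * A i l) * (B k j * B l t) =
       A s l * A i k * (b k l * B k j * B l t) + A s k * A i l * (b' k l * B k j * B l t)"
      by (simp add: relA kl)
  qed
  \<comment> \<open>Exchanging the two summation indices in the second sum turns the correction term of \<open>A\<close>
    into the correction term of \<open>B\<close>.\<close>
  also have "(\<Sum>k\<in>K. \<Sum>l\<in>K. A s k * A i l * (b' k l * B k j * B l t)) =
             (\<Sum>k\<in>K. \<Sum>l\<in>K. A s l * A i k * (b' l k * B l j * B k t))"
    by (rule sum.swap)
  also have "(\<Sum>k\<in>K. \<Sum>l\<in>K. A s l * A i k * (b k l * B k j * B l t)) + \<dots> =
    (\<Sum>k\<in>K. \<Sum>l\<in>K. A s l * A i k * (b j t * B l t * B k j + b' j t * B l j * B k t))"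
    unfolding sum.distrib[symmetric]
    by (intro sum.cong refl) (simp add: relB[symmetric] distrib_left)
  also have "\<dots> = (\<Sum>k\<in>K. \<Sum>l\<in>K. b j t * (A s l * A i k * (B l t * B k j))) +
                  (\<Sum>k\<in>K. \<Sum>l\<in>K. b' j t * (A s l * A i k * (B l j * B k t)))"
    unfolding sum.distrib[symmetric]
    by (intro sum.cong refl) (simp add: distrib_left mult.assoc cen)
  also have "\<dots> = b j t * ?C s t * ?C i j + b' j t * ?C s j * ?C i t"
    unfolding mult.assoc[of "b j t"] mult.assoc[of "b' j t"] prod[OF m(2,1,4,3)] prod[OF m(2,1,3,4)]
    by (subst (1 3) sum.swap) (simp add: sum_distrib_left)
  finally show "(if i = s then Q else 1) * ?C i j * ?C s t + (if s < i then L else 0) * ?C s j * ?C i t =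
    (if j = t then Q else 1) * ?C s t * ?C i j + (if j < t then L else 0) * ?C s j * ?C i t"
    by (simp only: a_def a'_def b_def b'_def)
qed

text \<open>The new matrix is the product of the block diagonal matrix with blocks \<open>A\<close> and \<open>1\<close> with \<open>B\<close>.\<close>

lemma quantum_matrix_new_row:
  fixes A B :: "nat \<Rightarrow> nat \<Rightarrow> 'r::ring_1"
  assumes A: "quantum_matrix Q L {1..m} {1..n} A" and B: "quantum_matrix Q L {1..Suc n} {1..n} B"
    and comm: "\<And>i k l j. i \<in> {1..m} \<Longrightarrow> k \<in> {1..n} \<Longrightarrow> l \<in> {1..Suc n} \<Longrightarrow> j \<in> {1..n} \<Longrightarrow>
                 A i k * B l j = B l j * A i k"
    and central: "\<And>x. Q * x = x * Q" "\<And>x. L * x = x * L"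
  shows "quantum_matrix Q L {1..Suc m} {1..n}
           (\<lambda>i j. if i = Suc m then B (Suc n) j else \<Sum>k=1..n. A i k * B k j)"
    (is "quantum_matrix _ _ _ _ ?C")
  unfolding quantum_matrix_def
proof (intro ballI)
  fix i s j t assume m: "i \<in> {1..Suc m}" "s \<in> {1..Suc m}" "j \<in> {1..n}" "t \<in> {1..n}"
  let ?b = "if j = t then Q else 1" and ?b' = "if j < t then L else 0"
  have B': "quantum_matrix Q L {1..n} {1..n} B"
    unfolding quantum_matrix_def by (intro ballI quantum_matrixD[OF B]) auto
  have relB: "(if k = l then Q else 1) * B k j * B l t + (if l < k then L else 0) * B l j * B k t =
      ?b * B l t * B k j + ?b' * B l j * B k t" if "k \<in> {1..Suc n}" "l \<in> {1..Suc n}" for k l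
    using quantum_matrixD[OF B that m(3,4)] .
  have cen: "?b * x = x * ?b" "?b' * x = x * ?b'" for x
    by (auto simp: central)
  consider "i = Suc m" "s = Suc m" | "i = Suc m" "s \<in> {1..m}" | "i \<in> {1..m}" "s = Suc m"
    | "i \<in> {1..m}" "s \<in> {1..m}"
    using m by (metis atLeastAtMost_iff le_Suc_eq)
  then show "(if i = s then Q else 1) * ?C i j * ?C s t + (if s < i then L else 0) * ?C s j * ?C i t =
    (if j = t then Q else 1) * ?C s t * ?C i j + (if j < t then L else 0) * ?C s j * ?C i t"
  proof cases
    case 1
    then show ?thesis using relB[of "Suc n" "Suc n"] by simp
  next
    case 2
    have "?C i j * ?C s t + L * ?C s j * ?C i t =
       (\<Sum>k=1..n. B (Suc n) j * (A s k * B k t) + L * (A s k * B k j) * B (Suc n) t)"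
      using 2 by (auto simp: sum_distrib_left sum_distrib_right sum.distrib mult.assoc)
    also have "\<dots> = (\<Sum>k=1..n. A s k * (1 * B (Suc n) j * B k t + L * B k j * B (Suc n) t))"
    proof (intro sum.cong refl)
      fix k assume k: "k \<in> {1..n}"
      have "B (Suc n) j * (A s k * B k t) = A s k * (B (Suc n) j * B k t)"
        using comm[of s k "Suc n" j] 2 k m by (metis (no_types) mult.assoc atLeastAtMost_iff le_refl le_numeral_extra(4) One_nat_def Suc_le_mono le0)
      moreover have "L * (A s k * B k j) * B (Suc n) t = A s k * (L * B k j * B (Suc n) t)"
        by (metis (no_types) central(2) mult.assoc)
      ultimately show "B (Suc n) j * (A s k * B k t) + L * (A s k * B k j) * B (Suc n) t =
        A s k * (1 * B (Suc n) j * B k t + L * B k j * B (Suc n) t)"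
        by (simp add: distrib_left)
    qed
    also have "\<dots> = (\<Sum>k=1..n. A s k * (?b * B k t * B (Suc n) j + ?b' * B k j * B (Suc n) t))"
    proof (intro sum.cong refl)
      fix k assume k: "k \<in> {1..n}"
      then show "A s k * (1 * B (Suc n) j * B k t + L * B k j * B (Suc n) t) =
         A s k * (?b * B k t * B (Suc n) j + ?b' * B k j * B (Suc n) t)"
        using relB[of "Suc n" k] by simp
    qed
    also have "\<dots> = (\<Sum>k=1..n. ?b * (A s k * B k t) * B (Suc n) j + ?b' * (A s k * B k j) * B (Suc n) t)"
    proof (intro sum.cong refl)
      fix k
      show "A s k * (?b * B k t * B (Suc n) j + ?b' * B k j * B (Suc n) t) =
        ?b * (A s k * B k t) * B (Suc n) j + ?b' * (A s k * B k j) * B (Suc n) t"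
        by (metis (no_types) cen distrib_left mult.assoc)
    qed
    also have "\<dots> = ?b * ?C s t * ?C i j + ?b' * ?C s j * ?C i t"
      using 2 by (auto simp: sum_distrib_left sum_distrib_right sum.distrib mult.assoc)
    finally show ?thesis using 2 by auto
  next
    case 3
    have "?C i j * ?C s t = (\<Sum>k=1..n. A i k * (1 * B k j * B (Suc n) t))"
      using 3 by (auto simp: sum_distrib_right mult.assoc)
    also have "\<dots> = (\<Sum>k=1..n. A i k * (?b * B (Suc n) t * B k j + ?b' * B (Suc n) j * B k t))"
    proof (intro sum.cong refl)
      fix k assume k: "k \<in> {1..n}"
      then show "A i k * (1 * B k j * B (Suc n) t) =
         A i k * (?b * B (Suc n) t * B k j + ?b' * B (Suc n) j * B k t)"
        using relB[of k "Suc n"] by simp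
    qed
    also have "\<dots> = (\<Sum>k=1..n. ?b * B (Suc n) t * (A i k * B k j) + ?b' * B (Suc n) j * (A i k * B k t))"
    proof (intro sum.cong refl)
      fix k assume k: "k \<in> {1..n}"
      have "A i k * B (Suc n) t = B (Suc n) t * A i k" "A i k * B (Suc n) j = B (Suc n) j * A i k"
        using 3 k m by (auto intro!: comm)
      then show "A i k * (?b * B (Suc n) t * B k j + ?b' * B (Suc n) j * B k t) =
        ?b * B (Suc n) t * (A i k * B k j) + ?b' * B (Suc n) j * (A i k * B k t)"
        by (metis (no_types) cen distrib_left mult.assoc)
    qed
    also have "\<dots> = ?b * ?C s t * ?C i j + ?b' * ?C s j * ?C i t"
      using 3 by (auto simp: sum_distrib_left sum.distrib mult.assoc)
    finally show ?thesis using 3 by auto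
  next
    case 4
    have "quantum_matrix Q L {1..m} {1..n} (\<lambda>i j. \<Sum>k=1..n. A i k * B k j)"
      by (rule quantum_matrix_mult[OF A B' _ central]) (auto intro: comm)
    from quantum_matrixD[OF this 4 m(3,4)] show ?thesis using 4 by auto
  qed
qed

section \<open>A quantum matrix of operators\<close>

text \<open>Linear operators on complex functions, as a type with a ring structure.  Linearity over the complex numbers
  makes the scalar operators central.\<close>

typedef 'e endo = "{T :: ('e \<Rightarrow> complex) \<Rightarrow> 'e \<Rightarrow> complex.
    (\<forall>f g. T (\<lambda>e. f e + g e) = (\<lambda>e. T f e + T g e)) \<and> (\<forall>c f. T (\<lambda>e. c * f e) = (\<lambda>e. c * T f e))}"
  morphisms apply_endo Abs_endo
  by (rule exI[of _ "\<lambda>f. f"]) simp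

setup_lifting type_definition_endo

instantiation endo :: (type) ring_1
begin
lift_definition zero_endo :: "'a endo" is "\<lambda>f e. 0" by simp
lift_definition one_endo :: "'a endo" is "\<lambda>f. f" by simp
lift_definition plus_endo :: "'a endo \<Rightarrow> 'a endo \<Rightarrow> 'a endo" is "\<lambda>S T f e. S f e + T f e"
  by (simp add: distrib_left add_ac)
lift_definition uminus_endo :: "'a endo \<Rightarrow> 'a endo" is "\<lambda>T f e. - T f e" by simp
lift_definition minus_endo :: "'a endo \<Rightarrow> 'a endo \<Rightarrow> 'a endo" is "\<lambda>S T f e. S f e - T f e"
  by (simp add: algebra_simps)
lift_definition times_endo :: "'a endo \<Rightarrow> 'a endo \<Rightarrow> 'a endo" is "\<lambda>S T f. S (T f)" by simp
instance
proof
  show "(0 :: 'a endo) \<noteq> 1"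
    by transfer (metis zero_neq_one)
qed (transfer; simp add: add_ac fun_eq_iff)+
end

lemma endo_eqI: "(\<And>f e. apply_endo S f e = apply_endo T f e) \<Longrightarrow> S = T"
  by transfer (simp add: fun_eq_iff)

lemma apply_endo_simps [simp]:
  "apply_endo 0 f e = 0" "apply_endo 1 f e = f e"
  "apply_endo (S + T) f e = apply_endo S f e + apply_endo T f e"
  "apply_endo (S - T) f e = apply_endo S f e - apply_endo T f e"
  "apply_endo (S * T) f e = apply_endo S (apply_endo T f) e"
  by (transfer; simp)+

lemma apply_endo_sum: "apply_endo (sum A I) f e = (\<Sum>x\<in>I. apply_endo (A x) f e)"
  by (induction I rule: infinite_finite_induct) auto

lift_definition scalar_endo :: "complex \<Rightarrow> 'e endo" is "\<lambda>c f e. c * f e"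
  by (simp add: distrib_left mult_ac)

lemma apply_scalar_endo [simp]: "apply_endo (scalar_endo c) f e = c * f e"
  by transfer simp

lemma scalar_endo_central: "scalar_endo c * T = T * scalar_endo c"
  by transfer (simp add: fun_eq_iff)

lift_definition weighted_shift :: "('e::ab_group_add \<Rightarrow> complex) \<Rightarrow> 'e \<Rightarrow> 'e endo"
  is "\<lambda>g s f e. g e * f (e - s)"
  by (simp add: distrib_left mult_ac)

lemma apply_weighted_shift [simp]: "apply_endo (weighted_shift g s) f e = g e * f (e - s)"
  by transfer simp

lemma weighted_shift_mult:
  "weighted_shift g s * weighted_shift h t = weighted_shift (\<lambda>e. g e * h (e - s)) (s + t)"
  by (rule endo_eqI) (simp add: algebra_simps)

type_synonym lattice = "nat \<times> nat \<Rightarrow>\<^sub>0 int"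

text \<open>The matrix of row \<open>m\<close> acts on row \<open>m\<close> of the lattice points.  Its entries are \<open>d\<^sub>k u\<^sub>k\<^sup>-\<^sup>1 u\<^sub>j\<close> for \<open>j \<le> k\<close>,
  where \<open>(u\<^sub>j f) e = q\<^bsup>e\<^sub>j + e\<^sub>j\<^sub>+\<^sub>1 + \<dots>\<^esup> f (e - \<epsilon>\<^sub>j)\<close> and \<open>(d\<^sub>k f) e = q\<^bsup>e\<^sub>k\<^esup> f e\<close>.  These operators satisfy
  \<open>u\<^sub>i u\<^sub>j = q u\<^sub>j u\<^sub>i\<close> for \<open>i < j\<close> and \<open>d\<^sub>k u\<^sub>k = q u\<^sub>k d\<^sub>k\<close>, and \<open>d\<^sub>k\<close> commutes with the other \<open>u\<^sub>j\<close>
  and with every \<open>d\<^sub>l\<close>.\<close>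

definition row_coeff :: "complex \<Rightarrow> nat \<Rightarrow> nat \<Rightarrow> nat \<Rightarrow> lattice \<Rightarrow> complex"
  where "row_coeff q m k j e = (if j \<le> k then q powi (\<Sum>i=j..k. Poly_Mapping.lookup e (m, i)) else 0)"

definition row_matrix :: "complex \<Rightarrow> nat \<Rightarrow> nat \<Rightarrow> nat \<Rightarrow> lattice endo"
  where "row_matrix q m k j = weighted_shift (row_coeff q m k j) (frag_of (m, j) - frag_of (m, k))"

lemma row_coeff_shift:
  assumes q: "q \<noteq> 0"
  shows "row_coeff q m l t (e - (frag_of (m, j) - frag_of (m, k))) =
    row_coeff q m l t e * q powi ((if t \<le> k \<and> k \<le> l then 1 else 0) - (if t \<le> j \<and> j \<le> l then 1 else 0))"
proof -
  have "(\<Sum>i=t..l. Poly_Mapping.lookup (frag_of (m, j)) (m, i)) = (if t \<le> j \<and> j \<le> l then 1 else 0 :: int)" for j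
    by simp
  then have "(\<Sum>i=t..l. Poly_Mapping.lookup (e - (frag_of (m, j) - frag_of (m, k))) (m, i)) =
    (\<Sum>i=t..l. Poly_Mapping.lookup e (m, i)) +
    ((if t \<le> k \<and> k \<le> l then 1 else 0) - (if t \<le> j \<and> j \<le> l then 1 else 0))"
    unfolding lookup_minus sum_subtractf by (simp only: algebra_simps)
  then show ?thesis
    using q unfolding row_coeff_def by (auto simp only: power_int_add if_True if_False simp_thms mult_zero_left split: if_split)
qed

lemma row_matrix_other_row:
  assumes "m \<noteq> m'"
  shows "row_matrix q m k j * row_matrix q m' l t = row_matrix q m' l t * row_matrix q m k j"
proof -
  have "row_coeff q m l t (e - (frag_of (m', j) - frag_of (m', k))) = row_coeff q m l t e"
    if "m \<noteq> m'" for m m' l t j k e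
    using that by (simp add: row_coeff_def lookup_minus)
  from this[OF assms] this[OF assms[symmetric]] show ?thesis
    by (simp only: row_matrix_def weighted_shift_mult add.commute mult.commute)
qed

text \<open>All products in the equation shift by the same vector, so it reduces to an identity between
  powers of \<open>q\<close>.  When all four entries involved are nonzero, a common power of \<open>q\<close> can be
  factored out, and what is left in each relative position of \<open>k, l\<close> and \<open>j, t\<close> is an identity
  between \<open>1\<close>, \<open>q\<close> and \<open>q\<^sup>-\<^sup>1\<close>.\<close>

lemma quantum_matrix_row_matrix:
  assumes q: "q \<noteq> 0"
  shows "quantum_matrix (scalar_endo q) (scalar_endo (q - inverse q)) I J (row_matrix q m)"
  unfolding quantum_matrix_def
proof (intro ballI endo_eqI)
  fix k l j t f e
  define S :: "nat \<Rightarrow> nat \<Rightarrow> int" where "S a b = (\<Sum>i=a..b. Poly_Mapping.lookup e (m, i))" for a b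
  \<comment> \<open>Both sides count the same indices with the same multiplicities.\<close>
  have swap: "S j k + S t l = S t k + S j l" if "j \<le> k" "j \<le> l" "t \<le> k" "t \<le> l"
  proof -
    have *: "S a k - S a l = S b k - S b l" if "a \<le> b" "b \<le> k" "b \<le> l" for a b
    proof -
      have "S a c = (\<Sum>i\<in>{a..<b}. Poly_Mapping.lookup e (m, i)) + S b c" if "b \<le> c" for c
        unfolding S_def atLeastLessThanSuc_atLeastAtMost[symmetric] using that \<open>a \<le> b\<close>
        by (intro sum.atLeastLessThan_concat[symmetric]) auto
      from this[OF \<open>b \<le> k\<close>] this[OF \<open>b \<le> l\<close>] show ?thesis by linarith
    qed
    show ?thesis
    proof (cases "j \<le> t")
      case True
      from *[OF this that(3,4)] show ?thesis by linarith
    next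
      case False
      then have "t \<le> j" by simp
      from *[OF this that(1,2)] show ?thesis by linarith
    qed
  qed
  define Y where "Y = q powi (S j k + S t l)"
  have shift: "e - (frag_of (m, j) - frag_of (m, k)) - (frag_of (m, t) - frag_of (m, l)) =
               e - (frag_of (m, t) - frag_of (m, k)) - (frag_of (m, j) - frag_of (m, l))"
    "e - (frag_of (m, t) - frag_of (m, l)) - (frag_of (m, j) - frag_of (m, k)) =
               e - (frag_of (m, t) - frag_of (m, k)) - (frag_of (m, j) - frag_of (m, l))"
    "e - (frag_of (m, j) - frag_of (m, l)) - (frag_of (m, t) - frag_of (m, k)) =
               e - (frag_of (m, t) - frag_of (m, k)) - (frag_of (m, j) - frag_of (m, l))"
    by (simp_all add: algebra_simps)
  have Y1: "q powi S j k * q powi S t l = Y"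
    using q by (simp add: Y_def power_int_add)
  have Y2: "q powi S j l * q powi S t k = Y" if "j \<le> k" "j \<le> l" "t \<le> k" "t \<le> l"
    using q swap[OF that] by (simp add: Y_def power_int_add[symmetric] add.commute)
  have coeff: "row_coeff q m a b e = (if b \<le> a then q powi S b a else 0)" for a b
    by (simp add: row_coeff_def S_def)
  have "(if k = l then q else 1) * (row_coeff q m k j e * row_coeff q m l t (e - (frag_of (m, j) - frag_of (m, k))))
     + (if l < k then q - inverse q else 0) * (row_coeff q m l j e * row_coeff q m k t (e - (frag_of (m, j) - frag_of (m, l))))
    = (if j = t then q else 1) * (row_coeff q m l t e * row_coeff q m k j (e - (frag_of (m, t) - frag_of (m, l))))
     + (if j < t then q - inverse q else 0) * (row_coeff q m l j e * row_coeff q m k t (e - (frag_of (m, j) - frag_of (m, l))))"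
    (is "?L + ?L' = ?R + ?R'")
  proof -
    consider "\<not> (j \<le> k \<and> t \<le> l)" | "j \<le> k \<and> t \<le> l" "\<not> (j \<le> l \<and> t \<le> k)"
      | "j \<le> k" "t \<le> l" "j \<le> l" "t \<le> k"
      by blast
    then show ?thesis
    proof cases
      case 1
      then show ?thesis by (auto simp: row_coeff_def)
    next
      case 2
      then show ?thesis
        unfolding row_coeff_shift[OF q] coeff using q by auto
    next
      case 3
      have factor: "a * (x * (y * c)) = (x * y) * (a * c)" for a x y c :: complex
        by simp
      have "row_coeff q m k j e = q powi S j k" "row_coeff q m l t e = q powi S t l"
        "row_coeff q m l j e = q powi S j l" "row_coeff q m k t e = q powi S t k"
        using 3 by (simp_all add: coeff)
      moreover have "q powi S t l * q powi S j k = Y"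
        using Y1 by (simp add: mult.commute)
      ultimately show ?thesis
        unfolding row_coeff_shift[OF q] factor
        using Y1 Y2[OF 3(1,3,4,2)] q 3
        by (cases k l rule: linorder_cases; cases j t rule: linorder_cases)
          (simp_all add: field_simps power_int_minus power2_eq_square)
    qed
  qed
  note eq = this
  show "apply_endo ((if k = l then scalar_endo q else 1) * row_matrix q m k j * row_matrix q m l t +
        (if l < k then scalar_endo (q - inverse q) else 0) * row_matrix q m l j * row_matrix q m k t) f e =
      apply_endo ((if j = t then scalar_endo q else 1) * row_matrix q m l t * row_matrix q m k j +
        (if j < t then scalar_endo (q - inverse q) else 0) * row_matrix q m l j * row_matrix q m k t) f e"
    (is "?l = ?r")
  proof -
    let ?e = "e - (frag_of (m, t) - frag_of (m, k)) - (frag_of (m, j) - frag_of (m, l))"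
    have scalar: "(if b then scalar_endo c else 1) = scalar_endo (if b then c else 1)"
      "(if b then scalar_endo c else 0) = scalar_endo (if b then c else 0)" for b c
      by (auto intro!: endo_eqI)
    have "?l = (?L + ?L') * f ?e"
      by (simp only: scalar row_matrix_def shift distrib_right mult.assoc apply_endo_simps
            apply_scalar_endo apply_weighted_shift)
    moreover have "?r = (?R + ?R') * f ?e"
      by (simp only: scalar row_matrix_def shift distrib_right mult.assoc apply_endo_simps
            apply_scalar_endo apply_weighted_shift)
    ultimately show ?thesis using eq by simp
  qed
qed

text \<open>The matrix of the first \<open>m\<close> rows.  Unfolded, entry \<open>(i, j)\<close> is a sum over paths
  \<open>k\<^sub>i \<ge> k\<^sub>i\<^sub>+\<^sub>1 \<ge> \<dots> \<ge> k\<^sub>m = j\<close> of columns: row \<open>i\<close> is entered from the extra column \<open>Suc n\<close> and left in column \<open>k\<^sub>i\<close>,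
  and row \<open>r > i\<close> leads from column \<open>k\<^sub>r\<^sub>-\<^sub>1\<close> to column \<open>k\<^sub>r\<close>.\<close>

fun path_matrix :: "complex \<Rightarrow> nat \<Rightarrow> nat \<Rightarrow> nat \<Rightarrow> nat \<Rightarrow> lattice endo"
  where "path_matrix q n 0 i j = 0"
  | "path_matrix q n (Suc m) i j = (if i = Suc m then row_matrix q (Suc m) (Suc n) j
       else \<Sum>k=1..n. path_matrix q n m i k * row_matrix q (Suc m) k j)"

lemma path_matrix_other_row:
  "m < r \<Longrightarrow> path_matrix q n m i k * row_matrix q r l j = row_matrix q r l j * path_matrix q n m i k"
proof (induction m arbitrary: i k)
  case (Suc m)
  have "path_matrix q n m i k' * row_matrix q (Suc m) k' k * row_matrix q r l j =
        row_matrix q r l j * (path_matrix q n m i k' * row_matrix q (Suc m) k' k)" for k'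
    using Suc row_matrix_other_row[of "Suc m" r q k' k l j] by (metis Suc_lessD less_irrefl mult.assoc)
  then show ?case
    using Suc.prems row_matrix_other_row[of "Suc m" r q "Suc n" k l j]
    by (auto simp: sum_distrib_left sum_distrib_right)
qed simp

theorem quantum_matrix_path_matrix:
  assumes "q \<noteq> 0"
  shows "quantum_matrix (scalar_endo q) (scalar_endo (q - inverse q)) {1..m} {1..n} (path_matrix q n m)"
proof (induction m)
  case 0
  then show ?case by (simp add: quantum_matrix_def)
next
  case (Suc m)
  have "path_matrix q n (Suc m) = (\<lambda>i j. if i = Suc m then row_matrix q (Suc m) (Suc n) j
       else \<Sum>k=1..n. path_matrix q n m i k * row_matrix q (Suc m) k j)"
    by (intro ext) simp
  then show ?case
    using quantum_matrix_new_row[OF Suc quantum_matrix_row_matrix[OF assms]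
        path_matrix_other_row scalar_endo_central scalar_endo_central, of "Suc m"]
    by simp
qed

section \<open>Leading terms\<close>

text \<open>A step to the left by one column in row \<open>r\<close> costs height \<open>r\<close>, so a path that ends in a given column is highest
  when it goes there as early as possible.  The extra column does not count.\<close>

definition height :: "nat \<Rightarrow> lattice \<Rightarrow> int"
  where "height n e = (\<Sum>(i, j)\<in>mat_indices n. int (i * j) * Poly_Mapping.lookup e (i, j))"

lemma height_simps [simp]:
  "height n 0 = 0" "height n (d + e) = height n d + height n e" "height n (d - e) = height n d - height n e"
  "height n (frag_of (i, j)) = (if (i, j) \<in> mat_indices n then int (i * j) else 0)"
proof -
  show "height n 0 = 0" "height n (d + e) = height n d + height n e" "height n (d - e) = height n d - height n e"
    by (simp_all add: height_def lookup_add lookup_minus case_prod_unfold distrib_left right_diff_distrib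
        sum.distrib sum_subtractf)
  have "finite (mat_indices n)" by (simp add: mat_indices_def)
  moreover have "height n (frag_of (i, j)) = (\<Sum>p\<in>mat_indices n. if p = (i, j) then int (i * j) else 0)"
    unfolding height_def by (intro sum.cong) auto
  ultimately show "height n (frag_of (i, j)) = (if (i, j) \<in> mat_indices n then int (i * j) else 0)"
    by simp
qed

definition bounded_by :: "nat \<Rightarrow> int \<Rightarrow> (lattice \<Rightarrow> complex) \<Rightarrow> bool"
  where "bounded_by n b f \<longleftrightarrow> (\<forall>e. f e \<noteq> 0 \<longrightarrow> height n e \<le> b)"

text \<open>On a function bounded by height \<open>b\<close>, the operator agrees in the heights from
  \<open>b + height n s\<close> on with the weighted shift by \<open>s\<close>.  With \<open>g = 0\<close> this says that the operator raises heights by less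
  than \<open>height n s\<close>.\<close>

definition leading_term :: "nat \<Rightarrow> lattice endo \<Rightarrow> lattice \<Rightarrow> (lattice \<Rightarrow> complex) \<Rightarrow> bool"
  where "leading_term n T s g \<longleftrightarrow>
    (\<forall>b f e. bounded_by n b f \<longrightarrow> b + height n s \<le> height n e \<longrightarrow> apply_endo T f e = g e * f (e - s))"

lemma leading_termD:
  "leading_term n T s g \<Longrightarrow> bounded_by n b f \<Longrightarrow> b + height n s \<le> height n e \<Longrightarrow>
    apply_endo T f e = g e * f (e - s)"
  unfolding leading_term_def by blast

lemma leading_term_weighted_shift: "leading_term n (weighted_shift g s) s g"
  by (simp add: leading_term_def)

lemma leading_term_bounded:
  assumes "leading_term n T s g" "bounded_by n b f"
  shows "bounded_by n (b + height n s) (apply_endo T f)"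
  unfolding bounded_by_def
proof (intro allI impI, rule ccontr)
  fix e assume e: "apply_endo T f e \<noteq> 0" "\<not> height n e \<le> b + height n s"
  then have "f (e - s) \<noteq> 0" using leading_termD[OF assms, of e] by auto
  then have "height n (e - s) \<le> b" using assms(2) by (auto simp: bounded_by_def)
  with e show False by simp
qed

lemma leading_term_mult:
  assumes S: "leading_term n S s g" and T: "leading_term n T t h"
  shows "leading_term n (S * T) (s + t) (\<lambda>e. g e * h (e - s))"
  unfolding leading_term_def
proof (intro allI impI)
  fix b f e assume f: "bounded_by n b f" and e: "b + height n (s + t) \<le> height n e"
  have "apply_endo S (apply_endo T f) e = g e * apply_endo T f (e - s)"
    using leading_termD[OF S leading_term_bounded[OF T f], of e] e by (simp add: add_ac)
  also have "apply_endo T f (e - s) = h (e - s) * f (e - s - t)"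
    using leading_termD[OF T f, of "e - s"] e by simp
  finally show "apply_endo (S * T) f e = g e * h (e - s) * f (e - (s + t))"
    by (simp add: diff_diff_add)
qed

lemma leading_term_zero: "leading_term n 0 s (\<lambda>e. 0)"
  by (simp add: leading_term_def)

lemma leading_term_lower:
  assumes T: "leading_term n T s g" and "height n s < height n t"
  shows "leading_term n T t (\<lambda>e. 0)"
  unfolding leading_term_def
proof (intro allI impI)
  fix b f e assume f: "bounded_by n b f" and e: "b + height n t \<le> height n e"
  have "f (e - s) = 0"
    using f e assms(2) by (auto simp: bounded_by_def)
  then show "apply_endo T f e = 0 * f (e - t)"
    using leading_termD[OF T f, of e] e assms(2) by simp
qed

lemma leading_term_sum:
  assumes "finite K" "\<And>k. k \<in> K \<Longrightarrow> leading_term n (T k) s (g k)"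
  shows "leading_term n (\<Sum>k\<in>K. T k) s (\<lambda>e. \<Sum>k\<in>K. g k e)"
  using assms by (auto simp: leading_term_def apply_endo_sum sum_distrib_right intro!: sum.cong)

text \<open>The shift along the straight path, which turns only at \<open>(i, j)\<close>.\<close>

definition corner_shift :: "nat \<Rightarrow> nat \<times> nat \<Rightarrow> lattice"
  where "corner_shift n = (\<lambda>(i, j). frag_of (i, j) - frag_of (i, Suc n))"

text \<open>By induction on the number of rows.  The last row may be crossed straight, or from some column \<open>k > j\<close>.
  In the second case the height gained is \<open>i k + r (j - k)\<close> for the last row \<open>r\<close>, which is less than \<open>i j\<close>
  because \<open>i < r\<close>.\<close>

lemma path_matrix_leading_term:
  assumes q: "q \<noteq> 0" and ij: "1 \<le> i" "i \<le> m" "m \<le> n" "j \<in> {1..n}"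
  shows "\<exists>g. (\<forall>e. g e \<noteq> 0) \<and> leading_term n (path_matrix q n m i j) (corner_shift n (i, j)) g"
  using ij
proof (induction m arbitrary: j)
  case (Suc m)
  have coeff: "row_coeff q r k l e \<noteq> 0" if "l \<le> k" for r k l e
    using that q by (simp add: row_coeff_def)
  show ?case
  proof (cases "i = Suc m")
    case True
    then show ?thesis
      using Suc.prems coeff leading_term_weighted_shift[of n "row_coeff q (Suc m) (Suc n) j"]
      by (intro exI[of _ "row_coeff q (Suc m) (Suc n) j"]) (auto simp: row_matrix_def corner_shift_def)
  next
    case False
    with Suc have i: "i \<le> m" by simp
    have "\<exists>g. (\<forall>e. g e \<noteq> 0) \<and> leading_term n (path_matrix q n m i k) (corner_shift n (i, k)) g"
      if "k \<in> {1..n}" for k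
      using Suc i that by (intro Suc.IH) auto
    then obtain g where g: "\<And>k e. k \<in> {1..n} \<Longrightarrow> g k e \<noteq> 0"
      "\<And>k. k \<in> {1..n} \<Longrightarrow> leading_term n (path_matrix q n m i k) (corner_shift n (i, k)) (g k)"
      by metis
    define h where "h k = (\<lambda>e. if k = j then g j e * row_coeff q (Suc m) j j (e - corner_shift n (i, j)) else 0)" for k
    have lead: "leading_term n (path_matrix q n m i k * row_matrix q (Suc m) k j) (corner_shift n (i, j)) (h k)"
      if k: "k \<in> {1..n}" for k
    proof -
      let ?s = "corner_shift n (i, k) + (frag_of (Suc m, j) - frag_of (Suc m, k))"
      note product = leading_term_mult[OF g(2)[OF k] leading_term_weighted_shift[of n "row_coeff q (Suc m) k j"
            "frag_of (Suc m, j) - frag_of (Suc m, k)"], folded row_matrix_def]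
      consider "k < j" | "k = j" | "j < k" by linarith
      then show ?thesis
      proof cases
        case 1
        then have "row_matrix q (Suc m) k j = 0"
          by (intro endo_eqI) (simp add: row_matrix_def row_coeff_def)
        with 1 show ?thesis by (simp add: h_def leading_term_zero)
      next
        case 2
        then show ?thesis using product by (simp add: h_def)
      next
        case 3
        have "int i * int k + int (Suc m) * (int j - int k) < int i * int j"
        proof -
          have "(int (Suc m) - int i) * (int k - int j) > 0"
            using i 3 by (intro mult_pos_pos) auto
          then show ?thesis by (simp add: algebra_simps)
        qed
        then have "height n ?s < height n (corner_shift n (i, j))"
          using k i Suc.prems by (simp add: corner_shift_def mat_indices_def algebra_simps)
        from leading_term_lower[OF product this] show ?thesis
          using 3 by (simp add: h_def)
      qed
    qed
    have "(\<Sum>k=1..n. h k e) = h j e" for e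
      using Suc.prems(4) unfolding h_def by (subst sum.delta) auto
    moreover have "leading_term n (\<Sum>k=1..n. path_matrix q n m i k * row_matrix q (Suc m) k j)
        (corner_shift n (i, j)) (\<lambda>e. \<Sum>k=1..n. h k e)"
      by (rule leading_term_sum[OF _ lead]) simp
    ultimately have "leading_term n (path_matrix q n (Suc m) i j) (corner_shift n (i, j)) (h j)"
      using False by simp
    moreover have "h j e \<noteq> 0" for e
      using g(1)[OF Suc.prems(4)] coeff by (simp add: h_def)
    ultimately show ?thesis by (intro exI[of _ "h j"] conjI allI)
  qed
qed simp

section \<open>Independence of the ordered monomials\<close>

definition endo_ring :: "'e endo ring"
  where "endo_ring = \<lparr>carrier = UNIV, monoid.mult = (*), one = 1, ring.zero = 0, add = (+)\<rparr>"

lemma endo_ring_simps [simp]: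
  "carrier endo_ring = UNIV" "S \<otimes>\<^bsub>endo_ring\<^esub> T = S * T" "S \<oplus>\<^bsub>endo_ring\<^esub> T = S + T"
  "\<one>\<^bsub>endo_ring\<^esub> = 1" "\<zero>\<^bsub>endo_ring\<^esub> = 0"
  by (simp_all add: endo_ring_def)

interpretation endo: complex_algebra endo_ring scalar_endo
proof (rule complex_algebra.intro)
  show "ring (endo_ring :: 'e endo ring)"
  proof (rule ringI)
    show "abelian_group (endo_ring :: 'e endo ring)"
    proof (rule abelian_groupI)
      fix T :: "'e endo"
      show "\<exists>S\<in>carrier endo_ring. S \<oplus>\<^bsub>endo_ring\<^esub> T = \<zero>\<^bsub>endo_ring\<^esub>"
        by (intro bexI[of _ "- T"]) simp_all
    qed (simp_all add: add_ac)
    show "Group.monoid (endo_ring :: 'e endo ring)"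
      by (rule monoidI) (simp_all add: mult.assoc)
  qed (simp_all add: algebra_simps)
  show "complex_algebra_axioms (endo_ring :: 'e endo ring) scalar_endo"
  proof (rule complex_algebra_axioms.intro)
    fix a b and T :: "'e endo"
    show "scalar_endo (a + b) = scalar_endo a \<oplus>\<^bsub>endo_ring\<^esub> (scalar_endo b :: 'e endo)"
      by (rule endo_eqI) (simp add: distrib_right)
    show "scalar_endo (a * b) = scalar_endo a \<otimes>\<^bsub>endo_ring\<^esub> (scalar_endo b :: 'e endo)"
      by (rule endo_eqI) simp
    show "scalar_endo 1 = \<one>\<^bsub>endo_ring :: 'e endo ring\<^esub>"
      unfolding endo_ring_simps by (rule endo_eqI) simp
    show "scalar_endo a \<otimes>\<^bsub>endo_ring\<^esub> T = T \<otimes>\<^bsub>endo_ring\<^esub> scalar_endo a"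
      by (simp add: scalar_endo_central)
  qed simp
qed

lemma endo_ring_minus [simp]: "S \<ominus>\<^bsub>endo_ring\<^esub> T = S - T"
proof -
  have "\<ominus>\<^bsub>endo_ring\<^esub> T = - T"
    by (rule endo.minus_equality) simp_all
  then show ?thesis by (simp add: a_minus_def)
qed

definition point_mass :: "lattice \<Rightarrow> complex"
  where "point_mass e = (if e = 0 then 1 else 0)"

definition word_shift :: "nat \<Rightarrow> (nat \<times> nat) free_word \<Rightarrow> lattice"
  where "word_shift n w = (\<Sum>p\<leftarrow>letters w. corner_shift n p)"

definition path_gen :: "complex \<Rightarrow> nat \<Rightarrow> nat \<times> nat \<Rightarrow> lattice endo"
  where "path_gen q n = (\<lambda>(i, j). path_matrix q n n i j)"

lemma word_leading_term:
  assumes q: "q \<noteq> 0" and w: "w \<in> words (mat_indices n)"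
  shows "\<exists>g. (\<forall>e. g e \<noteq> 0) \<and>
    leading_term n (word_product endo_ring (map (path_gen q n) (letters w))) (word_shift n w) g"
proof -
  have "\<exists>g. (\<forall>e. g e \<noteq> 0) \<and> leading_term n (word_product endo_ring (map (path_gen q n) xs)) (\<Sum>p\<leftarrow>xs. corner_shift n p) g"
    if "set xs \<subseteq> mat_indices n" for xs
    using that
  proof (induction xs)
    case Nil
    have "leading_term n 1 0 (\<lambda>e. 1)" by (simp add: leading_term_def)
    then show ?case by (intro exI[of _ "\<lambda>e. 1"]) simp
  next
    case (Cons p xs)
    obtain i j where p: "p = (i, j)" "i \<in> {1..n}" "j \<in> {1..n}"
      using Cons.prems by (cases p) (auto simp: mat_indices_def)
    obtain g h where "\<And>e. g e \<noteq> 0" "leading_term n (path_matrix q n n i j) (corner_shift n p) g"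
      and "\<And>e. h e \<noteq> 0" "leading_term n (word_product endo_ring (map (path_gen q n) xs)) (\<Sum>p\<leftarrow>xs. corner_shift n p) h"
      using path_matrix_leading_term[OF q, of i n n j] Cons p by auto
    then show ?case
      using leading_term_mult[of n "path_matrix q n n i j" "corner_shift n p" g] p
      by (intro exI[of _ "\<lambda>e. g e * h (e - corner_shift n p)"]) (simp add: path_gen_def)
  qed
  from this[of "letters w"] w show ?thesis by (simp add: words_def word_shift_def)
qed

lemma word_shift_inj:
  assumes v: "v \<in> sorted_words (mat_indices n)" and w: "w \<in> sorted_words (mat_indices n)"
    and eq: "word_shift n v = word_shift n w"
  shows "v = w"
proof -
  have count: "Poly_Mapping.lookup (word_shift n u) p = int (count_list (letters u) p)"
    if "u \<in> words (mat_indices n)" "p \<in> mat_indices n" for u p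
  proof -
    have "Poly_Mapping.lookup (\<Sum>p\<leftarrow>xs. corner_shift n p) p = int (count_list xs p)" for xs
      using that(2) by (induction xs) (auto simp: lookup_add lookup_minus corner_shift_def mat_indices_def)
    then show ?thesis by (simp add: word_shift_def)
  qed
  have "count_list (letters v) p = count_list (letters w) p" for p
  proof (cases "p \<in> mat_indices n")
    case True
    then have "int (count_list (letters v) p) = int (count_list (letters w) p)"
      using count[of v p] count[of w p] v w eq by (simp add: sorted_words_def)
    then show ?thesis by simp
  next
    case False
    then have "p \<notin> set (letters v)" "p \<notin> set (letters w)"
      using v w by (auto simp: sorted_words_def words_def)
    then show ?thesis by (simp add: count_list_0_iff[THEN iffD2])
  qed
  with v w show ?thesis by (rule sorted_words_eqI)
qed

text \<open>Among the words occurring in \<open>f\<close> choose \<open>v\<close> of maximal height and apply \<open>f\<close> to the point mass at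
  the origin.  At the point \<open>word_shift n v\<close> the word \<open>v\<close> has a nonzero value, and every other word of \<open>f\<close> vanishes:
  it is not higher, and its own top point is a different one.\<close>

theorem path_monomials_independent:
  assumes q: "q \<noteq> 0" and f: "f \<in> supported_on (sorted_words (mat_indices n))"
    and zero: "free_eval endo_ring scalar_endo (path_gen q n) f = 0"
  shows "f = 0"
proof (rule ccontr)
  assume "f \<noteq> 0"
  then have ne: "Poly_Mapping.keys f \<noteq> {}" by simp
  let ?h = "\<lambda>w. height n (word_shift n w)" and ?W = "\<lambda>w. word_product endo_ring (map (path_gen q n) (letters w))"
  have sorted: "w \<in> sorted_words (mat_indices n)" "w \<in> words (mat_indices n)" if "w \<in> Poly_Mapping.keys f" for w
    using f that by (auto simp: supported_on_def sorted_words_def)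
  define b where "b = Max (?h ` Poly_Mapping.keys f)"
  have "b \<in> ?h ` Poly_Mapping.keys f"
    unfolding b_def using ne by (intro Max_in) auto
  then obtain v where v: "v \<in> Poly_Mapping.keys f" "?h v = b" by auto
  have le: "?h w \<le> b" if "w \<in> Poly_Mapping.keys f" for w
    unfolding b_def using that by (intro Max_ge) auto
  have bound: "bounded_by n 0 point_mass"
    by (simp add: bounded_by_def point_mass_def)
  have value_other: "apply_endo (?W w) point_mass (word_shift n v) = 0" if w: "w \<in> Poly_Mapping.keys f" "w \<noteq> v" for w
  proof -
    obtain g where "leading_term n (?W w) (word_shift n w) g"
      using word_leading_term[OF q sorted(2)[OF w(1)]] by blast
    from leading_termD[OF this bound, of "word_shift n v"] le[OF w(1)] v(2)
    have "apply_endo (?W w) point_mass (word_shift n v) = g (word_shift n v) * point_mass (word_shift n v - word_shift n w)"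
      by simp
    moreover have "word_shift n v \<noteq> word_shift n w"
      using word_shift_inj[OF sorted(1)[OF v(1)] sorted(1)[OF w(1)]] w(2) by blast
    ultimately show ?thesis by (simp add: point_mass_def)
  qed
  have value_v: "apply_endo (?W v) point_mass (word_shift n v) \<noteq> 0"
  proof -
    obtain g where "\<forall>e. g e \<noteq> 0" "leading_term n (?W v) (word_shift n v) g"
      using word_leading_term[OF q sorted(2)[OF v(1)]] by blast
    with leading_termD[OF this(2) bound, of "word_shift n v"] show ?thesis
      by (simp add: point_mass_def)
  qed
  have finsum: "finsum endo_ring u S = sum u S" if "finite S" for u :: "(nat \<times> nat) free_word \<Rightarrow> lattice endo" and S
    using that by (induction S) simp_all
  have "0 = apply_endo (\<Sum>w\<in>Poly_Mapping.keys f. scalar_endo (Poly_Mapping.lookup f w) * ?W w) point_mass (word_shift n v)"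
    using zero by (simp add: free_eval_def finsum)
  also have "\<dots> = (\<Sum>w\<in>Poly_Mapping.keys f. if w = v then Poly_Mapping.lookup f v * apply_endo (?W v) point_mass (word_shift n v) else 0)"
    unfolding apply_endo_sum by (intro sum.cong refl) (simp add: value_other)
  also have "\<dots> = Poly_Mapping.lookup f v * apply_endo (?W v) point_mass (word_shift n v)"
    using v(1) by simp
  finally show False
    using v(1) value_v by (simp add: in_keys_iff)
qed

section \<open>The commutative polynomial ring\<close>

lemma comm_polynomial_ring_simps [simp]:
  "carrier (comm_polynomial_ring I) = supported_on (supported_on I)"
  "f \<otimes>\<^bsub>comm_polynomial_ring I\<^esub> g = f * g" "f \<oplus>\<^bsub>comm_polynomial_ring I\<^esub> g = f + g"
  "\<one>\<^bsub>comm_polynomial_ring I\<^esub> = 1" "\<zero>\<^bsub>comm_polynomial_ring I\<^esub> = 0"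
  by (auto simp: comm_polynomial_ring_def supported_on_def)

lemma comm_polynomial_closed [simp]:
  fixes I :: "'x set" and f g :: "('x \<Rightarrow>\<^sub>0 nat) \<Rightarrow>\<^sub>0 complex"
  shows "f \<in> supported_on (supported_on I) \<Longrightarrow> g \<in> supported_on (supported_on I) \<Longrightarrow>
      f * g \<in> supported_on (supported_on I)"
    "(1 :: ('x \<Rightarrow>\<^sub>0 nat) \<Rightarrow>\<^sub>0 complex) \<in> supported_on (supported_on I)"
    "x \<in> I \<Longrightarrow> poly_var x \<in> supported_on (supported_on I)"
  by (auto intro: supported_on_mult supported_on_closed(3) simp: poly_var_def simp flip: single_one)

definition poly_scalar :: "complex \<Rightarrow> ('x \<Rightarrow>\<^sub>0 nat) \<Rightarrow>\<^sub>0 complex"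
  where "poly_scalar a = Poly_Mapping.single 0 a"

lemma complex_algebra_comm_polynomial_ring: "complex_algebra (comm_polynomial_ring I) poly_scalar"
proof (rule complex_algebra.intro)
  show "ring (comm_polynomial_ring I)"
  proof (rule ringI)
    show "abelian_group (comm_polynomial_ring I)"
    proof (rule abelian_groupI)
      fix f assume "f \<in> carrier (comm_polynomial_ring I)"
      then show "\<exists>g\<in>carrier (comm_polynomial_ring I). g \<oplus>\<^bsub>comm_polynomial_ring I\<^esub> f = \<zero>\<^bsub>comm_polynomial_ring I\<^esub>"
        by (intro bexI[of _ "- f"]) simp_all
    qed (simp_all add: add_ac)
    show "Group.monoid (comm_polynomial_ring I)"
      by (rule monoidI) (simp_all add: mult.assoc)
  qed (simp_all add: algebra_simps)
  show "complex_algebra_axioms (comm_polynomial_ring I) poly_scalar"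
    by (rule complex_algebra_axioms.intro)
      (simp_all add: poly_scalar_def single_add mult_single mult.commute)
qed

definition word_exponent :: "'x free_word \<Rightarrow> 'x \<Rightarrow>\<^sub>0 nat"
  where "word_exponent w = (\<Sum>x\<leftarrow>letters w. Poly_Mapping.single x 1)"

lemma word_exponent_inj:
  assumes "v \<in> sorted_words I" "w \<in> sorted_words I" "word_exponent v = word_exponent w"
  shows "v = w"
proof -
  have "Poly_Mapping.lookup (\<Sum>x\<leftarrow>xs. Poly_Mapping.single x 1) y = count_list xs y" for xs and y :: 'a
    by (induction xs) (simp_all add: lookup_add lookup_single)
  then have "count_list (letters v) y = count_list (letters w) y" for y
    using assms(3) unfolding word_exponent_def by metis
  with assms(1,2) show ?thesis by (rule sorted_words_eqI)
qed

text \<open>Here all exchange coefficients are \<open>1\<close> and there are no correction terms.\<close>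

lemma pbw_algebra_comm_polynomial_ring:
  fixes I :: "'x::linorder set"
  assumes "finite I"
  shows "pbw_algebra (comm_polynomial_ring I) poly_scalar poly_var I (\<lambda>b a. 1)"
proof -
  interpret complex_algebra "comm_polynomial_ring I" poly_scalar
    by (rule complex_algebra_comm_polynomial_ring)
  have gen: "poly_var ` I \<subseteq> carrier (comm_polynomial_ring I)" by auto
  note ev [simp] = free_eval_zero[of poly_var, OF gen] free_eval_add[OF gen] free_eval_mult[OF gen] free_eval_diff[OF gen]
    free_eval_gen[OF gen] free_eval_scalar[OF gen] free_eval_one[OF gen]
  let ?\<phi> = "free_eval (comm_polynomial_ring I) poly_scalar poly_var"
  have mono: "\<exists>f\<in>supported_on (words I). Poly_Mapping.single m (1::complex) = ?\<phi> f" if "m \<in> supported_on I" for m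
    using that
  proof (induction m rule: supported_on_induct)
    case zero
    show ?case by (rule bexI[of _ 1]) simp_all
  next
    case (single x k)
    show ?case
    proof (induction k)
      case 0
      show ?case by (rule bexI[of _ 1]) simp_all
    next
      case (Suc k)
      then obtain f where f: "f \<in> supported_on (words I)" "Poly_Mapping.single (Poly_Mapping.single x k) 1 = ?\<phi> f" by (rule bexE)
      have "Poly_Mapping.single (Poly_Mapping.single x (Suc k)) (1::complex) = poly_var x * Poly_Mapping.single (Poly_Mapping.single x k) 1"
        by (simp add: poly_var_def mult_single flip: single_add)
      then show ?case using f single by (intro bexI[of _ "free_gen x * f"]) simp_all
    qed
  next
    case (add m m')
    obtain f where f: "f \<in> supported_on (words I)" "Poly_Mapping.single m 1 = ?\<phi> f" using add.IH(1) by (rule bexE)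
    obtain f' where f': "f' \<in> supported_on (words I)" "Poly_Mapping.single m' 1 = ?\<phi> f'" using add.IH(2) by (rule bexE)
    have "Poly_Mapping.single (m + m') (1::complex) = Poly_Mapping.single m 1 * Poly_Mapping.single m' 1"
      by (simp add: mult_single)
    then show ?case using f f' by (intro bexI[of _ "f * f'"]) simp_all
  qed
  have surj: "\<exists>f\<in>supported_on (words I). g = ?\<phi> f" if "g \<in> supported_on (supported_on I)" for g
    using that
  proof (induction g rule: supported_on_induct)
    case zero
    show ?case by (rule bexI[of _ 0]) simp_all
  next
    case (single m a)
    obtain f where f: "f \<in> supported_on (words I)" "Poly_Mapping.single m 1 = ?\<phi> f" using mono[OF single] by (rule bexE)
    have "Poly_Mapping.single m a = poly_scalar a * Poly_Mapping.single m 1"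
      by (simp add: poly_scalar_def mult_single)
    then show ?case using f by (intro bexI[of _ "free_scalar a * f"]) simp_all
  next
    case (add g g')
    obtain f where f: "f \<in> supported_on (words I)" "g = ?\<phi> f" using add.IH(1) by (rule bexE)
    obtain f' where f': "f' \<in> supported_on (words I)" "g' = ?\<phi> f'" using add.IH(2) by (rule bexE)
    show ?case using f f' by (intro bexI[of _ "f + f'"]) simp_all
  qed
  have monomial: "word_product (comm_polynomial_ring I) (map poly_var xs) =
      Poly_Mapping.single (\<Sum>x\<leftarrow>xs. Poly_Mapping.single x 1) 1" for xs :: "'x list"
    by (induction xs) (simp_all add: poly_var_def mult_single)
  have coeff: "Poly_Mapping.lookup (?\<phi> f) m = (\<Sum>w\<in>Poly_Mapping.keys f. if word_exponent w = m then Poly_Mapping.lookup f w else 0)"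
    if f: "f \<in> supported_on (words I)" for f m
  proof -
    have finsum: "finsum (comm_polynomial_ring I) u S = sum u S \<and> sum u S \<in> supported_on (supported_on I)"
      if "finite S" "\<And>w. w \<in> S \<Longrightarrow> u w \<in> supported_on (supported_on I)"
      for u :: "'x free_word \<Rightarrow> ('x \<Rightarrow>\<^sub>0 nat) \<Rightarrow>\<^sub>0 complex" and S
      using that
    proof (induction S)
      case (insert w S)
      then show ?case by (simp add: Pi_def)
    qed simp
    let ?u = "\<lambda>w. poly_scalar (Poly_Mapping.lookup f w) * word_product (comm_polynomial_ring I) (map poly_var (letters w))"
    have "?u w \<in> supported_on (supported_on I)" if "w \<in> Poly_Mapping.keys f" for w
    proof -
      have w: "w \<in> words I" using f that by (auto simp: supported_on_def)
      show ?thesis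
        using word_eval_closed[OF gen w] scalar_closed[of "Poly_Mapping.lookup f w"]
        by (intro comm_polynomial_closed) (simp_all only: comm_polynomial_ring_simps)
    qed
    then have "?\<phi> f = (\<Sum>w\<in>Poly_Mapping.keys f. ?u w)"
      using finsum[of "Poly_Mapping.keys f" ?u] by (simp add: free_eval_def)
    also have "\<dots> = (\<Sum>w\<in>Poly_Mapping.keys f. Poly_Mapping.single (word_exponent w) (Poly_Mapping.lookup f w))"
      by (simp add: monomial poly_scalar_def mult_single word_exponent_def)
    finally show ?thesis
      by (simp add: lookup_sum lookup_single when_def)
  qed
  show ?thesis
  proof (rule pbw_algebra.intro)
    show "complex_algebra (comm_polynomial_ring I) (poly_scalar :: complex \<Rightarrow> ('x \<Rightarrow>\<^sub>0 nat) \<Rightarrow>\<^sub>0 complex)"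
      by (rule complex_algebra_comm_polynomial_ring)
    show "pbw_algebra_axioms (comm_polynomial_ring I) poly_scalar poly_var I (\<lambda>b a. 1)"
    proof (rule pbw_algebra_axioms.intro)
      show "finite I" by fact
      show "poly_var ` I \<subseteq> carrier (comm_polynomial_ring I)" by fact
      show "carrier (comm_polynomial_ring I) \<subseteq> ?\<phi> ` supported_on (words I)"
        using surj by (auto simp: image_iff)
      show "\<exists>p\<in>supported_on (words_of_length {x\<in>I. x < b} 2).
        ?\<phi> (free_gen b * free_gen a - free_scalar 1 * free_gen a * free_gen b - p) = \<zero>\<^bsub>comm_polynomial_ring I\<^esub>"
        if "a \<in> I" "b \<in> I" for a b
      proof (rule bexI[of _ 0])
        have "?\<phi> (free_gen b * free_gen a) = ?\<phi> (free_gen a * free_gen b)"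
          using that by (simp add: mult.commute)
        then show "?\<phi> (free_gen b * free_gen a - free_scalar 1 * free_gen a * free_gen b - 0) = \<zero>\<^bsub>comm_polynomial_ring I\<^esub>"
          using that free_eval_closed[OF gen, of "free_gen a * free_gen b"]
          by (simp add: free_scalar_simps r_right_minus_eq del: free_eval_mult comm_polynomial_ring_simps)
      qed simp
      fix f :: "'x free_word \<Rightarrow>\<^sub>0 complex"
      assume f: "f \<in> supported_on (sorted_words I)" and zero: "?\<phi> f = \<zero>\<^bsub>comm_polynomial_ring I\<^esub>"
      have f': "f \<in> supported_on (words I)"
        by (rule subsetD[OF supported_on_mono f]) (auto simp: sorted_words_def)
      show "f = 0"
      proof (rule poly_mapping_eqI)
        fix v
        show "Poly_Mapping.lookup f v = Poly_Mapping.lookup 0 v"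
        proof (cases "v \<in> Poly_Mapping.keys f")
          case True
          have sorted: "w \<in> sorted_words I" if "w \<in> Poly_Mapping.keys f" for w
            using f that by (auto simp: supported_on_def)
          have "0 = (\<Sum>w\<in>Poly_Mapping.keys f. if word_exponent w = word_exponent v then Poly_Mapping.lookup f w else 0)"
            using coeff[OF f', of "word_exponent v"] zero by simp
          also have "\<dots> = (\<Sum>w\<in>Poly_Mapping.keys f. if w = v then Poly_Mapping.lookup f v else 0)"
            using word_exponent_inj[OF sorted sorted[OF True]] by (intro sum.cong refl) auto
          also have "\<dots> = Poly_Mapping.lookup f v" using True by simp
          finally show ?thesis by simp
        qed (simp add: in_keys_iff)
      qed
    qed simp
  qed
qed

section \<open>The quadratic algebra and its weight action\<close>

lemma (in ring) hom_vanishes_on_genideal: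
  assumes h: "h \<in> ring_hom R S" "ring S" and rel: "Rel \<subseteq> carrier R" "\<And>r. r \<in> Rel \<Longrightarrow> h r = \<zero>\<^bsub>S\<^esub>"
    and f: "f \<in> Idl Rel"
  shows "h f = \<zero>\<^bsub>S\<^esub>"
proof -
  have hom: "ring_hom_ring R S h"
    by (rule ring_hom_ringI2[OF ring_axioms h(2,1)])
  have "Rel \<subseteq> a_kernel R S h"
    unfolding a_kernel_def' using rel by blast
  with ring_hom_ring.kernel_is_ideal[OF hom] have "Idl Rel \<subseteq> a_kernel R S h"
    by (rule genideal_minimal)
  then show ?thesis
    using f unfolding a_kernel_def' by blast
qed

locale quantum_matrix_algebra =
  fixes n :: nat and q :: complex
  assumes q: "q \<noteq> 0"
begin

abbreviation "Ix \<equiv> mat_indices n"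
abbreviation "FA \<equiv> free_algebra Ix"

lemma finite_Ix [simp]: "finite Ix" by (simp add: mat_indices_def)

lemma Ix_iff: "(i, j) \<in> Ix \<longleftrightarrow> i \<in> {1..n} \<and> j \<in> {1..n}"
  by (auto simp: mat_indices_def)

lemma Mq_relations_closed: "Mq_relations n q \<subseteq> supported_on (words Ix)"
  unfolding Mq_relations_def by (intro Un_least subsetI; elim CollectE exE conjE; simp add: Ix_iff)

lemma Mq_ideal: "ideal (Mq_ideal n q) FA"
  unfolding Mq_ideal_def
  by (intro ring.genideal_ideal ring_free_algebra) (simp add: carrier_free_algebra Mq_relations_closed)

lemma Mq_relations_in_ideal: "Mq_relations n q \<subseteq> Mq_ideal n q"
  unfolding Mq_ideal_def
  by (intro ring.genideal_self ring_free_algebra) (simp add: carrier_free_algebra Mq_relations_closed)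

text \<open>The path matrix is a representation of the quadratic algebra in which ordered words are independent.\<close>

lemma Mq_monomials_independent:
  assumes f: "f \<in> supported_on (sorted_words Ix)" and zero: "f \<in> Mq_ideal n q"
  shows "f = 0"
proof -
  let ?\<phi> = "free_eval endo_ring scalar_endo (path_gen q n)"
  have gen: "path_gen q n ` Ix \<subseteq> carrier endo_ring" by simp
  note ev = endo.free_eval_add[OF gen] endo.free_eval_mult[OF gen] endo.free_eval_diff[OF gen]
    endo.free_eval_gen[OF gen] endo.free_eval_scalar[OF gen]
  have A: "quantum_matrix (scalar_endo q) (scalar_endo (q - inverse q)) {1..n} {1..n} (path_matrix q n n)"
    by (rule quantum_matrix_path_matrix[OF q])
  have path: "path_gen q n (i, j) = path_matrix q n n i j" for i j
    by (simp add: path_gen_def)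
  have rel: "?\<phi> r = \<zero>\<^bsub>endo_ring\<^esub>" if "r \<in> Mq_relations n q" for r
    using that unfolding Mq_relations_def
  proof (elim UnE CollectE exE conjE)
    fix i j k assume "r = gen i j * gen i k - free_scalar q * gen i k * gen i j"
      and ijk: "i \<in> {1..n}" "j \<in> {1..n}" "k \<in> {1..n}" "j < k"
    then show ?thesis
      using quantum_matrix_relations(1)[OF A ijk] by (simp add: ev Ix_iff path)
  next
    fix i j k assume "r = gen i j * gen k j - free_scalar q * gen k j * gen i j"
      and ijk: "i \<in> {1..n}" "j \<in> {1..n}" "k \<in> {1..n}" "i < k"
    then show ?thesis
      using quantum_matrix_relations(2)[OF A ijk(1,3,2,4)] by (simp add: ev Ix_iff path)
  next
    fix i j s t assume "r = gen i j * gen s t - gen s t * gen i j"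
      and ijst: "i \<in> {1..n}" "j \<in> {1..n}" "s \<in> {1..n}" "t \<in> {1..n}" "i < s" "t < j"
    then show ?thesis
      using quantum_matrix_relations(3)[OF A ijst(1,3,2,4-6)] by (simp add: ev Ix_iff path)
  next
    fix i j s t assume "r = gen i j * gen s t -
         (gen s t * gen i j + free_scalar (q - inverse q) * gen i t * gen s j)"
      and ijst: "i \<in> {1..n}" "j \<in> {1..n}" "s \<in> {1..n}" "t \<in> {1..n}" "i < s" "j < t"
    then show ?thesis
      using quantum_matrix_relations(4)[OF A ijst(1,3,2,4-6)] by (simp add: ev Ix_iff path)
  qed
  have "?\<phi> f = \<zero>\<^bsub>endo_ring\<^esub>"
  proof (rule ring.hom_vanishes_on_genideal[OF ring_free_algebra endo.free_eval_hom[OF gen] endo.ring_axioms _ rel])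
    show "Mq_relations n q \<subseteq> carrier FA"
      unfolding carrier_free_algebra by (rule Mq_relations_closed)
    show "f \<in> Idl\<^bsub>FA\<^esub> (Mq_relations n q)" using zero by (simp only: Mq_ideal_def)
  qed
  then have "?\<phi> f = 0" by simp
  with q f show ?thesis by (rule path_monomials_independent)
qed

lemma ring_Mq: "ring (Mq n q)"
  unfolding Mq_def by (rule ideal.quotient_is_ring[OF Mq_ideal])

lemma Mq_class_hom: "Mq_class n q \<in> ring_hom FA (Mq n q)"
proof -
  have "Mq_class n q = (+>\<^bsub>FA\<^esub>) (Mq_ideal n q)"
    by (rule ext) (simp add: Mq_class_def)
  then show ?thesis
    unfolding Mq_def using ideal.rcos_ring_hom[OF Mq_ideal] by simp
qed

lemma Mq_class_simps [simp]:
  "f \<in> supported_on (words Ix) \<Longrightarrow> Mq_class n q f \<in> carrier (Mq n q)"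
  "f \<in> supported_on (words Ix) \<Longrightarrow> g \<in> supported_on (words Ix) \<Longrightarrow>
    Mq_class n q f \<oplus>\<^bsub>Mq n q\<^esub> Mq_class n q g = Mq_class n q (f + g)"
  "f \<in> supported_on (words Ix) \<Longrightarrow> g \<in> supported_on (words Ix) \<Longrightarrow>
    Mq_class n q f \<otimes>\<^bsub>Mq n q\<^esub> Mq_class n q g = Mq_class n q (f * g)"
  "\<one>\<^bsub>Mq n q\<^esub> = Mq_class n q 1" "\<zero>\<^bsub>Mq n q\<^esub> = Mq_class n q 0"
  using ring_hom_memE[OF Mq_class_hom, unfolded carrier_free_algebra]
    ring_hom_zero[OF Mq_class_hom ring_free_algebra ring_Mq] by (simp_all add: carrier_free_algebra)

lemma Mq_class_eq_zero:
  assumes "f \<in> supported_on (words Ix)"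
  shows "Mq_class n q f = Mq_class n q 0 \<longleftrightarrow> f \<in> Mq_ideal n q"
proof -
  interpret ideal "Mq_ideal n q" FA by (rule Mq_ideal)
  have zero: "Mq_class n q 0 = Mq_ideal n q"
    unfolding Mq_class_simps(5)[symmetric] by (simp add: Mq_def FactRing_def)
  show ?thesis
    unfolding zero using assms a_rcos_zero[OF Mq_ideal, of f] rcos_const_imp_mem[of f]
    by (auto simp: Mq_class_def carrier_free_algebra)
qed

lemma Mq_carrierE:
  assumes "C \<in> carrier (Mq n q)"
  obtains f where "f \<in> supported_on (words Ix)" "C = Mq_class n q f"
  using assms by (auto simp: Mq_def FactRing_def A_RCOSETS_def' Mq_class_def carrier_free_algebra)

definition weight_char :: "weight \<Rightarrow> (nat \<times> nat) free_word \<Rightarrow> complex"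
  where "weight_char l w = q powi pairing l (word_root w)"

lemma free_weight_action_eq: "free_weight_action q l = word_scale (weight_char l)"
  by (rule ext) (simp add: free_weight_action_def word_scale_def weight_char_def)

lemma pairing_zero [simp]: "pairing 0 a = 0" "pairing l 0 = 0"
  by (simp_all add: pairing_def)

lemma weight_char_simps:
  "weight_char l (v + w) = weight_char l v * weight_char l w"
  "weight_char (l + m) w = weight_char l w * weight_char m w"
  "weight_char l 0 = 1" "weight_char 0 w = 1" "weight_char l w \<noteq> 0"
  using q by (simp_all add: weight_char_def word_root_def pairing_add_left pairing_add_right power_int_add)

lemma free_weight_action_simps [simp]:
  "f \<in> supported_on W \<Longrightarrow> free_weight_action q l f \<in> supported_on W"
  "free_weight_action q l (f + g) = free_weight_action q l f + free_weight_action q l g"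
  "free_weight_action q l (f * g) = free_weight_action q l f * free_weight_action q l g"
  "free_weight_action q l 1 = 1" "free_weight_action q l 0 = 0"
  "free_weight_action q (l + m) f = free_weight_action q l (free_weight_action q m f)"
  "free_weight_action q 0 f = f"
proof -
  show "free_weight_action q l (f * g) = free_weight_action q l f * free_weight_action q l g"
    unfolding free_weight_action_eq by (rule word_scale_mult) (rule weight_char_simps)
  show "free_weight_action q l 1 = 1"
    by (simp add: free_weight_action_eq weight_char_simps flip: single_one)
  show "free_weight_action q (l + m) f = free_weight_action q l (free_weight_action q m f)"
  proof -
    have "weight_char (l + m) = (\<lambda>w. weight_char l w * weight_char m w)"
      by (rule ext) (simp add: weight_char_simps)
    then show ?thesis by (simp add: free_weight_action_eq word_scale_compose)
  qed
  have "weight_char 0 = (\<lambda>w. 1)" by (rule ext) (simp add: weight_char_simps)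
  then show "free_weight_action q 0 f = f" by (simp add: free_weight_action_eq)
qed (simp_all add: free_weight_action_eq)

lemma alpha_exchange: "alpha i j + alpha s t = alpha i t + alpha s j"
  by (simp add: alpha_def add_ac)

text \<open>In each relation all words have the same root, by \<open>\<alpha>\<^sub>i\<^sub>j + \<alpha>\<^sub>s\<^sub>t = \<alpha>\<^sub>i\<^sub>t + \<alpha>\<^sub>s\<^sub>j\<close>.\<close>

lemma free_weight_action_relation:
  assumes "r \<in> Mq_relations n q"
  shows "\<exists>a. free_weight_action q l r = free_scalar a * r"
proof -
  have two: "free_weight_action q l (free_scalar c * gen i j * gen s t) =
      free_scalar (q powi pairing l (alpha i j + alpha s t)) * (free_scalar c * gen i j * gen s t)" for c i j s t
    by (simp add: free_weight_action_eq free_scalar_def free_gen_def mult_single weight_char_def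
        word_root_def mult.commute)
  note one = two[of 1, unfolded free_scalar_simps mult_1_left]
  have diff: "free_weight_action q l (f - g) = free_weight_action q l f - free_weight_action q l g" for f g
    by (simp add: free_weight_action_eq)
  from assms show ?thesis
    unfolding Mq_relations_def
  proof (elim UnE CollectE exE conjE)
    fix i j s t assume r: "r = gen i j * gen s t -
         (gen s t * gen i j + free_scalar (q - inverse q) * gen i t * gen s j)"
    show ?thesis
      unfolding r diff free_weight_action_simps(2) one two
      by (intro exI[of _ "q powi pairing l (alpha i j + alpha s t)"])
        (simp add: algebra_simps alpha_exchange[of i j s t] alpha_exchange[of s t i j])
  next
    fix i j k assume r: "r = gen i j * gen i k - free_scalar q * gen i k * gen i j"
    show ?thesis
      unfolding r diff one two
      by (intro exI[of _ "q powi pairing l (alpha i j + alpha i k)"]) (simp add: algebra_simps)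
  next
    fix i j k assume r: "r = gen i j * gen k j - free_scalar q * gen k j * gen i j"
    show ?thesis
      unfolding r diff one two
      by (intro exI[of _ "q powi pairing l (alpha i j + alpha k j)"]) (simp add: algebra_simps)
  next
    fix i j s t assume r: "r = gen i j * gen s t - gen s t * gen i j"
    show ?thesis
      unfolding r diff one two
      by (intro exI[of _ "q powi pairing l (alpha i j + alpha s t)"]) (simp add: algebra_simps)
  qed
qed

lemma free_weight_action_ideal:
  assumes "f \<in> Mq_ideal n q" shows "free_weight_action q l f \<in> Mq_ideal n q"
proof -
  interpret ideal "Mq_ideal n q" FA by (rule Mq_ideal)
  let ?h = "\<lambda>f. Mq_class n q (free_weight_action q l f)"
  have h: "?h \<in> ring_hom FA (Mq n q)"
    by (rule ring_hom_memI) (simp_all add: carrier_free_algebra)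
  have rel: "?h r = \<zero>\<^bsub>Mq n q\<^esub>" if r: "r \<in> Mq_relations n q" for r
  proof -
    obtain a where a: "free_weight_action q l r = free_scalar a * r"
      using free_weight_action_relation[OF r] by blast
    have "r \<in> supported_on (words Ix)" "r \<in> Mq_ideal n q"
      using r Mq_relations_closed Mq_relations_in_ideal by auto
    then have "free_scalar a * r \<in> Mq_ideal n q" "free_scalar a * r \<in> supported_on (words Ix)"
      using I_l_closed[of r "free_scalar a"] by (simp_all add: carrier_free_algebra)
    then show ?thesis by (simp add: a Mq_class_eq_zero)
  qed
  have "?h f = \<zero>\<^bsub>Mq n q\<^esub>"
  proof (rule ring.hom_vanishes_on_genideal[OF ring_free_algebra h ring_Mq _ rel])
    show "Mq_relations n q \<subseteq> carrier FA"
      unfolding carrier_free_algebra by (rule Mq_relations_closed)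
    show "f \<in> Idl\<^bsub>FA\<^esub> (Mq_relations n q)" using assms by (simp only: Mq_ideal_def)
  qed
  moreover have "f \<in> supported_on (words Ix)"
    using assms a_subset by (auto simp only: carrier_free_algebra)
  ultimately show ?thesis by (simp add: Mq_class_eq_zero)
qed

text \<open>The action maps the ideal onto itself because the inverse is the action of \<open>- l\<close>; hence it maps cosets
  onto cosets.\<close>

lemma Mq_weight_action_class:
  assumes "f \<in> supported_on (words Ix)"
  shows "Mq_weight_action q l (Mq_class n q f) = Mq_class n q (free_weight_action q l f)"
proof -
  have coset: "Mq_class n q f = (\<lambda>k. k + f) ` Mq_ideal n q" for f
    unfolding Mq_class_def a_r_coset_def' free_algebra_simps by (rule UNION_singleton_eq_range)
  have onto: "free_weight_action q l ` Mq_ideal n q = Mq_ideal n q"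
  proof (intro antisym subsetI)
    fix k assume k: "k \<in> Mq_ideal n q"
    have "k = free_weight_action q l (free_weight_action q (- l) k)"
      by (simp flip: free_weight_action_simps(6))
    then show "k \<in> free_weight_action q l ` Mq_ideal n q"
      using free_weight_action_ideal[OF k] by (rule image_eqI)
  qed (auto intro: free_weight_action_ideal)
  have "Mq_weight_action q l (Mq_class n q f) = (\<lambda>k. k + free_weight_action q l f) ` (free_weight_action q l ` Mq_ideal n q)"
    by (simp add: Mq_weight_action_def coset image_image)
  then show ?thesis by (simp add: onto coset)
qed

lemma weight_lattice_closed [simp]:
  "0 \<in> weight_lattice n" "l \<in> weight_lattice n \<Longrightarrow> m \<in> weight_lattice n \<Longrightarrow> l + m \<in> weight_lattice n"
proof -
  have "weight_lattice n = supported_on (nodes n)"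
    by (simp add: weight_lattice_def free_Abelian_group_def supported_on_def)
  then show "0 \<in> weight_lattice n" "l \<in> weight_lattice n \<Longrightarrow> m \<in> weight_lattice n \<Longrightarrow> l + m \<in> weight_lattice n"
    by simp_all
qed

lemma smash_action_Mq: "smash_action (Mq n q) (weight_lattice n) (Mq_weight_action q)"
proof (rule smash_action.intro[OF ring_Mq], rule smash_action_axioms.intro)
  fix l m :: weight
  show "Mq_weight_action q l \<in> ring_hom (Mq n q) (Mq n q)"
  proof (rule ring_hom_memI)
    fix C D assume C: "C \<in> carrier (Mq n q)" and D: "D \<in> carrier (Mq n q)"
    obtain f where f: "f \<in> supported_on (words Ix)" "C = Mq_class n q f"
      by (rule Mq_carrierE[OF C])
    obtain g where g: "g \<in> supported_on (words Ix)" "D = Mq_class n q g"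
      by (rule Mq_carrierE[OF D])
    show "Mq_weight_action q l C \<in> carrier (Mq n q)"
      using f by (simp add: Mq_weight_action_class)
    show "Mq_weight_action q l (C \<otimes>\<^bsub>Mq n q\<^esub> D) = Mq_weight_action q l C \<otimes>\<^bsub>Mq n q\<^esub> Mq_weight_action q l D"
      "Mq_weight_action q l (C \<oplus>\<^bsub>Mq n q\<^esub> D) = Mq_weight_action q l C \<oplus>\<^bsub>Mq n q\<^esub> Mq_weight_action q l D"
      using f g by (simp_all add: Mq_weight_action_class)
  qed (simp add: Mq_weight_action_class)
  fix C assume C: "C \<in> carrier (Mq n q)"
  obtain f where f: "f \<in> supported_on (words Ix)" "C = Mq_class n q f"
    by (rule Mq_carrierE[OF C])
  show "Mq_weight_action q 0 C = C"
    "Mq_weight_action q (l + m) C = Mq_weight_action q l (Mq_weight_action q m C)"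
    using f by (simp_all add: Mq_weight_action_class)
qed simp_all

end

context quantum_matrix_algebra
begin

sublocale smash: smash_action "Mq n q" "weight_lattice n" "Mq_weight_action q"
  by (rule smash_action_Mq)

end

context quantum_matrix_algebra
begin

lemma ring_Sq: "ring (Sq n q)"
  unfolding Sq_def by (rule smash.ring_smash_product)

definition tensor :: "free_mat \<Rightarrow> weight \<Rightarrow> smash_elt"
  where "tensor f l = smash_tensor (Mq n q) (Mq_class n q f) l"

lemma tensor_apply: "tensor f l = (\<lambda>m. if m = l then Mq_class n q f else Mq_class n q 0)"
  by (simp add: tensor_def smash_tensor_def cong: if_cong)

lemma tensor_closed [simp]:
  "f \<in> supported_on (words Ix) \<Longrightarrow> l \<in> weight_lattice n \<Longrightarrow> tensor f l \<in> carrier (Sq n q)"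
  unfolding tensor_def Sq_def by (intro smash.smash_tensor_closed) simp_all

lemma tensor_mult [simp]:
  assumes "f \<in> supported_on (words Ix)" "g \<in> supported_on (words Ix)"
    and "l \<in> weight_lattice n" "m \<in> weight_lattice n"
  shows "tensor f l \<otimes>\<^bsub>Sq n q\<^esub> tensor g m = tensor (f * free_weight_action q l g) (l + m)"
  unfolding tensor_def Sq_def
  using assms by (subst smash.smash_tensor_mult) (simp_all add: Mq_weight_action_class)

lemma tensor_add [simp]:
  assumes "f \<in> supported_on (words Ix)" "g \<in> supported_on (words Ix)"
  shows "tensor f l \<oplus>\<^bsub>Sq n q\<^esub> tensor g l = tensor (f + g) l"
  unfolding tensor_def Sq_def using assms by (subst smash.smash_tensor_add) simp_all

lemma Sq_one: "\<one>\<^bsub>Sq n q\<^esub> = tensor 1 0"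
  unfolding tensor_apply Sq_def smash.S_simps by (simp cong: if_cong)

lemma Sq_apply:
  "\<zero>\<^bsub>Sq n q\<^esub> = (\<lambda>l. Mq_class n q 0)" "(x \<oplus>\<^bsub>Sq n q\<^esub> y) l = x l \<oplus>\<^bsub>Mq n q\<^esub> y l"
  unfolding Sq_def smash.S_simps by simp_all

lemma Sq_scalar_eq: "Sq_scalar n q a = tensor (free_scalar a) 0"
  by (simp add: Sq_scalar_def tensor_def)

lemma free_weight_action_scalar [simp]: "free_weight_action q l (free_scalar a) = free_scalar a"
  by (simp add: free_weight_action_eq free_scalar_def weight_char_simps)

end

section \<open>The modified algebra\<close>

locale modified_algebra = quantum_matrix_algebra n q for n q +
  fixes \<zeta> \<xi> :: "nat \<Rightarrow> weight"
  assumes weights: "i \<in> {1..n} \<Longrightarrow> \<zeta> i \<in> weight_lattice n" "i \<in> {1..n} \<Longrightarrow> \<xi> i \<in> weight_lattice n"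
begin

definition gen_weight :: "nat \<times> nat \<Rightarrow> weight"
  where "gen_weight p = \<zeta> (fst p) + \<xi> (snd p)"

definition word_weight :: "(nat \<times> nat) free_word \<Rightarrow> weight"
  where "word_weight w = (\<Sum>p\<leftarrow>letters w. gen_weight p)"

abbreviation "A \<equiv> mod_Mq n q \<zeta> \<xi>"
abbreviation "Z \<equiv> mod_Z n q \<zeta> \<xi>"

lemma gen_weight_closed: "p \<in> Ix \<Longrightarrow> gen_weight p \<in> weight_lattice n"
  by (cases p) (simp add: gen_weight_def Ix_iff weights)

lemma mod_Z_eq:
  assumes "p \<in> Ix" shows "Z p = tensor (free_gen p) (gen_weight p)"
proof -
  obtain i j where p: "p = (i, j)" "i \<in> {1..n}" "j \<in> {1..n}"
    using assms by (cases p) (auto simp: Ix_iff)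
  have "Sq_Z n q i j = tensor (gen i j) 0" "Sq_L n q l = tensor 1 l" for l
    by (simp_all add: Sq_Z_def Sq_L_def tensor_def)
  with p weights show ?thesis
    by (simp add: mod_Z_def gen_weight_def Ix_iff)
qed

lemma generators_closed: "range (Sq_scalar n q) \<union> Z ` Ix \<subseteq> carrier (Sq n q)"
  using gen_weight_closed by (auto simp: Sq_scalar_eq mod_Z_eq simp del: tensor_mult)

lemma A_simps [simp]:
  "x \<otimes>\<^bsub>A\<^esub> y = x \<otimes>\<^bsub>Sq n q\<^esub> y" "x \<oplus>\<^bsub>A\<^esub> y = x \<oplus>\<^bsub>Sq n q\<^esub> y"
  "\<one>\<^bsub>A\<^esub> = \<one>\<^bsub>Sq n q\<^esub>" "\<zero>\<^bsub>A\<^esub> = \<zero>\<^bsub>Sq n q\<^esub>"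
  by (simp_all add: mod_Mq_def)

lemma carrier_A: "carrier A = generate_ring (Sq n q) (range (Sq_scalar n q) \<union> Z ` Ix)"
  by (simp add: mod_Mq_def)

lemma carrier_A_subset: "x \<in> carrier A \<Longrightarrow> x \<in> carrier (Sq n q)"
  unfolding carrier_A by (rule ring.generate_ring_in_carrier[OF ring_Sq generators_closed])

lemma ring_A: "ring A"
  unfolding mod_Mq_def by (rule ring.generate_ring_is_ring[OF ring_Sq generators_closed])

lemma scalar_commutes:
  assumes "x \<in> carrier A"
  shows "Sq_scalar n q a \<otimes>\<^bsub>Sq n q\<^esub> x = x \<otimes>\<^bsub>Sq n q\<^esub> Sq_scalar n q a"
proof -
  interpret Sq: ring "Sq n q" by (rule ring_Sq)
  have s: "Sq_scalar n q a \<in> carrier (Sq n q)" for a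
    using generators_closed by auto
  have mem: "x \<in> carrier (Sq n q)" if "x \<in> generate_ring (Sq n q) (range (Sq_scalar n q) \<union> Z ` Ix)" for x
    using that carrier_A_subset by (simp add: carrier_A)
  show ?thesis
    using assms unfolding carrier_A
  proof (induction x rule: generate_ring.induct)
    case one
    then show ?case using s by simp
  next
    case (incl h)
    then show ?case
    proof
      assume "h \<in> range (Sq_scalar n q)"
      then obtain b where "h = Sq_scalar n q b" by auto
      then show ?thesis
        by (simp add: Sq_scalar_eq mult.commute flip: free_scalar_simps(2))
    next
      assume "h \<in> Z ` Ix"
      then obtain p where "p \<in> Ix" "h = Z p" by auto
      then show ?thesis
        using gen_weight_closed[of p] by (simp add: Sq_scalar_eq mod_Z_eq free_scalar_central[of a "free_gen p"])
    qed
  next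
    case (a_inv h)
    then show ?case using s mem by (simp add: Sq.l_minus Sq.r_minus)
  next
    case (eng_add h h')
    then show ?case using s mem by (simp add: Sq.l_distr Sq.r_distr)
  next
    case (eng_mult h h')
    have "Sq_scalar n q a \<otimes>\<^bsub>Sq n q\<^esub> (h \<otimes>\<^bsub>Sq n q\<^esub> h') = Sq_scalar n q a \<otimes>\<^bsub>Sq n q\<^esub> h \<otimes>\<^bsub>Sq n q\<^esub> h'"
      using s mem eng_mult.hyps by (simp add: Sq.m_assoc)
    also have "\<dots> = h \<otimes>\<^bsub>Sq n q\<^esub> (Sq_scalar n q a \<otimes>\<^bsub>Sq n q\<^esub> h')"
      using s mem eng_mult by (simp add: Sq.m_assoc)
    also have "\<dots> = h \<otimes>\<^bsub>Sq n q\<^esub> h' \<otimes>\<^bsub>Sq n q\<^esub> Sq_scalar n q a"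
      using s mem eng_mult by (simp add: Sq.m_assoc)
    finally show ?case .
  qed
qed

lemma complex_algebra_A: "complex_algebra A (Sq_scalar n q)"
proof (rule complex_algebra.intro[OF ring_A], rule complex_algebra_axioms.intro)
  show "Sq_scalar n q a \<in> carrier A" for a
    unfolding carrier_A by (rule generate_ring.incl) simp
  show "Sq_scalar n q a \<otimes>\<^bsub>A\<^esub> x = x \<otimes>\<^bsub>A\<^esub> Sq_scalar n q a" if "x \<in> carrier A" for a x
    using scalar_commutes[OF that] by simp
qed (simp_all add: Sq_scalar_eq Sq_one free_scalar_simps)

sublocale A: complex_algebra A "Sq_scalar n q"
  by (rule complex_algebra_A)

lemma Z_closed: "Z ` Ix \<subseteq> carrier A"
  unfolding carrier_A by (auto intro: generate_ring.incl)

abbreviation "\<phi> \<equiv> free_eval A (Sq_scalar n q) Z"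

text \<open>The scalar that appears when all \<open>L\<^sub>\<lambda>\<close> in a product of generators are moved to the right.\<close>

fun list_twist :: "(nat \<times> nat) list \<Rightarrow> complex"
  where "list_twist [] = 1"
  | "list_twist (p # ps) = q powi pairing (gen_weight p) (word_root (Word ps)) * list_twist ps"

definition twist :: "weight \<Rightarrow> (nat \<times> nat) free_word \<Rightarrow> complex"
  where "twist l w = (if word_weight w = l then list_twist (letters w) else 0)"

lemma list_twist_nonzero: "list_twist ps \<noteq> 0"
  using q by (induction ps) simp_all

lemma word_weight_closed: "w \<in> words Ix \<Longrightarrow> word_weight w \<in> weight_lattice n"
proof -
  have "set ps \<subseteq> Ix \<Longrightarrow> (\<Sum>p\<leftarrow>ps. gen_weight p) \<in> weight_lattice n" for ps
    by (induction ps) (simp_all add: gen_weight_closed)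
  then show "w \<in> words Ix \<Longrightarrow> word_weight w \<in> weight_lattice n"
    by (simp add: word_weight_def words_def)
qed

lemma word_product_Z:
  "set ps \<subseteq> Ix \<Longrightarrow> word_product A (map Z ps) =
    tensor (Poly_Mapping.single (Word ps) (list_twist ps)) (word_weight (Word ps))"
proof (induction ps)
  case Nil
  have "Poly_Mapping.single (Word []) 1 = (1 :: free_mat)"
    by (simp flip: zero_free_word_def)
  then show ?case by (simp add: Sq_one word_weight_def)
next
  case (Cons p ps)
  have w: "word_weight (Word ps) \<in> weight_lattice n" and p: "p \<in> Ix"
    using Cons.prems word_weight_closed[of "Word ps"] by (simp_all add: words_def)
  have s: "Poly_Mapping.single (Word ps) a \<in> supported_on (words Ix)" for a :: complex
    using Cons.prems by (simp add: words_def)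
  have "word_product A (map Z (p # ps)) = tensor (free_gen p) (gen_weight p) \<otimes>\<^bsub>Sq n q\<^esub>
      tensor (Poly_Mapping.single (Word ps) (list_twist ps)) (word_weight (Word ps))"
    using Cons p by (simp add: mod_Z_eq del: tensor_mult)
  also have "\<dots> = tensor (free_gen p * free_weight_action q (gen_weight p) (Poly_Mapping.single (Word ps) (list_twist ps)))
      (gen_weight p + word_weight (Word ps))"
    using p w s gen_weight_closed by simp
  also have "free_gen p * free_weight_action q (gen_weight p) (Poly_Mapping.single (Word ps) (list_twist ps)) =
      Poly_Mapping.single (Word (p # ps)) (list_twist (p # ps))"
    by (simp add: free_weight_action_eq weight_char_def single_Cons)
  finally show ?case by (simp add: word_weight_def)
qed

text \<open>The coefficient of \<open>L\<^sub>l\<close> collects the words of weight \<open>l\<close>, each multiplied by its twist.\<close>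

lemma eval_apply:
  assumes "f \<in> supported_on (words Ix)"
  shows "\<phi> f l = Mq_class n q (word_scale (twist l) f)"
  using assms
proof (induction f rule: supported_on_induct)
  case zero
  then show ?case by (simp add: A.free_eval_zero[OF Z_closed] Sq_apply)
next
  case (single w a)
  have w: "word_weight w \<in> weight_lattice n" "Poly_Mapping.single w b \<in> supported_on (words Ix)" for b :: complex
    using single word_weight_closed by simp_all
  have "\<phi> (Poly_Mapping.single w a) = tensor (free_scalar a) 0 \<otimes>\<^bsub>Sq n q\<^esub>
      tensor (Poly_Mapping.single w (list_twist (letters w))) (word_weight w)"
    using single word_product_Z[of "letters w"]
    by (simp add: A.free_eval_single[OF Z_closed] Sq_scalar_eq words_def del: tensor_mult)
  also have "\<dots> = tensor (Poly_Mapping.single w (a * list_twist (letters w))) (word_weight w)"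
    using w by (simp add: free_scalar_def mult_single)
  finally show ?case
    by (simp add: tensor_apply twist_def mult.commute)
next
  case (add f g)
  then show ?case
    by (simp add: A.free_eval_add[OF Z_closed] Sq_apply)
qed

lemma eval_zero_iff:
  assumes "f \<in> supported_on (words Ix)"
  shows "\<phi> f = \<zero>\<^bsub>A\<^esub> \<longleftrightarrow> (\<forall>l. word_scale (twist l) f \<in> Mq_ideal n q)"
proof -
  have "\<phi> f = \<zero>\<^bsub>A\<^esub> \<longleftrightarrow> (\<forall>l. \<phi> f l = Mq_class n q 0)"
    by (auto simp: Sq_apply)
  also have "\<dots> \<longleftrightarrow> (\<forall>l. word_scale (twist l) f \<in> Mq_ideal n q)"
    using assms by (simp add: eval_apply Mq_class_eq_zero)
  finally show ?thesis .
qed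

lemma mod_monomials_independent:
  assumes f: "f \<in> supported_on (sorted_words Ix)" and zero: "\<phi> f = \<zero>\<^bsub>A\<^esub>"
  shows "f = 0"
proof (rule poly_mapping_eqI)
  fix w
  have f': "f \<in> supported_on (words Ix)"
    by (rule subsetD[OF supported_on_mono f]) (auto simp: sorted_words_def)
  have "word_scale (twist (word_weight w)) f = 0"
  proof (rule Mq_monomials_independent)
    show "word_scale (twist (word_weight w)) f \<in> Mq_ideal n q"
      using zero unfolding eval_zero_iff[OF f'] by blast
  qed (simp add: f)
  then have "Poly_Mapping.lookup (word_scale (twist (word_weight w)) f) w = 0" by simp
  then show "Poly_Mapping.lookup f w = Poly_Mapping.lookup 0 w"
    by (simp add: twist_def list_twist_nonzero)
qed

lemma scale_two:
  "word_scale (twist l) (free_scalar a * free_gen x * free_gen y) =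
    free_scalar (if gen_weight x + gen_weight y = l then a * q powi pairing (gen_weight x) (alpha (fst y) (snd y)) else 0)
      * free_gen x * free_gen y"
  "word_scale (twist l) (free_gen x * free_gen y) =
    free_scalar (if gen_weight x + gen_weight y = l then q powi pairing (gen_weight x) (alpha (fst y) (snd y)) else 0)
      * free_gen x * free_gen y"
proof -
  have root: "word_root (Word [y]) = alpha (fst y) (snd y)" "word_root (Word []) = 0"
    by (simp_all add: word_root_def case_prod_unfold)
  show "word_scale (twist l) (free_scalar a * free_gen x * free_gen y) =
    free_scalar (if gen_weight x + gen_weight y = l then a * q powi pairing (gen_weight x) (alpha (fst y) (snd y)) else 0)
      * free_gen x * free_gen y" for a
    by (simp add: free_scalar_def free_gen_def mult_single twist_def word_weight_def root plus_free_word_def zero_free_word_def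
        mult.commute[of a])
  from this[of 1] show "word_scale (twist l) (free_gen x * free_gen y) =
    free_scalar (if gen_weight x + gen_weight y = l then q powi pairing (gen_weight x) (alpha (fst y) (snd y)) else 0)
      * free_gen x * free_gen y"
    by (simp add: free_scalar_simps)
qed

text \<open>The words of a relation have the same weight, so for at most one \<open>l\<close> is the twisted relation nonzero,
  and then the exponents of \<open>q\<close> are such that it becomes a multiple of a relation of the quadratic algebra.\<close>

lemma twisted_relation:
  assumes "r \<in> mod_Mq_relations n q \<zeta> \<xi>"
  shows "\<exists>a. \<exists>r'\<in>Mq_relations n q. word_scale (twist l) r = free_scalar a * r'"
proof -
  have pw: "q powi (a - b + 1) * q powi b = q powi a * q" "q powi (a - b) * q powi b = q powi a * 1"
    "x * q powi (a - b) * q powi b = q powi a * x" for a b :: int and x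
    using q by (simp_all add: power_int_add power_int_diff)
  have diff: "free_scalar (a - b) = free_scalar a - free_scalar b" for a b
    by (simp add: free_scalar_def single_diff)
  have comm: "free_scalar a * (free_scalar b * x) = free_scalar b * (free_scalar a * x)" for a b and x :: free_mat
    by (metis free_scalar_central mult.assoc)
  define coeff where "coeff i j s t = (if \<zeta> i + \<xi> j + (\<zeta> s + \<xi> t) = l
    then q powi pairing (\<zeta> i + \<xi> j) (alpha s t) else 0)" for i j s t
  have twist: "(if gen_weight (i, j) + gen_weight (s, t) = l
      then q powi pairing (gen_weight (i, j)) (alpha (fst (s, t)) (snd (s, t))) else 0) = coeff i j s t"
    "(if gen_weight (i', j') + gen_weight (s', t') = l
      then y * q powi pairing (gen_weight (i', j')) (alpha (fst (s', t')) (snd (s', t'))) else 0) = coeff i j s t * z"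
    if "gen_weight (i', j') + gen_weight (s', t') = gen_weight (i, j) + gen_weight (s, t)"
      and "y * q powi pairing (\<zeta> i' + \<xi> j') (alpha s' t') = q powi pairing (\<zeta> i + \<xi> j) (alpha s t) * z"
    for i j s t i' j' s' t' y z
    using that by (simp_all add: coeff_def gen_weight_def)
  from assms show ?thesis
    unfolding mod_Mq_relations_def
  proof (elim UnE CollectE exE conjE)
    fix i j k
    let ?r = "gen i j * gen i k - free_scalar q * gen i k * gen i j"
    let ?c = "q powi (pairing (\<zeta> i + \<xi> j) (alpha i k) - pairing (\<zeta> i + \<xi> k) (alpha i j) + 1)"
    assume r: "r = gen i j * gen i k - free_scalar ?c * gen i k * gen i j"
      and ijk: "i \<in> {1..n}" "j \<in> {1..n}" "k \<in> {1..n}" "j < k"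
    have "word_scale (twist l) r = free_scalar (coeff i j i k) * ?r"
      unfolding r word_scale_simps scale_two twist(1)[OF refl refl]
        twist(2)[of i k i j i j i k ?c q, OF add.commute pw(1)]
      by (simp add: free_scalar_simps right_diff_distrib mult.assoc)
    moreover have "?r \<in> Mq_relations n q" using ijk unfolding Mq_relations_def by blast
    ultimately show ?thesis by blast
  next
    fix i j k
    let ?r = "gen i j * gen k j - free_scalar q * gen k j * gen i j"
    let ?c = "q powi (pairing (\<zeta> i + \<xi> j) (alpha k j) - pairing (\<zeta> k + \<xi> j) (alpha i j) + 1)"
    assume r: "r = gen i j * gen k j - free_scalar ?c * gen k j * gen i j"
      and ijk: "i \<in> {1..n}" "j \<in> {1..n}" "k \<in> {1..n}" "i < k"
    have "word_scale (twist l) r = free_scalar (coeff i j k j) * ?r"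
      unfolding r word_scale_simps scale_two twist(1)[OF refl refl]
        twist(2)[of k j i j i j k j ?c q, OF add.commute pw(1)]
      by (simp add: free_scalar_simps right_diff_distrib mult.assoc)
    moreover have "?r \<in> Mq_relations n q" using ijk unfolding Mq_relations_def by blast
    ultimately show ?thesis by blast
  next
    fix i j s t
    let ?r = "gen i j * gen s t - gen s t * gen i j"
    let ?c = "q powi (pairing (\<zeta> i + \<xi> j) (alpha s t) - pairing (\<zeta> s + \<xi> t) (alpha i j))"
    assume r: "r = gen i j * gen s t - free_scalar ?c * gen s t * gen i j"
      and ijst: "i \<in> {1..n}" "j \<in> {1..n}" "s \<in> {1..n}" "t \<in> {1..n}" "i < s" "t < j"
    have "word_scale (twist l) r = free_scalar (coeff i j s t) * ?r"
      unfolding r word_scale_simps scale_two twist(1)[OF refl refl]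
        twist(2)[of s t i j i j s t ?c 1, OF add.commute pw(2)]
      by (simp add: free_scalar_simps right_diff_distrib mult.assoc)
    moreover have "?r \<in> Mq_relations n q" using ijst unfolding Mq_relations_def by blast
    ultimately show ?thesis by blast
  next
    fix i j s t
    let ?r = "gen i j * gen s t - (gen s t * gen i j + free_scalar (q - inverse q) * gen i t * gen s j)"
    let ?c = "q powi (pairing (\<zeta> i + \<xi> j) (alpha s t) - pairing (\<zeta> s + \<xi> t) (alpha i j))"
    let ?d = "(q - inverse q) * q powi (pairing (\<zeta> i + \<xi> j) (alpha s t) - pairing (\<zeta> i + \<xi> t) (alpha s j))"
    assume r: "r = gen i j * gen s t - (free_scalar ?c * gen s t * gen i j + free_scalar ?d * gen i t * gen s j)"
      and ijst: "i \<in> {1..n}" "j \<in> {1..n}" "s \<in> {1..n}" "t \<in> {1..n}" "i < s" "j < t"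
    have weight: "gen_weight (i, t) + gen_weight (s, j) = gen_weight (i, j) + gen_weight (s, t)"
      by (simp add: gen_weight_def add_ac)
    have "word_scale (twist l) r = free_scalar (coeff i j s t) * ?r"
      unfolding r word_scale_simps scale_two twist(1)[OF refl refl]
        twist(2)[of s t i j i j s t ?c 1, OF add.commute pw(2)]
        twist(2)[of i t s j i j s t ?d "q - inverse q", OF weight pw(3)]
      by (simp add: free_scalar_simps(2-4) diff comm algebra_simps)
    moreover have "?r \<in> Mq_relations n q" using ijst unfolding Mq_relations_def by blast
    ultimately show ?thesis by blast
  qed
qed

abbreviation "mod_ideal \<equiv> Idl\<^bsub>FA\<^esub> (mod_Mq_relations n q \<zeta> \<xi>)"

lemma mod_Mq_relations_closed: "mod_Mq_relations n q \<zeta> \<xi> \<subseteq> supported_on (words Ix)"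
  unfolding mod_Mq_relations_def by (intro Un_least subsetI; elim CollectE exE conjE; simp add: Ix_iff)

lemma mod_ideal: "ideal mod_ideal FA"
  by (intro ring.genideal_ideal ring_free_algebra) (simp add: carrier_free_algebra mod_Mq_relations_closed)

lemma mod_relations_in_ideal: "mod_Mq_relations n q \<zeta> \<xi> \<subseteq> mod_ideal"
  by (intro ring.genideal_self ring_free_algebra) (simp add: carrier_free_algebra mod_Mq_relations_closed)

lemma mod_ideal_subset: "f \<in> mod_ideal \<Longrightarrow> f \<in> supported_on (words Ix)"
  using additive_subgroup.a_subset[OF ideal.axioms(1)[OF mod_ideal]] by (auto simp only: carrier_free_algebra)

lemma eval_mod_ideal:
  assumes "f \<in> mod_ideal" shows "\<phi> f = \<zero>\<^bsub>A\<^esub>"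
proof (rule ring.hom_vanishes_on_genideal[OF ring_free_algebra A.free_eval_hom[OF Z_closed] ring_A _ _ assms])
  show "mod_Mq_relations n q \<zeta> \<xi> \<subseteq> carrier FA"
    unfolding carrier_free_algebra by (rule mod_Mq_relations_closed)
  fix r assume r: "r \<in> mod_Mq_relations n q \<zeta> \<xi>"
  have "word_scale (twist l) r \<in> Mq_ideal n q" for l
  proof -
    obtain a r' where r': "r' \<in> Mq_relations n q" "word_scale (twist l) r = free_scalar a * r'"
      using twisted_relation[OF r] by blast
    have "free_scalar a \<otimes>\<^bsub>FA\<^esub> r' \<in> Mq_ideal n q"
      using r'(1) Mq_relations_in_ideal
      by (intro ideal.I_l_closed[OF Mq_ideal]) (auto simp: carrier_free_algebra)
    then show ?thesis by (simp add: r'(2))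
  qed
  then show "\<phi> r = \<zero>\<^bsub>A\<^esub>"
    using r mod_Mq_relations_closed eval_zero_iff[of r] by blast
qed

definition exchange_exponent :: "nat \<times> nat \<Rightarrow> nat \<times> nat \<Rightarrow> int"
  where "exchange_exponent a b = pairing (gen_weight a) (alpha (fst b) (snd b)) -
    pairing (gen_weight b) (alpha (fst a) (snd a)) + (if fst a = fst b \<or> snd a = snd b then 1 else 0)"

definition exchange_scalar :: "nat \<times> nat \<Rightarrow> nat \<times> nat \<Rightarrow> complex"
  where "exchange_scalar b a = q powi (- exchange_exponent a b)"

text \<open>Each relation for \<open>a < b\<close> is solved for the product \<open>b a\<close>.  In the last family the correction term has the
  letters \<open>(i, t)\<close> and \<open>(s, j)\<close>, which lie below \<open>b = (s, t)\<close>.\<close>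

lemma mod_exchange:
  assumes ab: "a \<in> Ix" "b \<in> Ix" "a < b"
  shows "\<exists>p\<in>supported_on (words_of_length {x\<in>Ix. x < b} 2).
    free_gen b * free_gen a - free_scalar (exchange_scalar b a) * free_gen a * free_gen b - p \<in> mod_ideal"
proof -
  obtain i j s t where a: "a = (i, j)" "i \<in> {1..n}" "j \<in> {1..n}" and b: "b = (s, t)" "s \<in> {1..n}" "t \<in> {1..n}"
    using ab by (cases a, cases b) (auto simp: Ix_iff)
  let ?C = "q powi exchange_exponent a b"
  define r where "r D = gen i j * gen s t - (free_scalar ?C * gen s t * gen i j + free_scalar D * gen i t * gen s j)" for D
  have "\<exists>D. (D = 0 \<or> i < s \<and> j < t) \<and> r D \<in> mod_Mq_relations n q \<zeta> \<xi>"
  proof -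
    consider "i = s" "j < t" | "i < s" "j = t" | "i < s" "t < j" | "i < s" "j < t"
      using ab(3) a(1) b(1) by (cases j t rule: linorder_cases) (auto simp: le_eq_less_or_eq)
    then show ?thesis
    proof cases
      case 1
      have "r 0 = gen i j * gen i t - free_scalar (q powi (pairing (\<zeta> i + \<xi> j) (alpha i t)
          - pairing (\<zeta> i + \<xi> t) (alpha i j) + 1)) * gen i t * gen i j"
        using 1 by (simp add: r_def exchange_exponent_def gen_weight_def a(1) b(1) free_scalar_simps)
      then have "r 0 \<in> mod_Mq_relations n q \<zeta> \<xi>"
        unfolding mod_Mq_relations_def using a b 1 by blast
      then show ?thesis by blast
    next
      case 2
      have "r 0 = gen i j * gen s j - free_scalar (q powi (pairing (\<zeta> i + \<xi> j) (alpha s j)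
          - pairing (\<zeta> s + \<xi> j) (alpha i j) + 1)) * gen s j * gen i j"
        using 2 by (simp add: r_def exchange_exponent_def gen_weight_def a(1) b(1) free_scalar_simps)
      then have "r 0 \<in> mod_Mq_relations n q \<zeta> \<xi>"
        unfolding mod_Mq_relations_def using a b 2 by blast
      then show ?thesis by blast
    next
      case 3
      have "r 0 = gen i j * gen s t - free_scalar (q powi (pairing (\<zeta> i + \<xi> j) (alpha s t)
          - pairing (\<zeta> s + \<xi> t) (alpha i j))) * gen s t * gen i j"
        using 3 by (simp add: r_def exchange_exponent_def gen_weight_def a(1) b(1) free_scalar_simps)
      then have "r 0 \<in> mod_Mq_relations n q \<zeta> \<xi>"
        unfolding mod_Mq_relations_def using a b 3 by blast
      then show ?thesis by blast
    next
      case 4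
      let ?D = "(q - inverse q) * q powi (pairing (\<zeta> i + \<xi> j) (alpha s t) - pairing (\<zeta> i + \<xi> t) (alpha s j))"
      have "r ?D = gen i j * gen s t - (free_scalar (q powi (pairing (\<zeta> i + \<xi> j) (alpha s t)
          - pairing (\<zeta> s + \<xi> t) (alpha i j))) * gen s t * gen i j + free_scalar ?D * gen i t * gen s j)"
        using 4 by (simp add: r_def exchange_exponent_def gen_weight_def a(1) b(1))
      then have "r ?D \<in> mod_Mq_relations n q \<zeta> \<xi>"
        unfolding mod_Mq_relations_def using a b 4 by blast
      then show ?thesis using 4 by blast
    qed
  qed
  then obtain D where D: "D = 0 \<or> i < s \<and> j < t" and rD: "r D \<in> mod_Mq_relations n q \<zeta> \<xi>" by blast
  let ?p = "free_scalar (- (exchange_scalar b a * D)) * gen i t * gen s j"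
  have CC: "exchange_scalar b a * ?C = 1"
    using q by (simp add: exchange_scalar_def power_int_minus)
  have "free_scalar (- exchange_scalar b a) \<otimes>\<^bsub>FA\<^esub> r D \<in> mod_ideal"
    using rD mod_relations_in_ideal
    by (intro ideal.I_l_closed[OF mod_ideal]) (auto simp: carrier_free_algebra)
  moreover have "free_scalar (- exchange_scalar b a) \<otimes>\<^bsub>FA\<^esub> r D =
      free_gen b * free_gen a - free_scalar (exchange_scalar b a) * free_gen a * free_gen b - ?p"
  proof -
    have "free_scalar (exchange_scalar b a) * (free_scalar ?C * gen s t * gen i j) = gen s t * gen i j"
      using CC by (simp add: free_scalar_simps flip: mult.assoc free_scalar_simps(2))
    moreover have "free_scalar (exchange_scalar b a) * (free_scalar D * x) =
        free_scalar D * (free_scalar (exchange_scalar b a) * x)" for x :: free_mat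
      by (metis free_scalar_central mult.assoc)
    ultimately show ?thesis
      by (simp add: r_def a(1) b(1) free_scalar_simps algebra_simps)
  qed
  moreover have "?p \<in> supported_on (words_of_length {x\<in>Ix. x < b} 2)"
    using D a b by (auto simp: free_scalar_def free_gen_def mult_single plus_free_word_def zero_free_word_def
        words_of_length_def words_def Ix_iff)
  ultimately show ?thesis by (intro bexI[of _ ?p]) simp_all
qed

sublocale presented: ordered_rewriting Ix mod_ideal exchange_scalar
  by (rule ordered_rewriting.intro[OF finite_Ix mod_ideal mod_exchange])

lemma carrier_A_eval: "carrier A \<subseteq> \<phi> ` supported_on (words Ix)"
proof
  interpret Sq: ring "Sq n q" by (rule ring_Sq)
  note ev [simp] = A.free_eval_add[OF Z_closed] A.free_eval_mult[OF Z_closed] A.free_eval_gen[OF Z_closed]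
    A.free_eval_scalar[OF Z_closed] A.free_eval_one[OF Z_closed]
  have "\<exists>f\<in>supported_on (words Ix). x = \<phi> f" if "x \<in> carrier A" for x
    using that unfolding carrier_A
  proof (induction x rule: generate_ring.induct)
    case one
    show ?case by (rule bexI[of _ 1]) simp_all
  next
    case (incl h)
    then show ?case
    proof
      assume "h \<in> range (Sq_scalar n q)"
      then obtain a where "h = Sq_scalar n q a" by auto
      then show ?thesis by (intro bexI[of _ "free_scalar a"]) simp_all
    next
      assume "h \<in> Z ` Ix"
      then obtain p where "p \<in> Ix" "h = Z p" by auto
      then show ?thesis by (intro bexI[of _ "free_gen p"]) simp_all
    qed
  next
    case (a_inv h)
    then obtain f where f: "f \<in> supported_on (words Ix)" "h = \<phi> f" by (auto elim: bexE)
    have "\<phi> (- f) \<oplus>\<^bsub>Sq n q\<^esub> \<phi> f = \<phi> 0"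
      using ev(1)[of "- f" f] f(1) by simp
    then have "\<phi> (- f) \<oplus>\<^bsub>Sq n q\<^esub> \<phi> f = \<zero>\<^bsub>Sq n q\<^esub>"
      by (simp add: A.free_eval_zero[OF Z_closed])
    then have "\<ominus>\<^bsub>Sq n q\<^esub> h = \<phi> (- f)"
      using f A.free_eval_closed[OF Z_closed, THEN carrier_A_subset]
      by (intro Sq.minus_equality) simp_all
    then show ?case using f by (intro bexI[of _ "- f"]) simp_all
  next
    case (eng_add h h')
    then obtain f f' where "f \<in> supported_on (words Ix)" "h = \<phi> f" "f' \<in> supported_on (words Ix)" "h' = \<phi> f'"
      by (elim bexE)
    then show ?case by (intro bexI[of _ "f + f'"]) simp_all
  next
    case (eng_mult h h')
    then obtain f f' where "f \<in> supported_on (words Ix)" "h = \<phi> f" "f' \<in> supported_on (words Ix)" "h' = \<phi> f'"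
      by (elim bexE)
    then show ?case by (intro bexI[of _ "f * f'"]) simp_all
  qed
  then show "x \<in> \<phi> ` supported_on (words Ix)" if "x \<in> carrier A" for x
    using that by (auto simp: image_iff)
qed

lemma pbw_algebra_A: "pbw_algebra A (Sq_scalar n q) Z Ix exchange_scalar"
proof (rule pbw_algebra.intro[OF complex_algebra_A], rule pbw_algebra_axioms.intro)
  show "exchange_scalar b a \<noteq> 0" for a b
    using q by (simp add: exchange_scalar_def)
  show "\<exists>p\<in>supported_on (words_of_length {x\<in>Ix. x < b} 2).
      \<phi> (free_gen b * free_gen a - free_scalar (exchange_scalar b a) * free_gen a * free_gen b - p) = \<zero>\<^bsub>A\<^esub>"
    if "a \<in> Ix" "b \<in> Ix" "a < b" for a b
    using mod_exchange[OF that] eval_mod_ideal by blast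
qed (rule finite_Ix Z_closed carrier_A_eval mod_monomials_independent; assumption)+

text \<open>Modulo the relations every element of the kernel is an ordered combination of words, still in the
  kernel, and therefore zero.\<close>

lemma kernel_eq_mod_ideal: "a_kernel FA A \<phi> = mod_ideal"
proof (intro antisym subsetI)
  fix f assume "f \<in> a_kernel FA A \<phi>"
  then have f: "f \<in> supported_on (words Ix)" "\<phi> f = \<zero>\<^bsub>A\<^esub>"
    unfolding a_kernel_def' carrier_free_algebra by blast+
  obtain g where g: "g \<in> supported_on (sorted_words Ix)" "presented.eqv f g"
    using presented.normal_form[OF finite_Ix order_refl _ f(1)] by blast
  have g': "g \<in> supported_on (words Ix)"
    by (rule subsetD[OF supported_on_mono g(1)]) (auto simp: sorted_words_def)
  have "\<phi> (f - g) = \<zero>\<^bsub>A\<^esub>"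
    using g(2) unfolding presented.eqv_def by (rule eval_mod_ideal)
  then have "\<phi> g = \<zero>\<^bsub>A\<^esub>"
    using f g' A.free_eval_closed[OF Z_closed, of g] A.r_right_minus_eq[of "\<phi> f" "\<phi> g"]
      A.free_eval_closed[OF Z_closed, of f] A.free_eval_diff[OF Z_closed, of f g] by (simp del: A_simps)
  then have "g = 0" using g(1) by (intro mod_monomials_independent)
  then show "f \<in> mod_ideal" using g(2) by (simp add: presented.eqv_def)
next
  fix f assume "f \<in> mod_ideal"
  then show "f \<in> a_kernel FA A \<phi>"
    unfolding a_kernel_def' carrier_free_algebra using mod_ideal_subset eval_mod_ideal by blast
qed

lemma defining_relations_A: "defining_relations A (Sq_scalar n q) Ix Z (mod_Mq_relations n q \<zeta> \<xi>)"
  unfolding defining_relations_def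
proof (intro conjI)
  show "\<phi> \<in> ring_hom FA A" by (rule A.free_eval_hom[OF Z_closed])
  show "\<phi> ` carrier FA = carrier A"
    unfolding carrier_free_algebra using carrier_A_eval A.free_eval_closed[OF Z_closed] by blast
  show "a_kernel FA A \<phi> = mod_ideal" by (rule kernel_eq_mod_ideal)
qed

end

theorem theorem2p4:
  fixes n :: nat and q :: complex and \<zeta> \<xi> :: "nat \<Rightarrow> weight"
  assumes "n \<ge> 1" and "q \<noteq> 0" and "q ^ 2 \<noteq> 1"
    and "\<forall>i\<in>{1..n}. \<zeta> i \<in> weight_lattice n"
    and "\<forall>i\<in>{1..n}. \<xi> i \<in> weight_lattice n"
  shows "iterated_Ore_extension (mod_Mq n q \<zeta> \<xi>) (range (Sq_scalar n q)) (carrier (mod_Mq n q \<zeta> \<xi>))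
    \<and> noncomm_domain (mod_Mq n q \<zeta> \<xi>)
    \<and> (\<exists>h :: nat fps.
         has_Hilbert_series (mod_Mq n q \<zeta> \<xi>) (range (Sq_scalar n q))
           (mod_Z n q \<zeta> \<xi> ` mat_indices n) h \<and>
         has_Hilbert_series (comm_polynomial_ring (mat_indices n)) poly_scalars
           (poly_var ` mat_indices n) h)
    \<and> defining_relations (mod_Mq n q \<zeta> \<xi>) (Sq_scalar n q) (mat_indices n) (mod_Z n q \<zeta> \<xi>)
        (mod_Mq_relations n q \<zeta> \<xi>)"
proof -
  interpret modified_algebra n q \<zeta> \<xi>
    using assms by unfold_locales auto
  interpret pbw: pbw_algebra A "Sq_scalar n q" Z Ix exchange_scalar
    by (rule pbw_algebra_A)
  interpret poly: pbw_algebra "comm_polynomial_ring Ix" poly_scalar poly_var Ix "\<lambda>b a. 1"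
    by (rule pbw_algebra_comm_polynomial_ring[OF finite_Ix])
  have "poly_scalars = range poly_scalar"
    by (simp add: poly_scalars_def poly_scalar_def[abs_def])
  note poly_series = poly.has_Hilbert_series_sorted_words[folded this]
  show ?thesis
    by (intro conjI exI[of _ "Abs_fps (\<lambda>d. card (sorted_words Ix \<inter> words_of_length Ix d))"] pbw.iterated_Ore_extension_carrier pbw.noncomm_domain
        pbw.has_Hilbert_series_sorted_words poly_series defining_relations_A)
qed

end
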